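(* Let $\widehat{\mu}(n)=\pi\sqrt{n}$, $\widehat{T}(n)=\frac{1}{8n}\bigl(1-\frac{1}{\widehat{\mu}(n)}\bigr)e^{\widehat{\mu}(n)}$, $\widehat{R}(n)=\overline{p}(n)-\widehat{T}(n)$ and $\widehat{y}_n=\widehat{R}(n)/\widehat{T}(n)$. For each integer $m\geq 2$ let $N_0(m)=2m\log m-m\log\log m$ and \[ N_1(m)=\max\Bigl\{184,\ \frac{9}{4\pi^2}N_0(m)^2\Bigr\}. \] Then for every integer $m\geq 2$ and every integer $n\geq N_1(m)$, \[ |\widehat{y}_n|<\Bigl(\frac{3}{2}\Bigr)^{m+1}\widehat{\mu}(n)^{-m}. \]
   Context: An overpartition of a nonnegative integer $n$ is a partition of $n$ in which the first occurrence of each distinct part may be overlined; $\overline{p}(n)$ denotes the number of overpartitions of $n$. $\log$ is the natural logarithm. *)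

theory Defs
  imports "HOL-Analysis.Analysis" "HOL-Library.Multiset"
begin

definition partitions_of :: "nat \<Rightarrow> nat multiset set" where
  "partitions_of n = {M. 0 \<notin># M \<and> \<Sum>\<^sub># M = n}"

text \<open>
  In an overpartition only the first occurrence of each distinct part can carry an overline,
  so the overlining amounts to an arbitrary set S of distinct parts of the partition M.
\<close>

definition overpartitions :: "nat \<Rightarrow> (nat multiset \<times> nat set) set" where
  "overpartitions n = {(M, S). M \<in> partitions_of n \<and> S \<subseteq> set_mset M}"

definition pbar :: "nat \<Rightarrow> nat" where
  "pbar n = card (overpartitions n)"

text \<open>The set is finite, so its cardinality is not the default value 0.\<close>

lemma finite_overpartitions: "finite (overpartitions n)"
proof -
  have part: "set_mset M \<subseteq> {..n} \<and> size M \<le> n" if "M \<in> partitions_of n" for M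
  proof -
    have "size K \<le> \<Sum>\<^sub># K" if "0 \<notin># K" for K :: "nat multiset"
      using that by (induction K) auto
    moreover have "x \<le> \<Sum>\<^sub># M" if "x \<in># M" for x
      using multi_member_split[OF that] by auto
    ultimately show ?thesis
      using that by (auto simp: partitions_of_def)
  qed
  have "partitions_of n \<subseteq> mset ` {xs. set xs \<subseteq> {..n} \<and> length xs \<le> n}"
  proof
    fix M assume M: "M \<in> partitions_of n"
    obtain xs where xs: "mset xs = M" using ex_mset by blast
    have "set xs \<subseteq> {..n}" "length xs \<le> n"
      using part[OF M] unfolding xs[symmetric] by auto
    then show "M \<in> mset ` {xs. set xs \<subseteq> {..n} \<and> length xs \<le> n}"
      using xs by blast
  qed
  then have "finite (partitions_of n)"
    by (rule finite_subset) (simp add: finite_lists_length_le)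
  moreover have "overpartitions n \<subseteq> partitions_of n \<times> Pow {..n}"
    unfolding overpartitions_def using part by blast
  ultimately show ?thesis
    by (meson finite_Pow_iff finite_SigmaI finite_atMost finite_subset)
qed

definition mu_hat :: "nat \<Rightarrow> real" where
  "mu_hat n = pi * sqrt (real n)"

definition T_hat :: "nat \<Rightarrow> real" where
  "T_hat n = 1 / (8 * real n) * (1 - 1 / mu_hat n) * exp (mu_hat n)"

definition R_hat :: "nat \<Rightarrow> real" where
  "R_hat n = real (pbar n) - T_hat n"

definition y_hat :: "nat \<Rightarrow> real" where
  "y_hat n = R_hat n / T_hat n"

definition N0 :: "nat \<Rightarrow> real" where
  "N0 m = 2 * real m * ln (real m) - real m * ln (ln (real m))"

definition N1 :: "nat \<Rightarrow> real" where
  "N1 m = max 184 (9 / (4 * pi\<^sup>2) * (N0 m)\<^sup>2)"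

end

theory Submission
  imports Defs
    "HOL-Complex_Analysis.Complex_Analysis"
    "HOL-Real_Asymp.Real_Asymp"
    "HOL-Probability.Distributions"
begin

text \<open>
  The generating function of overpartitions is 1/theta4 with theta4(q) the sum of (-1)^k q^(k^2) over
  all integers k. With q = exp(-pi t), Cauchy's formula on Re t = y := 1/(6 sqrt n) gives
  pbar n as the integral of exp(pi n t)/theta4(t); this abscissa is the saddle point of the cusps of
  denominator 3. Near t = 0 the inversion formula replaces 1/theta4(t) by sqrt t exp(pi/(4t))/2 up to a
  bounded error, and the integral of this function, computed with a primitive of exp(z^2), is T_hat n up to
  boundary terms. Everywhere else, reduction of t modulo SL(2,Z) bounds 1/theta4: the cusps of
  denominator 3 contribute Gaussian integrals of total size at most 2.2 exp(mu_hat n/3)/(8n), and all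
  other points contribute only the order exp(0.227 mu_hat n). Hence
  |R_hat n| < 4.5 exp(-2 mu_hat n/3) T_hat n, and n \<ge> N1 m makes x = 2 mu_hat n/3
  so large that 3 x^m \<le> exp x.
\<close>

section \<open>Generating function of overpartitions\<close>

text \<open>On the line Re t = y, the integrand near a cusp of odd denominator c (with even
  numerator) has logarithm about pi n y + pi/(4 c^2 y). This is least at y = 1/(2 c sqrt n), with
  value mu_hat n / c. The error must be of size exp(mu_hat n / 3)/n up to a constant, so c = 3
  dictates y. At this y the cusp 0 (c = 1) makes the integrand as large as exp(5 mu_hat n / 3), far
  above T_hat n. Absolute values are useless there, which is why the main arc is integrated by a
  primitive. At c = 3 the supremum times the length of the arc would lose a power of n; the Gaussian
  profile, of width y^(3/2), recovers it. From c = 5 on the exponent is at most (1/6 + 3/50) mu_hat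
  n and crude bounds do. The constant 4.5 is what the claim permits: with x = 2 mu_hat n / 3 and 3
  x^m <= exp x, one has 4.5 exp(-x) <= 1.5 x^(-m), which is (3/2)^(m+1) (mu_hat n)^(-m). The
  estimates add up to 4.21 for n >= 184, so little can be wasted in the constants.\<close>

definition overpartitions_le :: "nat \<Rightarrow> nat \<Rightarrow> (nat multiset \<times> nat set) set" where
  "overpartitions_le k n = {(M, S). (M, S) \<in> overpartitions n \<and> set_mset M \<subseteq> {..k}}"

text \<open>Bounding the largest part makes the generating function a finite product, which
  induction on k can build. Letting k grow at the end replaces all work with infinite
  products.\<close>

definition pbar_le :: "nat \<Rightarrow> nat \<Rightarrow> nat" where
  "pbar_le k n = card (overpartitions_le k n)"

lemma overpartitions_le_subset: "overpartitions_le k n \<subseteq> overpartitions n"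
  by (auto simp: overpartitions_le_def)

lemma finite_overpartitions_le: "finite (overpartitions_le k n)"
  using finite_subset[OF overpartitions_le_subset finite_overpartitions] .

lemma pbar_le_le: "pbar_le k n \<le> pbar n"
  unfolding pbar_le_def pbar_def
  by (rule card_mono[OF finite_overpartitions overpartitions_le_subset])

lemma pbar_le_eq:
  assumes "n \<le> k"
  shows "pbar_le k n = pbar n"
proof -
  have "set_mset M \<subseteq> {..k}" if "M \<in> partitions_of n" for M
  proof
    fix x assume "x \<in># M"
    then obtain K where "M = add_mset x K" using multi_member_split by metis
    with that assms show "x \<in> {..k}" by (auto simp: partitions_of_def)
  qed
  then have "overpartitions_le k n = overpartitions n"
    by (auto simp: overpartitions_le_def overpartitions_def)
  then show ?thesis by (simp add: pbar_le_def pbar_def)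
qed

lemma pbar_le_0: "pbar_le 0 n = (if n = 0 then 1 else 0)"
proof -
  have "set_mset M \<subseteq> {..0} \<Longrightarrow> 0 \<notin># M \<Longrightarrow> M = {#}" for M :: "nat multiset"
    by (metis atMost_0 multiset_nonemptyE singletonD subsetD)
  then have "M = {#}" if "M \<in> partitions_of n" "set_mset M \<subseteq> {..0}" for M
    using that by (simp add: partitions_of_def)
  then have "overpartitions_le 0 n = (if n = 0 then {({#}, {})} else {})"
    by (force simp: overpartitions_le_def overpartitions_def partitions_of_def)
  then show ?thesis by (simp add: pbar_le_def)
qed

text \<open>The three sets sort an overpartition by how the part \<open>Suc k\<close> occurs: not at
  all; such that deleting one copy leaves every overlined part present; exactly once and overlined.
  In generating functions this reads F(k+1) = F(k) + z^(k+1) F(k+1) + z^(k+1) F(k), that is (1 -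
  z^(k+1)) F(k+1) = (1 + z^(k+1)) F(k).\<close>

lemma overpartitions_le_Suc:
  assumes "Suc k \<le> n"
  shows "overpartitions_le (Suc k) n = overpartitions_le k n \<union>
    (\<lambda>(M, S). (add_mset (Suc k) M, S)) ` overpartitions_le (Suc k) (n - Suc k) \<union>
    (\<lambda>(M, S). (add_mset (Suc k) M, insert (Suc k) S)) ` overpartitions_le k (n - Suc k)"
    (is "?L = ?A \<union> ?B \<union> ?C")
proof
  show "?L \<subseteq> ?A \<union> ?B \<union> ?C"
  proof clarify
    fix M S assume MS: "(M, S) \<in> ?L" and nB: "(M, S) \<notin> ?C" "(M, S) \<notin> ?B"
    show "(M, S) \<in> ?A"
    proof (cases "Suc k \<in># M")
      case False
      then have "set_mset M \<subseteq> {..k}" using MS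
        by (force simp: overpartitions_le_def le_Suc_eq)
      then show ?thesis using MS by (auto simp: overpartitions_le_def)
    next
      case True
      then obtain K where K: "M = add_mset (Suc k) K" using multi_member_split by metis
      have sum: "\<Sum>\<^sub># K = n - Suc k" and S: "S \<subseteq> insert (Suc k) (set_mset K)"
        and K0: "0 \<notin># K" "set_mset K \<subseteq> {..Suc k}"
        using MS K by (auto simp: overpartitions_le_def overpartitions_def partitions_of_def)
      show ?thesis
      proof (cases "S \<subseteq> set_mset K")
        case True
        then have "(K, S) \<in> overpartitions_le (Suc k) (n - Suc k)"
          using sum K0 by (auto simp: overpartitions_le_def overpartitions_def partitions_of_def)
        then have "(M, S) \<in> ?B" using K by force
        then show ?thesis using nB by blast
      next
        case False
        then have s: "Suc k \<in> S" "Suc k \<notin># K" using S by auto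
        then have "set_mset K \<subseteq> {..k}" using K0 by (force simp: le_Suc_eq)
        then have "(K, S - {Suc k}) \<in> overpartitions_le k (n - Suc k)"
          using sum K0 S by (auto simp: overpartitions_le_def overpartitions_def partitions_of_def)
        then have "(M, S) \<in> ?C" using K s(1) by (force simp: insert_absorb)
        then show ?thesis using nB by blast
      qed
    qed
  qed
  show "?A \<union> ?B \<union> ?C \<subseteq> ?L"
    using assms by (force simp: overpartitions_le_def overpartitions_def partitions_of_def)
qed

lemma pbar_le_Suc:
  "pbar_le (Suc k) n = pbar_le k n +
    (if Suc k \<le> n then pbar_le (Suc k) (n - Suc k) + pbar_le k (n - Suc k) else 0)"
proof (cases "Suc k \<le> n")
  case False
  have "set_mset M \<subseteq> {..k}" if "M \<in> partitions_of n" "set_mset M \<subseteq> {..Suc k}" for M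
  proof
    fix x assume "x \<in># M"
    then obtain K where "M = add_mset x K" using multi_member_split by metis
    with that False show "x \<in> {..k}" by (auto simp: partitions_of_def)
  qed
  then have "overpartitions_le (Suc k) n = overpartitions_le k n"
    by (fastforce simp: overpartitions_le_def overpartitions_def)
  then show ?thesis using False by (simp add: pbar_le_def)
next
  case True
  define f where "f = (\<lambda>(M, S :: nat set). (add_mset (Suc k) M, S))"
  define g where "g = (\<lambda>(M, S). (add_mset (Suc k) M, insert (Suc k) S))"
  let ?A = "overpartitions_le k n"
  let ?B = "overpartitions_le (Suc k) (n - Suc k)" and ?C = "overpartitions_le k (n - Suc k)"
  have "inj_on f ?B" by (auto simp: f_def inj_on_def)
  have notin: "Suc k \<notin> S \<and> Suc k \<notin># M" if "(M, S) \<in> overpartitions_le k j" for M S j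
    using that by (auto simp: overpartitions_le_def overpartitions_def)
  have "inj_on g ?C"
    by (rule inj_onI) (auto simp: g_def insert_ident dest!: notin)
  have BC: "f ` ?B \<inter> g ` ?C = {}"
  proof -
    have False if B: "(M, S) \<in> ?B" and C: "(K, R) \<in> ?C" and fg: "f (M, S) = g (K, R)" for M S K R
    proof -
      have "M = K" "S = insert (Suc k) R" using fg by (auto simp: f_def g_def)
      moreover have "S \<subseteq> set_mset M" using B by (auto simp: overpartitions_le_def overpartitions_def)
      ultimately show False using notin[OF C] by auto
    qed
    then show ?thesis
      by (intro equals0I, elim IntE imageE) (metis surj_pair)
  qed
  have A: "?A \<inter> (f ` ?B \<union> g ` ?C) = {}"
  proof -
    have "Suc k \<notin># fst x" if "x \<in> ?A" for x
      using notin that by (cases x) auto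
    moreover have "Suc k \<in># fst x" if "x \<in> f ` ?B \<union> g ` ?C" for x
      using that by (auto simp: f_def g_def)
    ultimately show ?thesis by blast
  qed
  have "pbar_le (Suc k) n = card (?A \<union> (f ` ?B \<union> g ` ?C))"
    unfolding pbar_le_def overpartitions_le_Suc[OF True] f_def g_def by (simp add: Un_assoc)
  also have "\<dots> = card ?A + (card (f ` ?B) + card (g ` ?C))"
    by (subst card_Un_disjoint[OF _ _ A]; (subst card_Un_disjoint[OF _ _ BC])?)
      (auto simp: finite_overpartitions_le)
  also have "\<dots> = card ?A + (card ?B + card ?C)"
    using \<open>inj_on f ?B\<close> \<open>inj_on g ?C\<close> by (simp add: card_image)
  finally show ?thesis using True by (simp add: pbar_le_def)
qed

section \<open>Power series of the truncated counts, with bounds uniform in k\<close>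

lemma one_minus_power_nonzero:
  fixes z :: complex
  assumes "norm z < 1" "i > 0"
  shows "1 - z ^ i \<noteq> 0" "1 + z ^ i \<noteq> 0"
proof -
  have "norm (z ^ i) < 1" using assms by (simp add: norm_power power_less_one_iff)
  then have "z ^ i \<noteq> 1" "z ^ i \<noteq> - 1"
    using norm_one norm_minus_cancel[of "1::complex"] by force+
  then show "1 - z ^ i \<noteq> 0" "1 + z ^ i \<noteq> 0"
    by (simp_all add: add_eq_0_iff eq_neg_iff_add_eq_0[symmetric])
qed

lemma sum_shift_if:
  fixes f :: "nat \<Rightarrow> 'a :: real_normed_field"
  assumes "(\<lambda>n. f n * z ^ n) sums s"
  shows "(\<lambda>n. (if j \<le> n then f (n - j) else 0) * z ^ n) sums (z ^ j * s)"
proof -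
  have "(\<lambda>n. z ^ j * (f n * z ^ n)) sums (z ^ j * s)" using assms by (rule sums_mult)
  then have "(\<lambda>n. (if j \<le> n + j then f (n + j - j) else 0) * z ^ (n + j)) sums (z ^ j * s)"
    by (simp add: power_add algebra_simps)
  moreover have "(\<Sum>i<j. (if j \<le> i then f (i - j) else 0) * z ^ i) = 0"
    by (rule sum.neutral) simp
  ultimately show ?thesis
    using sums_iff_shift[of "\<lambda>n. (if j \<le> n then f (n - j) else 0) * z ^ n" j "z ^ j * s"] by simp
qed

text \<open>The recurrence bounds a partial sum B of the new series by A + C + r^(k+1) B, with the
  same B on the right because shifting the index only drops nonnegative terms. Solving for B bounds
  all partial sums.\<close>

lemma pbar_le_summable:
  assumes "0 \<le> (r::real)" "r < 1"
  shows "summable (\<lambda>n. real (pbar_le k n) * r ^ n)"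
proof (induction k)
  case 0
  have "(\<lambda>n. real (pbar_le 0 n) * r ^ n) = (\<lambda>n. if n = 0 then 1 else 0)"
    by (auto simp: pbar_le_0)
  then show ?case by simp
next
  case (Suc k)
  let ?j = "Suc k"
  let ?a = "\<lambda>n. real (pbar_le k n) * r ^ n"
  let ?c = "\<lambda>n. (if ?j \<le> n then real (pbar_le k (n - ?j)) else 0) * r ^ n"
  let ?b = "\<lambda>n. real (pbar_le ?j n) * r ^ n"
  let ?d = "\<lambda>n. (if ?j \<le> n then real (pbar_le ?j (n - ?j)) else 0) * r ^ n"
  have sc: "summable ?c"
    using sum_shift_if[of "\<lambda>n. real (pbar_le k n)" r, OF summable_sums[OF Suc]] by (rule sums_summable)
  have b: "?b n = ?a n + ?c n + ?d n" for n
    by (subst pbar_le_Suc) (simp add: algebra_simps)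
  have rj: "r ^ ?j < 1" using assms by (simp add: power_less_one_iff del: power_Suc)
  have d: "(\<Sum>n<N. ?d n) \<le> r ^ ?j * (\<Sum>n<N. ?b n)" for N
  proof -
    have e: "?d n = r ^ ?j * ?b (n - ?j)" if "?j \<le> n" for n
    proof -
      have "r ^ n = r ^ ?j * r ^ (n - ?j)" using that by (metis le_add_diff_inverse power_add)
      then show ?thesis using that by simp
    qed
    have "(\<Sum>n<N. ?d n) = (\<Sum>n\<in>{?j..<N}. ?d n)"
      by (rule sum.mono_neutral_right) auto
    also have "\<dots> = (\<Sum>n\<in>{?j..<N}. r ^ ?j * ?b (n - ?j))"
      by (rule sum.cong[OF refl], rule e) auto
    also have "\<dots> = (\<Sum>n<N - ?j. r ^ ?j * ?b n)"
      by (rule sum.reindex_bij_witness[of _ "\<lambda>n. n + ?j" "\<lambda>n. n - ?j"]) auto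
    also have "\<dots> \<le> (\<Sum>n<N. r ^ ?j * ?b n)"
      using assms by (intro sum_mono2) auto
    finally show ?thesis by (simp add: sum_distrib_left)
  qed
  show ?case
  proof (rule bounded_imp_summable[where B = "(suminf ?a + suminf ?c) / (1 - r ^ ?j)"])
    show "0 \<le> ?b n" for n using assms by simp
    fix N
    have "(\<Sum>n<Suc N. ?b n) = (\<Sum>n<Suc N. ?a n) + (\<Sum>n<Suc N. ?c n) + (\<Sum>n<Suc N. ?d n)"
      unfolding sum.distrib[symmetric] by (rule sum.cong[OF refl b])
    moreover have "(\<Sum>n<Suc N. ?a n) \<le> suminf ?a" "(\<Sum>n<Suc N. ?c n) \<le> suminf ?c"
      using assms by (intro sum_le_suminf Suc sc; simp)+
    ultimately have "(\<Sum>n<Suc N. ?b n) \<le> (suminf ?a + suminf ?c) + r ^ ?j * (\<Sum>n<Suc N. ?b n)"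
      using d[of "Suc N"] by linarith
    then have "(1 - r ^ ?j) * (\<Sum>n<Suc N. ?b n) \<le> suminf ?a + suminf ?c"
      by (simp add: algebra_simps)
    then show "(\<Sum>n\<le>N. ?b n) \<le> (suminf ?a + suminf ?c) / (1 - r ^ ?j)"
      using rj by (simp add: lessThan_Suc_atMost field_simps)
  qed
qed

lemma pbar_le_sums:
  fixes z :: complex
  assumes "norm z < 1"
  shows "(\<lambda>n. of_nat (pbar_le k n) * z ^ n) sums (\<Prod>i=1..k. (1 + z ^ i) / (1 - z ^ i))"
proof (induction k)
  case 0
  have "(\<lambda>n. of_nat (pbar_le 0 n) * z ^ n) = (\<lambda>n. if n = 0 then 1 else 0)"
    by (auto simp: pbar_le_0)
  then show ?case using sums_single[of 0 "\<lambda>_. 1::complex"] by simp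
next
  case (Suc k)
  let ?j = "Suc k"
  let ?A = "\<Prod>i=1..k. (1 + z ^ i) / (1 - z ^ i)"
  let ?b = "\<lambda>n. of_nat (pbar_le ?j n) * z ^ n"
  have "summable (\<lambda>n. norm (?b n))"
    using pbar_le_summable[of "norm z" ?j] assms by (simp add: norm_mult norm_power)
  then have sb: "?b sums suminf ?b" by (rule summable_sums[OF summable_norm_cancel])
  have b: "of_nat (pbar_le ?j n) = of_nat (pbar_le k n) +
        ((if ?j \<le> n then of_nat (pbar_le k (n - ?j)) else 0) +
        (if ?j \<le> n then of_nat (pbar_le ?j (n - ?j)) else (0::complex)))" for n
    by (simp add: pbar_le_Suc[of k n])
  have "(\<lambda>n. of_nat (pbar_le k n) * z ^ n +
        (if ?j \<le> n then of_nat (pbar_le k (n - ?j)) else 0) * z ^ n +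
        (if ?j \<le> n then of_nat (pbar_le ?j (n - ?j)) else 0) * z ^ n) sums
        (?A + z ^ ?j * ?A + z ^ ?j * suminf ?b)"
    using sum_shift_if[of "\<lambda>n. of_nat (pbar_le k n)", OF Suc]
      sum_shift_if[of "\<lambda>n. of_nat (pbar_le ?j n)", OF sb] by (intro sums_add Suc)
  also have "(\<lambda>n. of_nat (pbar_le k n) * z ^ n +
        (if ?j \<le> n then of_nat (pbar_le k (n - ?j)) else 0) * z ^ n +
        (if ?j \<le> n then of_nat (pbar_le ?j (n - ?j)) else 0) * z ^ n) = ?b"
    by (rule ext, subst b) (simp only: distrib_right add.assoc)
  finally have "?b sums (?A + z ^ ?j * ?A + z ^ ?j * suminf ?b)" .
  from sums_unique[OF this]
  have "suminf ?b = ?A + z ^ ?j * ?A + z ^ ?j * suminf ?b" by (rule sym)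
  then have "suminf ?b * (1 - z ^ ?j) = ?A * (1 + z ^ ?j)"
    by (simp add: algebra_simps)
  then have 1: "suminf ?b = ?A * ((1 + z ^ ?j) / (1 - z ^ ?j))"
    using one_minus_power_nonzero[OF assms, of ?j] by (simp add: eq_divide_eq)
  show ?case using sb unfolding 1 by (simp add: mult.commute)
qed

text \<open>Each factor is at most exp (2 r^i / (1 - r)), and the exponents form a geometric series.
  What matters is that the bound is free of k: it survives the limit, both for the generating
  function and for Shanks' identity.\<close>

lemma prod_ratio_bound:
  fixes r :: real
  assumes "0 \<le> r" "r < 1"
  shows "(\<Prod>i=1..k. (1 + r ^ i) / (1 - r ^ i)) \<le> exp (2 / (1 - r)\<^sup>2)"
proof -
  have 1: "(1 + r ^ i) / (1 - r ^ i) \<le> exp (2 / (1 - r) * r ^ i)" if "i \<in> {1..k}" for i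
  proof -
    have ri: "r ^ i \<le> r" using power_decreasing[of 1 i r] that assms by auto
    have "(1 + r ^ i) / (1 - r ^ i) = 1 + 2 / (1 - r ^ i) * r ^ i"
      using ri assms by (simp add: field_simps)
    also have "\<dots> \<le> 1 + 2 / (1 - r) * r ^ i"
      using ri assms by (intro add_left_mono mult_right_mono divide_left_mono mult_pos_pos) auto
    also have "\<dots> \<le> exp (2 / (1 - r) * r ^ i)" by (rule exp_ge_add_one_self)
    finally show ?thesis .
  qed
  have "(\<Prod>i=1..k. (1 + r ^ i) / (1 - r ^ i)) \<le> (\<Prod>i=1..k. exp (2 / (1 - r) * r ^ i))"
    using 1 assms by (intro prod_mono) (auto intro!: divide_nonneg_nonneg simp: power_le_one)
  also have "\<dots> = exp (2 / (1 - r) * (\<Sum>i=1..k. r ^ i))"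
    by (simp add: exp_sum sum_distrib_left)
  also have "\<dots> \<le> exp (2 / (1 - r) * (1 / (1 - r)))"
  proof -
    have "(\<Sum>i=1..k. r ^ i) \<le> (\<Sum>i. r ^ i)"
      using assms by (intro sum_le_suminf summable_geometric) auto
    also have "\<dots> = 1 / (1 - r)" using assms by (simp add: suminf_geometric)
    finally show ?thesis using assms
      by (intro iffD2[OF exp_le_cancel_iff] mult_left_mono) auto
  qed
  finally show ?thesis by (simp add: power2_eq_square)
qed

lemma norm_prod_ratio_bound:
  fixes z :: complex
  assumes "norm z < 1"
  shows "norm (\<Prod>i=1..k. (1 + z ^ i) / (1 - z ^ i)) \<le> exp (2 / (1 - norm z)\<^sup>2)"
    and "norm (\<Prod>i=1..k. (1 - z ^ i) / (1 + z ^ i)) \<le> exp (2 / (1 - norm z)\<^sup>2)"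
proof -
  have n: "norm (1 + z ^ i) \<le> 1 + norm z ^ i" "norm (1 - z ^ i) \<le> 1 + norm z ^ i"
       "1 - norm z ^ i \<le> norm (1 + z ^ i)" "1 - norm z ^ i \<le> norm (1 - z ^ i)" for i
    using norm_triangle_ineq[of 1 "z ^ i"] norm_triangle_ineq4[of 1 "z ^ i"]
      norm_triangle_ineq2[of 1 "- (z ^ i)"] norm_triangle_ineq2[of 1 "z ^ i"]
    by (auto simp: norm_power)
  have p: "0 < 1 - norm z ^ i" if "i \<in> {1..k}" for i
    using that assms by (simp add: power_less_one_iff)
  note b = order_trans[OF _ prod_ratio_bound[of "norm z" k]]
  show "norm (\<Prod>i=1..k. (1 + z ^ i) / (1 - z ^ i)) \<le> exp (2 / (1 - norm z)\<^sup>2)"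
    "norm (\<Prod>i=1..k. (1 - z ^ i) / (1 + z ^ i)) \<le> exp (2 / (1 - norm z)\<^sup>2)"
    using assms unfolding prod_norm[symmetric]
    by (intro b prod_mono conjI; auto simp: norm_divide intro!: frac_le n p)+
qed

text \<open>Up to index N no part exceeds N, so \<open>pbar\<close> may be replaced by
  \<open>pbar_le N\<close>. The whole series of the latter is a finite product, whose bound does not
  depend on N.\<close>

lemma pbar_summable:
  fixes z :: complex
  assumes "norm z < 1"
  shows "summable (\<lambda>n. norm (of_nat (pbar n) * z ^ n))"
proof (rule bounded_imp_summable[where B = "exp (2 / (1 - norm z)\<^sup>2)"])
  let ?r = "norm z"
  fix N
  have "(\<Sum>n\<le>N. norm (of_nat (pbar n) * z ^ n)) = (\<Sum>n\<le>N. real (pbar_le N n) * ?r ^ n)"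
    by (intro sum.cong) (auto simp: norm_mult norm_power pbar_le_eq)
  also have "\<dots> \<le> (\<Sum>n. real (pbar_le N n) * ?r ^ n)"
    using assms by (intro sum_le_suminf pbar_le_summable) auto
  also have "\<dots> = norm (\<Sum>n. of_nat (pbar_le N n) * (of_real ?r :: complex) ^ n)"
  proof -
    have "of_real (\<Sum>n. real (pbar_le N n) * ?r ^ n) = (\<Sum>n. of_nat (pbar_le N n) * (of_real ?r :: complex) ^ n)"
      using assms by (subst suminf_of_real) (auto intro!: pbar_le_summable)
    moreover have "0 \<le> (\<Sum>n. real (pbar_le N n) * ?r ^ n)"
      using assms by (intro suminf_nonneg pbar_le_summable) auto
    ultimately show ?thesis by (metis norm_of_real abs_of_nonneg)
  qed
  also have "\<dots> = norm (\<Prod>i=1..N. (1 + complex_of_real ?r ^ i) / (1 - complex_of_real ?r ^ i))"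
    using pbar_le_sums[of "of_real ?r" N] assms by (simp add: sums_unique[symmetric])
  also have "\<dots> \<le> exp (2 / (1 - norm z)\<^sup>2)"
    using norm_prod_ratio_bound(1)[of "of_real ?r" N] assms by simp
  finally show "(\<Sum>n\<le>N. norm (of_nat (pbar n) * z ^ n)) \<le> exp (2 / (1 - norm z)\<^sup>2)" .
qed simp

text \<open>Shanks' finite form of Gauss's identity; the difference of two consecutive right-hand sides telescopes.\<close>

lemma shanks_identity:
  fixes z :: complex
  assumes "norm z < 1"
  defines "P \<equiv> \<lambda>k. \<Prod>i=1..k. (1 - z ^ i) / (1 + z ^ i)"
  shows "1 + 2 * (\<Sum>s=1..n. (-1) ^ s * z ^ (s\<^sup>2)) =
    (\<Sum>s\<le>n. (-1) ^ s * (2 / (1 + z ^ s)) * (P n / P s) * z ^ (s * (n + 1)))"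
proof (induction n)
  case 0
  show ?case by (simp add: P_def)
next
  case (Suc n)
  let ?m = "Suc n"
  have nz: "1 - z ^ i \<noteq> 0" "1 + z ^ i \<noteq> 0" if "i > 0" for i
    using one_minus_power_nonzero[OF assms(1) that] by auto
  have nz2: "1 + z ^ i \<noteq> 0" for i
    by (cases "i = 0") (auto simp: nz)
  have P0: "P s \<noteq> 0" for s
    using nz by (auto simp: P_def)
  have PS: "P (Suc s) = P s * ((1 - z ^ Suc s) / (1 + z ^ Suc s))" for s
    by (simp add: P_def)
  \<comment> \<open>\<open>U\<close> is found by telescoping in s: up to the factor 2/(1 + z^?m),
    \<open>U (Suc s) - U s\<close> is the change of the s-th summand when n becomes
    \<open>?m\<close>. The value 0 at s = 0 stands for the absent boundary term (the numerator 1 -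
    z^0 vanishes), so only \<open>U ?m\<close> = (-1)^?m z^(?m^2) survives.\<close>
  define U where "U s = (if s = 0 then 0 else (-1) ^ s * (P n / P (s - 1)) * z ^ (s * ?m))" for s
  have step: "(-1) ^ s * (2 / (1 + z ^ s)) * (P ?m / P s) * z ^ (s * (?m + 1))
     - (-1) ^ s * (2 / (1 + z ^ s)) * (P n / P s) * z ^ (s * (n + 1))
     = 2 / (1 + z ^ ?m) * (U (Suc s) - U s)" for s
  proof -
    have "(-1) ^ s * (2 / (1 + z ^ s)) * (P ?m / P s) * z ^ (s * (?m + 1))
     - (-1) ^ s * (2 / (1 + z ^ s)) * (P n / P s) * z ^ (s * (n + 1))
     = (-1) ^ s * (2 / (1 + z ^ s)) * (P n / P s) * z ^ (s * ?m) *
       ((1 - z ^ ?m) / (1 + z ^ ?m) * z ^ s - 1)"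
    proof -
      have gen: "c * d * (p * r / q) * (w * u) - c * d * (p / q) * w = c * d * (p / q) * w * (r * u - 1)"
        for c d p r q w u :: complex by (simp add: divide_inverse algebra_simps)
      have e: "z ^ (s * (?m + 1)) = z ^ (s * ?m) * z ^ s" "n + 1 = ?m"
        by (simp_all only: power_add[symmetric] distrib_left mult_1_right Suc_eq_plus1)
      show ?thesis unfolding e PS by (rule gen)
    qed
    also have "(1 - z ^ ?m) / (1 + z ^ ?m) * z ^ s - 1 =
       - ((1 - z ^ s) + z ^ ?m * (1 + z ^ s)) / (1 + z ^ ?m)"
      using nz2[of ?m] by (simp add: field_simps)
    also have "(-1) ^ s * (2 / (1 + z ^ s)) * (P n / P s) * z ^ (s * ?m) *
       (- ((1 - z ^ s) + z ^ ?m * (1 + z ^ s)) / (1 + z ^ ?m)) =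
       2 / (1 + z ^ ?m) * (- ((-1) ^ s) * (P n / P s) * z ^ (s * ?m) * z ^ ?m
         - (-1) ^ s * (P n / P s * ((1 - z ^ s) / (1 + z ^ s))) * z ^ (s * ?m))"
      using nz2[of ?m] nz2[of s] P0[of s] by (simp add: divide_simps) (simp add: algebra_simps)
    also have "- ((-1) ^ s) * (P n / P s) * z ^ (s * ?m) * z ^ ?m = U (Suc s)"
      by (simp add: U_def power_add)
    also have "(-1) ^ s * (P n / P s * ((1 - z ^ s) / (1 + z ^ s))) * z ^ (s * ?m) = U s"
    proof (cases s)
      case (Suc t)
      then show ?thesis using P0[of t] nz[of s] PS[of t] by (simp add: U_def)
    qed (simp add: U_def)
    finally show ?thesis .
  qed
  have "(\<Sum>s\<le>n. (-1) ^ s * (2 / (1 + z ^ s)) * (P ?m / P s) * z ^ (s * (?m + 1)))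
    - (\<Sum>s\<le>n. (-1) ^ s * (2 / (1 + z ^ s)) * (P n / P s) * z ^ (s * (n + 1)))
    = 2 / (1 + z ^ ?m) * (\<Sum>s<?m. U (Suc s) - U s)"
    unfolding sum_subtractf[symmetric] step sum_distrib_left by (simp add: lessThan_Suc_atMost)
  also have "(\<Sum>s<?m. U (Suc s) - U s) = U ?m"
    unfolding sum_lessThan_telescope by (simp add: U_def)
  also have "U ?m = (-1) ^ ?m * z ^ (?m\<^sup>2)"
    using P0[of n] by (simp add: U_def power2_eq_square)
  finally have 1: "(\<Sum>s\<le>n. (-1) ^ s * (2 / (1 + z ^ s)) * (P ?m / P s) * z ^ (s * (?m + 1))) =
    1 + 2 * (\<Sum>s=1..n. (-1) ^ s * z ^ (s\<^sup>2)) + 2 / (1 + z ^ ?m) * ((-1) ^ ?m * z ^ (?m\<^sup>2))"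
    unfolding Suc by (simp add: algebra_simps)
  \<comment> \<open>The telescoped remainder and the new summand s = \<open>?m\<close> share the
    factor 2/(1 + z^?m); their weights 1 and z^?m add up to its denominator.\<close>
  have 2: "2 / (1 + z ^ ?m) * ((-1) ^ ?m * z ^ (?m\<^sup>2)) +
     (-1) ^ ?m * (2 / (1 + z ^ ?m)) * (P ?m / P ?m) * z ^ (?m * (?m + 1)) = 2 * ((-1) ^ ?m * z ^ (?m\<^sup>2))"
  proof -
    have e: "z ^ (?m * (?m + 1)) = z ^ (?m\<^sup>2) * z ^ ?m"
      by (simp only: power_add[symmetric] power2_eq_square distrib_left mult_1_right)
    show ?thesis unfolding e
      using P0[of ?m] nz2[of ?m] by (simp add: divide_simps del: power_Suc) (simp add: algebra_simps del: power_Suc)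
  qed
  show ?case
    unfolding sum.atMost_Suc 1 add.assoc 2 by (simp add: algebra_simps)
qed

text \<open>In Shanks' identity the summand s = 0 is exactly \<open>P n\<close>. Each of the other n
  summands contains z^(s(n+1)) and is therefore O(r^n), so the difference is O(n r^n).\<close>

lemma gauss_identity_limit:
  fixes z :: complex
  assumes z: "norm z < 1"
  defines "P \<equiv> \<lambda>k. \<Prod>i=1..k. (1 - z ^ i) / (1 + z ^ i)"
  shows "(\<lambda>n. 1 + 2 * (\<Sum>s=1..n. (-1) ^ s * z ^ (s\<^sup>2)) - P n) \<longlonglongrightarrow> 0"
proof -
  define r where "r = norm z"
  define K where "K = exp (2 / (1 - r)\<^sup>2)"
  have r: "0 \<le> r" "r < 1" using z by (auto simp: r_def)
  have nz: "1 - z ^ i \<noteq> 0" "1 + z ^ i \<noteq> 0" if "i > 0" for i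
    using one_minus_power_nonzero[OF z that] by auto
  have bP: "norm (P n) \<le> K" for n
    using norm_prod_ratio_bound(2)[OF z] by (simp add: P_def K_def r_def)
  have bQ: "norm (1 / P n) \<le> K" for n
  proof -
    have "1 / P n = (\<Prod>i=1..n. (1 + z ^ i) / (1 - z ^ i))"
      by (simp add: P_def prod_dividef)
    then show ?thesis using norm_prod_ratio_bound(1)[OF z, of n] by (simp add: K_def r_def)
  qed
  have bound: "norm (1 + 2 * (\<Sum>s=1..n. (-1) ^ s * z ^ (s\<^sup>2)) - P n) \<le> 2 / (1 - r) * K * K * (real n * r ^ n)" for n
  proof -
    let ?f = "\<lambda>s. (-1) ^ s * (2 / (1 + z ^ s)) * (P n / P s) * z ^ (s * (n + 1))"
    have "(\<Sum>s\<le>n. ?f s) = ?f 0 + (\<Sum>s=1..n. ?f s)"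
    proof -
      have "{..n} = insert 0 {1..n}" by auto
      then show ?thesis by (simp only: sum.insert finite_atLeastAtMost) simp
    qed
    also have "?f 0 = P n" by (simp add: P_def)
    finally have "1 + 2 * (\<Sum>s=1..n. (-1) ^ s * z ^ (s\<^sup>2)) - P n = (\<Sum>s=1..n. ?f s)"
      using shanks_identity[OF z, of n] by (simp add: P_def)
    also have "norm \<dots> \<le> (\<Sum>s=1..n. 2 / (1 - r) * K * K * r ^ n)"
    proof (rule sum_norm_le)
      fix s assume s: "s \<in> {1..n}"
      have "r ^ s \<le> r" using power_decreasing[of 1 s r] r s by auto
      moreover have "1 - r ^ s \<le> norm (1 + z ^ s)"
        using norm_triangle_ineq2[of 1 "- (z ^ s)"] by (simp add: norm_power r_def)
      ultimately have a: "norm (2 / (1 + z ^ s)) \<le> 2 / (1 - r)"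
        using r by (simp add: norm_divide frac_le)
      have "norm (P n / P s) = norm (P n) * norm (1 / P s)" by (simp add: norm_divide)
      also have "\<dots> \<le> K * K" using bP bQ by (intro mult_mono) (auto simp: K_def)
      finally have b: "norm (P n / P s) \<le> K * K" .
      have "n \<le> s * (n + 1)" using s by (cases s) auto
      then have c: "norm (z ^ (s * (n + 1))) \<le> r ^ n"
        unfolding norm_power r_def[symmetric] using r by (intro power_decreasing) auto
      have "norm (?f s) = norm (2 / (1 + z ^ s)) * norm (P n / P s) * norm (z ^ (s * (n + 1)))"
        unfolding norm_mult by (simp only: norm_power norm_minus_cancel norm_one power_one mult_1_left)
      also have "\<dots> \<le> 2 / (1 - r) * (K * K) * r ^ n"
        using a b c r by (intro mult_mono mult_nonneg_nonneg) (auto simp: K_def)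
      finally show "norm (?f s) \<le> 2 / (1 - r) * K * K * r ^ n" by (simp only: mult.assoc)
    qed
    finally show ?thesis by (simp add: mult_ac)
  qed
  have "(\<lambda>n. real n * r ^ n) \<longlonglongrightarrow> 0"
    using powser_times_n_limit_0[of r] r by simp
  then have "(\<lambda>n. 2 / (1 - r) * K * K * (real n * r ^ n)) \<longlonglongrightarrow> 0"
    by (rule tendsto_mult_right_zero)
  then show ?thesis
    by (rule Lim_null_comparison[rotated]) (use bound in auto)
qed

definition theta4_series :: "complex \<Rightarrow> complex" where
  "theta4_series z = 1 + 2 * (\<Sum>s. (-1) ^ Suc s * z ^ ((Suc s)\<^sup>2))"

lemma summable_square_powers:
  fixes r :: real
  assumes "0 \<le> r" "r < 1"
  shows "summable (\<lambda>s. r ^ ((Suc s)\<^sup>2))"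
proof (rule summable_comparison_test')
  show "summable (\<lambda>s. r ^ s)" using assms by (intro summable_geometric) auto
  fix s :: nat
  have "s \<le> (Suc s)\<^sup>2" by (simp add: power2_eq_square)
  then show "norm (r ^ ((Suc s)\<^sup>2)) \<le> r ^ s"
    using assms by (simp add: power_decreasing)
qed

text \<open>The finite products satisfy Q k * P k = 1. Here P k tends to the theta series by Gauss's
  identity, and Q k tends to the generating function by dominated convergence (Tannery), with the
  terms of the full series as majorant.\<close>

lemma pbar_generating_function:
  fixes z :: complex
  assumes z: "norm z < 1"
  shows "(\<Sum>n. of_nat (pbar n) * z ^ n) * theta4_series z = 1"
proof -
  define P where "P = (\<lambda>k. \<Prod>i=1..k. (1 - z ^ i) / (1 + z ^ i))"
  define Q where "Q = (\<lambda>k. \<Prod>i=1..k. (1 + z ^ i) / (1 - z ^ i))"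
  have PQ: "Q k * P k = 1" for k
    unfolding P_def Q_def prod.distrib[symmetric]
    by (rule prod.neutral) (use one_minus_power_nonzero[OF z] in auto)
  have "summable (\<lambda>s. norm ((-1) ^ Suc s * z ^ ((Suc s)\<^sup>2)))"
    using summable_square_powers[of "norm z"] z by (simp add: norm_mult norm_power)
  then have "(\<lambda>n. \<Sum>s<n. (-1) ^ Suc s * z ^ ((Suc s)\<^sup>2)) \<longlonglongrightarrow> (\<Sum>s. (-1) ^ Suc s * z ^ ((Suc s)\<^sup>2))"
    by (rule summable_LIMSEQ[OF summable_norm_cancel])
  moreover have "(\<Sum>s<n. (-1) ^ Suc s * z ^ ((Suc s)\<^sup>2)) = (\<Sum>s=1..n. (-1) ^ s * z ^ (s\<^sup>2))" for n
    by (rule sum.reindex_bij_witness[of _ "\<lambda>s. s - 1" Suc]) auto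
  ultimately have "(\<lambda>n. 1 + 2 * (\<Sum>s=1..n. (-1) ^ s * z ^ (s\<^sup>2))) \<longlonglongrightarrow> theta4_series z"
    unfolding theta4_series_def by (intro tendsto_intros) simp
  from tendsto_diff[OF this gauss_identity_limit[OF z]]
  have P: "P \<longlonglongrightarrow> theta4_series z" by (simp add: P_def)
  have "eventually (\<lambda>(j, k). norm (of_nat (pbar_le k j) * z ^ j) \<le> norm (of_nat (pbar j) * z ^ j))
      (at_top \<times>\<^sub>F sequentially)"
    by (rule always_eventually) (auto simp: norm_mult intro!: mult_right_mono pbar_le_le)
  moreover have "(\<lambda>k. of_nat (pbar_le k j) * z ^ j) \<longlonglongrightarrow> of_nat (pbar j) * z ^ j" for j
    by (rule tendsto_eventually) (auto simp: eventually_at_top_linorder pbar_le_eq intro!: exI[of _ j])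
  ultimately have "(\<lambda>k. \<Sum>j. of_nat (pbar_le k j) * z ^ j) \<longlonglongrightarrow> (\<Sum>j. of_nat (pbar j) * z ^ j)"
    using tannerys_theorem[of "\<lambda>j k. of_nat (pbar_le k j) * z ^ j" "\<lambda>j. of_nat (pbar j) * z ^ j" sequentially]
      pbar_summable[OF z] by auto
  moreover have "(\<Sum>j. of_nat (pbar_le k j) * z ^ j) = Q k" for k
    using sums_unique[OF pbar_le_sums[OF z, of k]] by (simp add: Q_def)
  ultimately have "Q \<longlonglongrightarrow> (\<Sum>j. of_nat (pbar j) * z ^ j)" by simp
  from tendsto_mult[OF this P] show ?thesis
    unfolding PQ by (metis LIMSEQ_unique tendsto_const)
qed

section \<open>Inversion of the theta function\<close>

lemma cis_eq_1_iff_int: "cis x = 1 \<longleftrightarrow> (\<exists>n::int. x = 2 * pi * of_int n)"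
proof
  assume "cis x = 1"
  then have "cos x = 1" by (metis cis.simps(1) one_complex.simps(1))
  then show "\<exists>n::int. x = 2 * pi * of_int n"
    by (auto simp: cos_one_2pi_int mult_ac)
qed (auto simp: cis_multiple_2pi)

lemma sum_roots_of_unity:
  fixes d :: int
  assumes "l > 0"
  shows "(\<Sum>i<l. cis (2 * pi * (real i - c) * of_int d / real l)) =
    (if int l dvd d then of_nat l * cis (- 2 * pi * c * of_int d / real l) else 0)"
proof -
  define w where "w = cis (2 * pi * of_int d / real l)"
  have "(\<Sum>i<l. cis (2 * pi * (real i - c) * of_int d / real l)) =
    (\<Sum>i<l. cis (- 2 * pi * c * of_int d / real l) * w ^ i)"
    by (intro sum.cong refl) (simp add: w_def Complex.DeMoivre cis_mult algebra_simps diff_divide_distrib)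
  also have "\<dots> = cis (- 2 * pi * c * of_int d / real l) * (\<Sum>i<l. w ^ i)"
    by (simp add: sum_distrib_left)
  also have "(\<Sum>i<l. w ^ i) = (if int l dvd d then of_nat l else 0)"
  proof (cases "w = 1")
    case True
    then obtain n :: int where "2 * pi * of_int d / real l = 2 * pi * of_int n"
      unfolding w_def cis_eq_1_iff_int by blast
    then have "real_of_int d = of_int (n * int l)" using assms by (simp add: field_simps)
    then have "int l dvd d" by (metis dvd_triv_right of_int_eq_iff)
    then show ?thesis using True by simp
  next
    case False
    have "w ^ l = 1" using assms
      by (simp add: w_def Complex.DeMoivre cis_eq_1_iff_int)
    then have "(\<Sum>i<l. w ^ i) = 0" using False by (simp add: geometric_sum)
    moreover have "\<not> int l dvd d"
    proof
      assume "int l dvd d"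
      then obtain n where "d = int l * n" by auto
      then have "w = 1" using assms by (simp add: w_def cis_eq_1_iff_int mult_ac)
      with False show False by simp
    qed
    ultimately show ?thesis by simp
  qed
  finally show ?thesis by simp
qed

lemma cos_power_cis:
  "complex_of_real ((2 * cos u) ^ (2 * m)) =
    (\<Sum>k\<le>2 * m. of_nat ((2 * m) choose k) * cis (2 * u * (real k - real m)))"
proof -
  have "complex_of_real (2 * cos u) = cis u + cis (- u)"
    by (simp add: complex_eq_iff)
  then have "complex_of_real ((2 * cos u) ^ (2 * m)) = (cis u + cis (- u)) ^ (2 * m)"
    by (metis of_real_power)
  also have "\<dots> = (\<Sum>k\<le>2 * m. of_nat ((2 * m) choose k) * cis u ^ k * cis (- u) ^ (2 * m - k))"
    by (rule binomial_ring)
  also have "\<dots> = (\<Sum>k\<le>2 * m. of_nat ((2 * m) choose k) * cis (2 * u * (real k - real m)))"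
  proof (intro sum.cong refl)
    fix k assume "k \<in> {..2 * m}"
    then have "cis u ^ k * cis (- u) ^ (2 * m - k) = cis (2 * u * (real k - real m))"
      by (simp add: Complex.DeMoivre cis_mult of_nat_diff algebra_simps)
    then show "of_nat ((2 * m) choose k) * cis u ^ k * cis (- u) ^ (2 * m - k) =
      of_nat ((2 * m) choose k) * cis (2 * u * (real k - real m))" by (simp add: mult.assoc)
  qed
  finally show ?thesis .
qed

lemma sum_even_int:
  fixes f :: "int \<Rightarrow> 'a :: comm_ring_1"
  assumes "\<And>x. f (- x) = f x"
  shows "(\<Sum>k\<le>2 * m. f (int k - int m)) = f 0 + 2 * (\<Sum>j=1..m. f (int j))"
proof -
  have "(\<Sum>k\<le>2 * m. f (int k - int m)) = (\<Sum>k\<in>{- int m..int m}. f k)"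
    by (rule sum.reindex_bij_witness[of _ "\<lambda>k. nat (k + int m)" "\<lambda>k. int k - int m"]) auto
  also have "{- int m..int m} = insert 0 ({- int m..- 1} \<union> {1..int m})" by auto
  also have "sum f \<dots> = f 0 + (sum f {- int m..- 1} + sum f {1..int m})"
    by (subst sum.insert, simp, simp, subst sum.union_disjoint) auto
  also have "sum f {- int m..- 1} = (\<Sum>j=1..m. f (int j))"
    by (rule sum.reindex_bij_witness[of _ "\<lambda>j. - int j" "\<lambda>k. nat (- k)"]) (auto simp: assms)
  also have "sum f {1..int m} = (\<Sum>j=1..m. f (int j))"
    by (rule sum.reindex_bij_witness[of _ "\<lambda>j. int j" "\<lambda>k. nat k"]) auto
  finally show ?thesis by simp
qed

text \<open>Sum (2 cos (pi j / l))^(2m) over the complete residue system -p..p modulo the odd number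
  l and expand each power into exponentials. Orthogonality of the l-th roots of unity keeps only the
  binomial coefficients whose distance from the centre m is a multiple of l. Both sides are then
  folded by evenness.\<close>

lemma polya_identity:
  fixes p m :: nat
  defines "l \<equiv> 2 * p + 1"
  shows "4 ^ m * (1 + 2 * (\<Sum>j=1..p. cos (pi * real j / real l) ^ (2 * m))) =
    real l * (real ((2 * m) choose m) + 2 * (\<Sum>v=1..m. if v * l \<le> m then real ((2 * m) choose (m + v * l)) else 0))"
proof -
  have l0: "l > 0" by (simp add: l_def)
  define f where "f = (\<lambda>j::int. (2 * cos (pi * of_int j / real l)) ^ (2 * m))"
  define g where "g = (\<lambda>d::int. if \<bar>d\<bar> \<le> int m \<and> int l dvd d then real ((2 * m) choose nat (int m + d)) else 0)"
  have gdef: "g (int k - int m) = (if int l dvd int k - int m then real ((2 * m) choose k) else 0)" if "k \<le> 2 * m" for k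
    using that by (auto simp: g_def)
  have "complex_of_real (\<Sum>i\<le>2 * p. f (int i - int p)) = (\<Sum>i<l. \<Sum>k\<le>2 * m. of_nat ((2 * m) choose k) *
      cis (2 * pi * (real i - real p) * of_int (int k - int m) / real l))"
    unfolding of_real_sum f_def cos_power_cis
    by (intro sum.cong) (auto simp: l_def mult_ac)
  also have "\<dots> = (\<Sum>k\<le>2 * m. of_nat ((2 * m) choose k) *
      (\<Sum>i<l. cis (2 * pi * (real i - real p) * of_int (int k - int m) / real l)))"
    by (subst sum.swap) (simp add: sum_distrib_left)
  also have "\<dots> = (\<Sum>k\<le>2 * m. of_nat l * of_real (g (int k - int m)))"
  proof (intro sum.cong refl)
    fix k assume k: "k \<in> {..2 * m}"
    have "cis (- 2 * pi * real p * of_int (int k - int m) / real l) = 1" if "int l dvd int k - int m"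
    proof -
      from that obtain n where n: "int k - int m = int l * n" by auto
      have "- 2 * pi * real p * of_int (int k - int m) / real l = 2 * pi * of_int (- int p * n)"
        using l0 unfolding n by simp
      then show ?thesis unfolding cis_eq_1_iff_int by blast
    qed
    then show "of_nat ((2 * m) choose k) *
      (\<Sum>i<l. cis (2 * pi * (real i - real p) * of_int (int k - int m) / real l)) =
      of_nat l * of_real (g (int k - int m))"
      using k unfolding sum_roots_of_unity[OF l0] by (simp add: gdef del: of_int_diff)
  qed
  also have "\<dots> = complex_of_real (real l * (\<Sum>k\<le>2 * m. g (int k - int m)))"
    by (simp add: sum_distrib_left)
  finally have "(\<Sum>i\<le>2 * p. f (int i - int p)) = real l * (\<Sum>k\<le>2 * m. g (int k - int m))"
    unfolding of_real_eq_iff .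
  moreover have "(\<Sum>i\<le>2 * p. f (int i - int p)) = f 0 + 2 * (\<Sum>j=1..p. f (int j))"
    by (rule sum_even_int) (simp add: f_def)
  moreover have "f 0 + 2 * (\<Sum>j=1..p. f (int j)) = 4 ^ m * (1 + 2 * (\<Sum>j=1..p. cos (pi * real j / real l) ^ (2 * m)))"
  proof -
    have e: "(2 * c) ^ (2 * m) = 4 ^ m * c ^ (2 * m)" for c :: real
      by (simp add: power_mult_distrib power_mult)
    show ?thesis unfolding f_def e by (simp add: sum_distrib_left distrib_left mult_ac)
  qed
  moreover have "(\<Sum>k\<le>2 * m. g (int k - int m)) = g 0 + 2 * (\<Sum>j=1..m. g (int j))"
  proof (rule sum_even_int)
    fix x :: int
    have "(2 * m) choose nat (int m - x) = (2 * m) choose nat (int m + x)" if "\<bar>x\<bar> \<le> int m"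
    proof -
      have "nat (int m - x) = 2 * m - nat (int m + x)" "nat (int m + x) \<le> 2 * m" using that by auto
      then show ?thesis by (metis binomial_symmetric)
    qed
    then show "g (- x) = g x" by (simp add: g_def)
  qed
  moreover have "(\<Sum>j=1..m. g (int j)) = (\<Sum>v=1..m. if v * l \<le> m then real ((2 * m) choose (m + v * l)) else 0)"
  proof -
    have "(\<Sum>v=1..m. if v * l \<le> m then real ((2 * m) choose (m + v * l)) else 0) =
       (\<Sum>v\<in>{v\<in>{1..m}. v * l \<le> m}. real ((2 * m) choose (m + v * l)))"
      by (rule sum.inter_filter[symmetric]) simp
    also have "\<dots> = (\<Sum>j\<in>{j\<in>{1..m}. int l dvd int j}. real ((2 * m) choose (m + j)))"
      using l0 by (intro sum.reindex_bij_witness[of _ "\<lambda>j. j div l" "\<lambda>v. v * l"])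
        (auto simp: Suc_le_eq div_greater_zero_iff dvd_imp_le intro: order_trans[OF div_le_dividend])
    also have "\<dots> = (\<Sum>j=1..m. g (int j))"
      unfolding sum.inter_filter[OF finite_atLeastAtMost]
      by (intro sum.cong) (auto simp: g_def nat_int_add)
    finally show ?thesis by simp
  qed
  moreover have "g 0 = real ((2 * m) choose m)" by (simp add: g_def)
  ultimately show ?thesis by simp
qed

section \<open>Binomial coefficients near the centre\<close>

lemma central_binomial_ratio:
  "real ((2 * m) choose (m + k)) = real ((2 * m) choose m) * (\<Prod>i=1..k. (real m - real i + 1) / (real m + real i))"
proof (induction k)
  case (Suc k)
  have "((2 * m) choose (m + Suc k)) * (m + Suc k) = ((2 * m) choose (m + k)) * (2 * m - (m + k))"
    using binomial_absorb_comp[of "2 * m" "m + k"] binomial_absorption[of "m + k" "2 * m"] by (simp add: mult_ac)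
  then have "real ((2 * m) choose (m + Suc k)) * (real m + real (Suc k)) = real ((2 * m) choose (m + k)) * real (m - k)"
    by (metis (no_types, opaque_lifting) of_nat_add of_nat_mult mult_2 add_diff_cancel_left)
  moreover have "real ((2 * m) choose (m + k)) * real (m - k) = real ((2 * m) choose (m + k)) * (real m - real k)"
    by (cases "k \<le> m") (auto simp: of_nat_diff binomial_eq_0)
  ultimately have "real ((2 * m) choose (m + Suc k)) = real ((2 * m) choose (m + k)) * ((real m - real (Suc k) + 1) / (real m + real (Suc k)))"
    by (simp add: field_simps)
  then show ?case by (simp add: Suc)
qed simp

lemma sum_odd_numbers: "(\<Sum>i=1..k. 2 * real i - 1) = (real k)\<^sup>2"
  by (induction k) (auto simp: power2_eq_square algebra_simps)

text \<open>Each factor of the ratio is 1 - (2i - 1)/(m + i). Replacing the denominators by the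
  largest one, m + k, and using 1 + x <= exp x turns the product into an exponential of the sum of
  the first k odd numbers.\<close>

lemma central_binomial_upper:
  assumes "k \<le> m" "m > 0"
  shows "real ((2 * m) choose (m + k)) \<le> real ((2 * m) choose m) * exp (- ((real k)\<^sup>2 / (real m + real k)))"
proof -
  have "(\<Prod>i=1..k. (real m - real i + 1) / (real m + real i)) \<le>
    (\<Prod>i=1..k. exp (- ((2 * real i - 1) / (real m + real k))))"
  proof (rule prod_mono, intro conjI)
    fix i assume i: "i \<in> {1..k}"
    show "0 \<le> (real m - real i + 1) / (real m + real i)" using i assms by auto
    have "(real m - real i + 1) / (real m + real i) = 1 - (2 * real i - 1) / (real m + real i)"
      using assms by (simp add: field_simps)
    also have "\<dots> \<le> 1 - (2 * real i - 1) / (real m + real k)"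
      using i assms by (intro diff_left_mono divide_left_mono mult_pos_pos) auto
    also have "\<dots> \<le> exp (- ((2 * real i - 1) / (real m + real k)))"
      using exp_ge_add_one_self[of "- ((2 * real i - 1) / (real m + real k))"] by simp
    finally show "(real m - real i + 1) / (real m + real i) \<le> exp (- ((2 * real i - 1) / (real m + real k)))" .
  qed
  also have "\<dots> = exp (- ((real k)\<^sup>2 / (real m + real k)))"
    by (simp add: exp_sum[symmetric] sum_negf sum_divide_distrib[symmetric] sum_odd_numbers del: One_nat_def)
  finally show ?thesis unfolding central_binomial_ratio[of m k] by (intro mult_left_mono) auto
qed

text \<open>The same argument for the inverted factors 1 + (2i - 1)/(m - i + 1), whose smallest
  denominator is m - k + 1.\<close>

lemma central_binomial_lower:
  assumes "k \<le> m" "m > 0"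
  shows "real ((2 * m) choose m) * exp (- ((real k)\<^sup>2 / (real m - real k + 1))) \<le> real ((2 * m) choose (m + k))"
proof -
  have "exp (- ((real k)\<^sup>2 / (real m - real k + 1))) =
    (\<Prod>i=1..k. exp (- ((2 * real i - 1) / (real m - real k + 1))))"
    by (simp add: exp_sum[symmetric] sum_negf sum_divide_distrib[symmetric] sum_odd_numbers del: One_nat_def)
  also have "\<dots> \<le> (\<Prod>i=1..k. (real m - real i + 1) / (real m + real i))"
  proof (rule prod_mono, intro conjI)
    fix i assume i: "i \<in> {1..k}"
    show "0 \<le> exp (- ((2 * real i - 1) / (real m - real k + 1)))" by simp
    have "(real m + real i) / (real m - real i + 1) = 1 + (2 * real i - 1) / (real m - real i + 1)"
      using assms i by (simp add: field_simps)
    also have "\<dots> \<le> 1 + (2 * real i - 1) / (real m - real k + 1)"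
      using i assms by (intro add_left_mono divide_left_mono mult_pos_pos) auto
    also have "\<dots> \<le> exp ((2 * real i - 1) / (real m - real k + 1))"
      by (rule exp_ge_add_one_self)
    finally have "inverse (exp ((2 * real i - 1) / (real m - real k + 1))) \<le> inverse ((real m + real i) / (real m - real i + 1))"
      using i assms by (intro le_imp_inverse_le) auto
    then show "exp (- ((2 * real i - 1) / (real m - real k + 1))) \<le> (real m - real i + 1) / (real m + real i)"
      by (simp add: exp_minus)
  qed
  finally show ?thesis unfolding central_binomial_ratio[of m k] by (intro mult_left_mono) auto
qed

text \<open>With the factor 2m + 1 the quantity is exactly the reciprocal of the m-th Wallis
  product, so Stirling's formula can be avoided.\<close>

lemma central_binomial_wallis:
  "(\<lambda>m. (2 * real m + 1) * (real ((2 * m) choose m) / 4 ^ m)\<^sup>2) \<longlonglongrightarrow> 2 / pi"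
proof -
  have "(2 * real m + 1) * (real ((2 * m) choose m) / 4 ^ m)\<^sup>2 = inverse (\<Prod>k=1..m. (4 * (real k)\<^sup>2) / (4 * (real k)\<^sup>2 - 1))" for m
  proof (induction m)
    case (Suc m)
    have "Suc m * ((2 * Suc m) choose Suc m) = 2 * (2 * m + 1) * ((2 * m) choose m)"
    proof -
      have "Suc m * ((2 * Suc m) choose Suc m) = (2 * Suc m) * ((2 * m + 1) choose m)"
        using Suc_times_binomial_eq[of "2 * m + 1" m] by (simp add: mult_ac)
      moreover have "Suc m * ((2 * m + 1) choose m) = (2 * m + 1) * ((2 * m) choose m)"
        using binomial_absorb_comp[of "2 * m + 1" m] by simp
      ultimately show ?thesis by (simp only: mult.assoc)
    qed
    then have "real (Suc m) * real ((2 * Suc m) choose Suc m) = 2 * (2 * real m + 1) * real ((2 * m) choose m)"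
      by (metis (no_types, lifting) of_nat_mult of_nat_add of_nat_1 of_nat_numeral)
    then have r: "real ((2 * Suc m) choose Suc m) = real ((2 * m) choose m) * (2 * (2 * real m + 1) / (real m + 1))"
      by (simp add: field_simps)
    have "(2 * real (Suc m) + 1) * (real ((2 * Suc m) choose Suc m) / 4 ^ Suc m)\<^sup>2 =
       ((2 * real m + 1) * (real ((2 * m) choose m) / 4 ^ m)\<^sup>2) * ((2 * real m + 3) * (2 * real m + 1) / (4 * (real m + 1)\<^sup>2))"
    proof -
      have gen: "(2 * (x + 1) + 1) * (c * (2 * (2 * x + 1) / (x + 1)) / (4 * q))\<^sup>2 =
        ((2 * x + 1) * (c / q)\<^sup>2) * ((2 * x + 3) * (2 * x + 1) / (4 * (x + 1)\<^sup>2))"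
        if "x + 1 \<noteq> 0" "q \<noteq> 0" for x c q :: real
        using that by (simp add: divide_simps) (simp add: algebra_simps power2_eq_square)
      show ?thesis unfolding r using gen[of "real m" "4 ^ m"] by (simp add: add.commute)
    qed
    also have "(2 * real m + 3) * (2 * real m + 1) / (4 * (real m + 1)\<^sup>2) =
      inverse ((4 * (real (Suc m))\<^sup>2) / (4 * (real (Suc m))\<^sup>2 - 1))"
      by (simp add: field_simps power2_eq_square)
    finally have "(2 * real (Suc m) + 1) * (real ((2 * Suc m) choose Suc m) / 4 ^ Suc m)\<^sup>2 =
      inverse ((\<Prod>k=1..m. (4 * (real k)\<^sup>2) / (4 * (real k)\<^sup>2 - 1)) * ((4 * (real (Suc m))\<^sup>2) / (4 * (real (Suc m))\<^sup>2 - 1)))"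
      unfolding Suc by (simp only: inverse_mult_distrib)
    then show ?case by simp
  qed simp
  then show ?thesis using tendsto_inverse[OF wallis] by simp
qed

text \<open>exp (x^2/2) cos x is nonincreasing because x cos x <= sin x. This supplies the summable
  majorant for the cosine side of Polya's identity, uniformly in p.\<close>

lemma cos_le_exp_quadratic:
  fixes u :: real
  assumes "0 \<le> u" "u < pi / 2"
  shows "cos u \<le> exp (- (u\<^sup>2 / 2))"
proof -
  define g where "g = (\<lambda>x::real. exp (x\<^sup>2 / 2) * cos x)"
  have "g u \<le> g 0"
  proof (rule DERIV_nonpos_imp_nonincreasing[OF assms(1)])
    fix x assume x: "0 \<le> x" "x \<le> u"
    have "(g has_real_derivative exp (x\<^sup>2 / 2) * (x * cos x - sin x)) (at x)"
      unfolding g_def by (auto intro!: derivative_eq_intros simp: algebra_simps)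
    moreover have "x * cos x - sin x \<le> 0"
    proof -
      have "(\<lambda>x. x * cos x - sin x) x \<le> (\<lambda>x. x * cos x - sin x) 0"
      proof (rule DERIV_nonpos_imp_nonincreasing[OF x(1)])
        fix v assume v: "0 \<le> v" "v \<le> x"
        have "((\<lambda>x. x * cos x - sin x) has_real_derivative - (v * sin v)) (at v)"
          by (auto intro!: derivative_eq_intros)
        moreover have "0 \<le> v * sin v"
          using v x assms by (intro mult_nonneg_nonneg sin_ge_zero) auto
        ultimately show "\<exists>y. ((\<lambda>x. x * cos x - sin x) has_real_derivative y) (at v) \<and> y \<le> 0"
          by (intro exI[of _ "- (v * sin v)"]) auto
      qed
      then show ?thesis by simp
    qed
    ultimately show "\<exists>y. (g has_real_derivative y) (at x) \<and> y \<le> 0"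
      by (intro exI[of _ "exp (x\<^sup>2 / 2) * (x * cos x - sin x)"]) (auto intro: mult_nonneg_nonpos)
  qed
  then show ?thesis by (simp add: g_def exp_minus field_simps)
qed

text \<open>Polya's proof of the inversion formula: both sides of the identity above converge termwise
  as the number of cosines grows like the square root of the exponent.\<close>

lemma real_theta_inversion:
  fixes s :: real
  assumes s: "s > 0"
  shows "1 + 2 * (\<Sum>j. exp (- (pi\<^sup>2 * (real (Suc j))\<^sup>2 / s))) =
    sqrt (s / pi) * (1 + 2 * (\<Sum>v. exp (- ((real (Suc v))\<^sup>2 * s))))"
proof -
  define l where "l = (\<lambda>p::nat. 2 * p + 1)"
  \<comment> \<open>The coupling m ~ l^2/s makes both sides converge: cos (pi j / l)^(2m) tends to
    exp (- pi^2 j^2 / s), and the binomial coefficient at distance v l from the centre, relative to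
    the central one, tends to exp (- v^2 s).\<close>
  define m where "m = (\<lambda>p. nat \<lfloor>(real (l p))\<^sup>2 / s\<rfloor>)"
  have l1: "l p \<ge> 1" for p by (simp add: l_def)
  have mle: "real (m p) \<le> (real (l p))\<^sup>2 / s" for p
    unfolding m_def using s by simp
  have mge: "(real (l p))\<^sup>2 / s - 1 \<le> real (m p)" for p
    unfolding m_def using s by linarith
  have l_lim: "filterlim (\<lambda>p. real (l p)) at_top sequentially"
    unfolding l_def by real_asymp
  have ml2: "(\<lambda>p. real (m p) / (real (l p))\<^sup>2) \<longlonglongrightarrow> 1 / s"
  proof (rule tendsto_sandwich)
    show "\<forall>\<^sub>F p in sequentially. 1 / s - 1 / (real (l p))\<^sup>2 \<le> real (m p) / (real (l p))\<^sup>2"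
    proof (rule always_eventually, rule allI)
      fix p
      have "1 / s - 1 / (real (l p))\<^sup>2 = ((real (l p))\<^sup>2 / s - 1) / (real (l p))\<^sup>2"
        using l1[of p] s by (simp add: field_simps)
      also have "\<dots> \<le> real (m p) / (real (l p))\<^sup>2"
        using mge by (intro divide_right_mono) auto
      finally show "1 / s - 1 / (real (l p))\<^sup>2 \<le> real (m p) / (real (l p))\<^sup>2" .
    qed
    show "\<forall>\<^sub>F p in sequentially. real (m p) / (real (l p))\<^sup>2 \<le> 1 / s"
    proof (rule always_eventually, rule allI)
      fix p
      have "real (m p) / (real (l p))\<^sup>2 \<le> ((real (l p))\<^sup>2 / s) / (real (l p))\<^sup>2"
        using mle by (intro divide_right_mono) auto
      then show "real (m p) / (real (l p))\<^sup>2 \<le> 1 / s" using l1[of p] by simp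
    qed
    show "(\<lambda>p. 1 / s - 1 / (real (l p))\<^sup>2) \<longlonglongrightarrow> 1 / s"
      unfolding l_def by real_asymp
  qed simp
  have m_pos: "\<forall>\<^sub>F p in sequentially. m p > 0"
  proof -
    have "\<forall>\<^sub>F p in sequentially. real (m p) / (real (l p))\<^sup>2 > 0"
      using order_tendstoD(1)[OF ml2, of 0] s by simp
    then show ?thesis by eventually_elim (auto simp: zero_less_divide_iff)
  qed
  have m_lim: "filterlim m at_top sequentially"
  proof -
    have "filterlim (\<lambda>p. (real (l p))\<^sup>2 / s - 1) at_top sequentially"
      unfolding l_def using s by real_asymp
    then have "filterlim (\<lambda>p. real (m p)) at_top sequentially"
      by (rule filterlim_at_top_mono) (use mge in auto)
    then show ?thesis by (simp add: filterlim_sequentially_iff_filterlim_real)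
  qed
  have l2m: "(\<lambda>p. (real (l p))\<^sup>2 / real (m p)) \<longlonglongrightarrow> s"
    using tendsto_inverse[OF ml2] s by (simp add: inverse_eq_divide)
  have lm0: "(\<lambda>p. real (l p) / real (m p)) \<longlonglongrightarrow> 0"
  proof -
    have "(\<lambda>p. (real (l p))\<^sup>2 / real (m p) * (1 / real (l p))) \<longlonglongrightarrow> s * 0"
      by (intro tendsto_mult l2m) (unfold l_def, real_asymp)
    moreover have "(real (l p))\<^sup>2 / real (m p) * (1 / real (l p)) = real (l p) / real (m p)" for p
      using l1[of p] by (simp add: power2_eq_square)
    ultimately show ?thesis by simp
  qed
  \<comment> \<open>Polya's identity is divided by 4^m: \<open>a\<close> are the cosine powers,
    \<open>b\<close> the binomial coefficients relative to the central one, \<open>C\<close> the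
    remaining factor. Extending \<open>a\<close> and \<open>b\<close> by 0 turns the finite sums
    into series to which Tannery's theorem applies.\<close>
  define a where "a = (\<lambda>j p. if Suc j \<le> p then cos (pi * real (Suc j) / real (l p)) ^ (2 * m p) else 0)"
  define b where "b = (\<lambda>v p. if Suc v * l p \<le> m p then real ((2 * m p) choose (m p + Suc v * l p)) / real ((2 * m p) choose m p) else 0)"
  define C where "C = (\<lambda>p. real (l p) * (real ((2 * m p) choose m p) / 4 ^ m p))"
  have geo: "summable (\<lambda>j. exp (- (c * real j)))" if "c > 0" for c :: real
  proof -
    have "(\<lambda>j. exp (- (c * real j))) = (\<lambda>j. exp (- c) ^ j)"
      by (simp add: exp_of_nat_mult[symmetric] mult_ac)
    then show ?thesis using that by (simp add: summable_geometric)
  qed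
  have a_lim: "(\<lambda>p. a j p) \<longlonglongrightarrow> exp (- (pi\<^sup>2 * (real (Suc j))\<^sup>2 / s))" for j
  proof -
    define c where "c = pi * real (Suc j)"
    have c0: "c > 0" by (simp add: c_def)
    have lc: "(\<lambda>p. ln (cos (c / real (l p))) * (real (l p))\<^sup>2) \<longlonglongrightarrow> - (c\<^sup>2 / 2)"
      unfolding l_def using c0 by (real_asymp simp: power2_eq_square)
    have "(\<lambda>p. exp (2 * (real (m p) / (real (l p))\<^sup>2) * (ln (cos (c / real (l p))) * (real (l p))\<^sup>2))) \<longlonglongrightarrow>
      exp (2 * (1 / s) * (- (c\<^sup>2 / 2)))"
      by (intro tendsto_intros ml2 lc)
    also have "2 * (1 / s) * (- (c\<^sup>2 / 2)) = - (pi\<^sup>2 * (real (Suc j))\<^sup>2 / s)"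
      by (simp add: c_def power_mult_distrib)
    finally show ?thesis
    proof (rule Lim_transform_eventually)
      have "\<forall>\<^sub>F p in sequentially. cos (c / real (l p)) > 0"
        unfolding l_def using c0 by real_asymp
      then show "\<forall>\<^sub>F p in sequentially. exp (2 * (real (m p) / (real (l p))\<^sup>2) *
          (ln (cos (c / real (l p))) * (real (l p))\<^sup>2)) = a j p"
        using eventually_ge_at_top[of "Suc j"]
      proof eventually_elim
        case (elim p)
        have "2 * (real (m p) / (real (l p))\<^sup>2) * (ln (cos (c / real (l p))) * (real (l p))\<^sup>2) =
          real (2 * m p) * ln (cos (c / real (l p)))" using l1[of p] by simp
        then show ?case using elim
          by (simp add: a_def exp_of_nat_mult c_def[symmetric] del: of_nat_Suc of_nat_mult)
      qed
    qed
  qed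
  have "\<forall>\<^sub>F p in sequentially. real (m p) / (real (l p))\<^sup>2 > 1 / (2 * s)"
    using order_tendstoD(1)[OF ml2, of "1 / (2 * s)"] s by (simp add: field_simps)
  then have "\<forall>\<^sub>F p in sequentially. \<forall>j. norm (a j p) \<le> exp (- (1 / (2 * s) * real j))"
  proof eventually_elim
    case (elim p)
    show ?case
    proof
      fix j
      show "norm (a j p) \<le> exp (- (1 / (2 * s) * real j))"
      proof (cases "Suc j \<le> p")
        case True
        let ?u = "pi * real (Suc j) / real (l p)"
        have u: "0 \<le> ?u" "?u < pi / 2"
        proof -
          show "0 \<le> ?u" by simp
          have "real (Suc j) / real (l p) < 1 / 2" using True by (simp add: l_def divide_simps)
          then have "pi * (real (Suc j) / real (l p)) < pi * (1 / 2)" by (rule mult_strict_left_mono) simp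
          then show "?u < pi / 2" by simp
        qed
        have "a j p = cos ?u ^ (2 * m p)" using True by (simp add: a_def)
        also have "\<dots> \<le> exp (- (?u\<^sup>2 / 2)) ^ (2 * m p)"
          by (intro power_mono cos_le_exp_quadratic[OF u] cos_ge_zero order_trans[OF _ u(1)] less_imp_le[OF u(2)]) simp
        also have "\<dots> = exp (- ((pi * real (Suc j))\<^sup>2 * (real (m p) / (real (l p))\<^sup>2)))"
          by (simp add: exp_of_nat_mult[symmetric] power_divide del: of_nat_Suc)
        also have "\<dots> \<le> exp (- (real j * (1 / (2 * s))))"
        proof -
          have "real j \<le> 1 * (real (Suc j))\<^sup>2" by (simp add: power2_eq_square algebra_simps)
          also have "\<dots> \<le> pi\<^sup>2 * (real (Suc j))\<^sup>2"
            using pi_gt3 by (intro mult_right_mono) (auto simp: one_le_power)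
          finally have "real j \<le> (pi * real (Suc j))\<^sup>2" by (simp add: power_mult_distrib)
          then have "real j * (1 / (2 * s)) \<le> (pi * real (Suc j))\<^sup>2 * (real (m p) / (real (l p))\<^sup>2)"
            using elim s by (intro mult_mono) auto
          then show ?thesis by simp
        qed
        finally have "a j p \<le> exp (- (1 / (2 * s) * real j))" by (simp add: mult.commute)
        moreover have "0 \<le> a j p" by (simp add: a_def)
        ultimately show ?thesis by simp
      qed (simp add: a_def)
    qed
  qed
  then have "eventually (\<lambda>(j, p). norm (a j p) \<le> exp (- (1 / (2 * s) * real j))) (at_top \<times>\<^sub>F sequentially)"
    unfolding eventually_prod_filter by (auto intro!: exI[of _ "\<lambda>_. True"] exI)
  with tannerys_theorem[OF a_lim _ geo[of "1 / (2 * s)"]] s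
  have A: "(\<lambda>p. \<Sum>j. a j p) \<longlonglongrightarrow> (\<Sum>j. exp (- (pi\<^sup>2 * (real (Suc j))\<^sup>2 / s)))" by auto
  have ch0: "real ((2 * M) choose M) > 0" for M by simp
  have b_lim: "(\<lambda>p. b v p) \<longlonglongrightarrow> exp (- ((real (Suc v))\<^sup>2 * s))" for v
  proof -
    define k where "k = (\<lambda>p. Suc v * l p)"
    have rk: "real (k p) = real (Suc v) * real (l p)" for p by (simp only: k_def of_nat_mult)
    have bk: "b v p = (if k p \<le> m p then real ((2 * m p) choose (m p + k p)) / real ((2 * m p) choose m p) else 0)" for p
      by (simp only: b_def k_def)
    have km: "\<forall>\<^sub>F p in sequentially. real (k p) / real (m p) < 1"
      using order_tendstoD(2)[OF tendsto_mult[OF tendsto_const[of "real (Suc v)"] lm0], of 1]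
      by (simp add: rk del: of_nat_Suc)
    have ev: "\<forall>\<^sub>F p in sequentially. k p \<le> m p \<and> m p > 0"
      using km m_pos by eventually_elim (auto simp: field_simps)
    have k0: "(\<lambda>p. real (k p) / real (m p)) \<longlonglongrightarrow> 0"
      using tendsto_mult[OF tendsto_const[of "real (Suc v)"] lm0] by (simp add: rk del: of_nat_Suc)
    have k2: "(\<lambda>p. (real (k p))\<^sup>2 / real (m p)) \<longlonglongrightarrow> (real (Suc v))\<^sup>2 * s"
      using tendsto_mult[OF tendsto_const[of "(real (Suc v))\<^sup>2"] l2m] by (simp add: rk power_mult_distrib del: of_nat_Suc)
    have m1: "(\<lambda>p. 1 / real (m p)) \<longlonglongrightarrow> 0"
      using filterlim_compose[OF lim_1_over_n m_lim] .
    show ?thesis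
    proof (rule tendsto_sandwich)
      show "\<forall>\<^sub>F p in sequentially. exp (- ((real (k p))\<^sup>2 / real (m p) / (1 - real (k p) / real (m p) + 1 / real (m p)))) \<le> b v p"
        using ev
      proof eventually_elim
        case (elim p)
        have "(real (k p))\<^sup>2 / real (m p) / (1 - real (k p) / real (m p) + 1 / real (m p)) =
          (real (k p))\<^sup>2 / (real (m p) - real (k p) + 1)"
          using elim by (simp add: field_simps)
        then show ?case using central_binomial_lower[of "k p" "m p"] elim
          by (simp add: bk field_simps)
      qed
      show "\<forall>\<^sub>F p in sequentially. b v p \<le> exp (- ((real (k p))\<^sup>2 / real (m p) / (1 + real (k p) / real (m p))))"
        using ev
      proof eventually_elim
        case (elim p)
        have "(real (k p))\<^sup>2 / real (m p) / (1 + real (k p) / real (m p)) =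
          (real (k p))\<^sup>2 / (real (m p) + real (k p))"
          using elim by (simp add: field_simps)
        then show ?case using central_binomial_upper[of "k p" "m p"] elim
          by (simp add: bk field_simps)
      qed
      have "(\<lambda>p. exp (- ((real (k p))\<^sup>2 / real (m p) / (1 - real (k p) / real (m p) + 1 / real (m p))))) \<longlonglongrightarrow>
        exp (- ((real (Suc v))\<^sup>2 * s / (1 - 0 + 0)))"
        by (intro tendsto_intros k2 k0 m1) auto
      then show "(\<lambda>p. exp (- ((real (k p))\<^sup>2 / real (m p) / (1 - real (k p) / real (m p) + 1 / real (m p))))) \<longlonglongrightarrow>
        exp (- ((real (Suc v))\<^sup>2 * s))" by simp
      have "(\<lambda>p. exp (- ((real (k p))\<^sup>2 / real (m p) / (1 + real (k p) / real (m p))))) \<longlonglongrightarrow>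
        exp (- ((real (Suc v))\<^sup>2 * s / (1 + 0)))"
        by (intro tendsto_intros k2 k0) auto
      then show "(\<lambda>p. exp (- ((real (k p))\<^sup>2 / real (m p) / (1 + real (k p) / real (m p))))) \<longlonglongrightarrow>
        exp (- ((real (Suc v))\<^sup>2 * s))" by simp
    qed
  qed
  \<comment> \<open>With k = \<open>Suc v * l p\<close> <= m <= l^2/s, the exponent k^2/(m + k) is
    at least k^2/(2m), hence at least s (v + 1)^2/2, in which p no longer occurs.\<close>
  have "norm (b v p) \<le> exp (- (s / 2 * real v))" for v p
  proof (cases "Suc v * l p \<le> m p")
    case True
    let ?k = "Suc v * l p"
    have m0: "m p > 0" using True l1[of p] by (simp add: l_def)
    have "b v p \<le> exp (- ((real ?k)\<^sup>2 / (real (m p) + real ?k)))"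
      using central_binomial_upper[OF True m0] ch0[of "m p"] True by (simp add: b_def field_simps del: mult_Suc)
    also have "\<dots> \<le> exp (- (s / 2 * real v))"
    proof -
      have "real v \<le> (real (Suc v))\<^sup>2" by (simp add: power2_eq_square algebra_simps)
      then have "s / 2 * real v \<le> s / 2 * (real (Suc v))\<^sup>2" using s by simp
      also have "\<dots> = (real ?k)\<^sup>2 / (2 * ((real (l p))\<^sup>2 / s))"
        using s l1[of p] unfolding of_nat_mult power_mult_distrib by simp
      also have "\<dots> \<le> (real ?k)\<^sup>2 / (2 * real (m p))"
        using mle[of p] m0 s l1[of p] by (intro divide_left_mono mult_left_mono mult_pos_pos) auto
      also have "\<dots> \<le> (real ?k)\<^sup>2 / (real (m p) + real ?k)"
      proof -
        have "real ?k \<le> real (m p)" using True unfolding of_nat_le_iff .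
        then show ?thesis using m0 by (intro divide_left_mono mult_pos_pos add_pos_nonneg) (auto simp del: mult_Suc of_nat_mult)
      qed
      finally show ?thesis by simp
    qed
    finally show ?thesis by (simp add: b_def)
  qed (simp add: b_def)
  then have "eventually (\<lambda>(v, p). norm (b v p) \<le> exp (- (s / 2 * real v))) (at_top \<times>\<^sub>F sequentially)"
    by (intro always_eventually) auto
  with tannerys_theorem[OF b_lim _ geo[of "s / 2"]] s
  have B: "(\<lambda>p. \<Sum>v. b v p) \<longlonglongrightarrow> (\<Sum>v. exp (- ((real (Suc v))\<^sup>2 * s)))" by auto
  \<comment> \<open>C^2 is the Wallis quantity times l^2/(2m + 1), with limit (2/pi) (s/2) =
    s/pi.\<close>
  have C: "C \<longlonglongrightarrow> sqrt (s / pi)"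
  proof -
    have "(\<lambda>p. sqrt ((2 * real (m p) + 1) * (real ((2 * m p) choose m p) / 4 ^ m p)\<^sup>2 *
        (1 / (2 * (real (m p) / (real (l p))\<^sup>2) + 1 / (real (l p))\<^sup>2)))) \<longlonglongrightarrow> sqrt (2 / pi * (1 / (2 * (1 / s) + 0)))"
    proof -
      have L: "(\<lambda>p. 1 / (real (l p))\<^sup>2) \<longlonglongrightarrow> 0" unfolding l_def by real_asymp
      show ?thesis
        by (rule tendsto_real_sqrt[OF tendsto_mult[OF filterlim_compose[OF central_binomial_wallis m_lim]
              tendsto_divide[OF tendsto_const tendsto_add[OF tendsto_mult[OF tendsto_const ml2] L]]]])
          (use s in simp)
    qed
    moreover have "sqrt ((2 * real (m p) + 1) * (real ((2 * m p) choose m p) / 4 ^ m p)\<^sup>2 *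
        (1 / (2 * (real (m p) / (real (l p))\<^sup>2) + 1 / (real (l p))\<^sup>2))) = C p" for p
    proof -
      have "(2 * real (m p) + 1) * (real ((2 * m p) choose m p) / 4 ^ m p)\<^sup>2 *
        (1 / (2 * (real (m p) / (real (l p))\<^sup>2) + 1 / (real (l p))\<^sup>2)) = (C p)\<^sup>2"
      proof -
        have "2 * (real (m p) / (real (l p))\<^sup>2) + 1 / (real (l p))\<^sup>2 = (2 * real (m p) + 1) / (real (l p))\<^sup>2"
          by (simp add: add_divide_distrib)
        moreover have "2 * real (m p) + 1 > 0" by simp
        ultimately show ?thesis by (simp add: C_def power_mult_distrib power_divide)
      qed
      moreover have "C p \<ge> 0" by (simp add: C_def)
      ultimately show ?thesis by simp
    qed
    ultimately show ?thesis by simp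
  qed
  have key: "1 + 2 * (\<Sum>j. a j p) = C p * (1 + 2 * (\<Sum>v. b v p))" for p
  proof -
    have "(\<Sum>j. a j p) = (\<Sum>j<p. a j p)"
      by (rule suminf_finite) (auto simp: a_def)
    also have "\<dots> = (\<Sum>j=1..p. cos (pi * real j / real (l p)) ^ (2 * m p))"
      by (rule sum.reindex_bij_witness[of _ "\<lambda>j. j - 1" Suc]) (auto simp: a_def)
    finally have 1: "(\<Sum>j. a j p) = (\<Sum>j=1..p. cos (pi * real j / real (l p)) ^ (2 * m p))" .
    have "b v p = 0" if "v \<ge> m p" for v
    proof -
      have "Suc v * 1 \<le> Suc v * l p" using l1[of p] by (intro mult_le_mono2)
      then have "Suc v \<le> Suc v * l p" unfolding mult_1_right .
      then have "\<not> Suc v * l p \<le> m p" using that by linarith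
      then show ?thesis by (simp add: b_def)
    qed
    then have "(\<Sum>v. b v p) = (\<Sum>v<m p. b v p)"
      by (intro suminf_finite) (auto simp: not_less)
    also have "\<dots> = (\<Sum>v=1..m p. if v * l p \<le> m p then real ((2 * m p) choose (m p + v * l p)) / real ((2 * m p) choose m p) else 0)"
      by (rule sum.reindex_bij_witness[of _ "\<lambda>j. j - 1" Suc]) (auto simp: b_def)
    also have "\<dots> = (\<Sum>v=1..m p. if v * l p \<le> m p then real ((2 * m p) choose (m p + v * l p)) else 0) / real ((2 * m p) choose m p)"
      unfolding sum_divide_distrib by (intro sum.cong) auto
    finally have 2: "(\<Sum>v=1..m p. if v * l p \<le> m p then real ((2 * m p) choose (m p + v * l p)) else 0) =
      real ((2 * m p) choose m p) * (\<Sum>v. b v p)" by simp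
    have "4 ^ m p * (1 + 2 * (\<Sum>j. a j p)) = real (l p) * (real ((2 * m p) choose m p) + 2 * (real ((2 * m p) choose m p) * (\<Sum>v. b v p)))"
      using polya_identity[where p = p and m = "m p"] unfolding 1 2[symmetric] l_def .
    then show ?thesis by (simp add: C_def field_simps)
  qed
  have "(\<lambda>p. 1 + 2 * (\<Sum>j. a j p)) \<longlonglongrightarrow> 1 + 2 * (\<Sum>j. exp (- (pi\<^sup>2 * (real (Suc j))\<^sup>2 / s)))"
    by (intro tendsto_intros A)
  moreover have "(\<lambda>p. C p * (1 + 2 * (\<Sum>v. b v p))) \<longlonglongrightarrow> sqrt (s / pi) * (1 + 2 * (\<Sum>v. exp (- ((real (Suc v))\<^sup>2 * s))))"
    by (intro tendsto_intros B C)
  ultimately show ?thesis unfolding key using LIMSEQ_unique by blast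
qed

section \<open>Theta functions of complex t (nome exp (- pi t), t = - i tau) and their
  transformation laws\<close>

definition theta3 :: "complex \<Rightarrow> complex" where
  "theta3 t = 1 + 2 * (\<Sum>j. exp (- (of_real pi * of_nat ((Suc j)\<^sup>2) * t)))"

definition theta4 :: "complex \<Rightarrow> complex" where
  "theta4 t = theta3 (t + \<i>)"

text \<open>theta3 (t/4) has the exponents k^2/4; subtracting the even k leaves the squares of
  half-integers, the classical theta2. In this form the inversion laws of theta2 and theta4 follow
  from that of theta3 by algebra.\<close>

definition theta2 :: "complex \<Rightarrow> complex" where
  "theta2 t = theta3 (t / 4) - theta3 t"

lemma norm_theta_term:
  "norm (exp (- (complex_of_real pi * of_nat k * t))) = exp (- (pi * Re t)) ^ k"
  by (simp add: norm_exp_eq_Re exp_of_nat_mult[symmetric] mult_ac)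

lemma theta_terms_summable:
  assumes "Re t > 0"
  shows "summable (\<lambda>j. norm (exp (- (complex_of_real pi * of_nat ((Suc j)\<^sup>2) * t))))"
  unfolding norm_theta_term using assms by (intro summable_square_powers) auto

lemma theta3_sums:
  assumes "Re t > 0"
  shows "(\<lambda>j. exp (- (complex_of_real pi * of_nat ((Suc j)\<^sup>2) * t))) sums ((theta3 t - 1) / 2)"
  using summable_sums[OF summable_norm_cancel[OF theta_terms_summable[OF assms]]]
  by (simp add: theta3_def)

lemma theta3_holomorphic: "theta3 holomorphic_on {t. Re t > 0}"
proof -
  let ?S = "{t. Re t > 0}" and ?f = "\<lambda>j t. exp (- (complex_of_real pi * of_nat ((Suc j)\<^sup>2) * t))"
  have op: "open ?S" by (rule open_halfspace_Re_gt)
  obtain g where g: "\<forall>x\<in>?S. ((\<lambda>n. ?f n x) sums g x) \<and> g field_differentiable (at x)"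
  proof (rule series_differentiable_comparison_complex[OF op, of ?f])
    fix n :: nat and x :: complex
    assume "x \<in> ?S"
    show "?f n field_differentiable (at x)"
      unfolding field_differentiable_def by (rule exI, (rule derivative_eq_intros refl | simp)+)
  next
    fix x :: complex
    assume x: "x \<in> ?S"
    define d where "d = Re x / 2"
    have d: "d > 0" using x by (simp add: d_def)
    define h where "h = (\<lambda>n. complex_of_real (exp (- (pi * d)) ^ ((Suc n)\<^sup>2)))"
    have "summable h" unfolding h_def summable_complex_of_real
      using d by (intro summable_square_powers) auto
    moreover have "range h \<subseteq> \<real>\<^sub>\<ge>\<^sub>0" by (auto simp: h_def complex_nonneg_Reals_iff)
    moreover have "cmod (?f n y) \<le> cmod (h n)" if "y \<in> ball x d" for n y
    proof -
      have "\<bar>Re (x - y)\<bar> < d" using that abs_Re_le_cmod[of "x - y"] by (simp add: dist_norm)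
      then have "d \<le> Re y" unfolding d_def by (simp add: abs_if split: if_splits)
      then show ?thesis unfolding norm_theta_term h_def norm_of_real
        by (simp add: power_mono del: of_nat_power power_Suc)
    qed
    ultimately show "\<exists>d h. 0 < d \<and> summable h \<and> range h \<subseteq> \<real>\<^sub>\<ge>\<^sub>0 \<and>
        (\<forall>\<^sub>F n in sequentially. \<forall>y\<in>ball x d \<inter> ?S. cmod (?f n y) \<le> cmod (h n))"
      using d by (intro exI[of _ d] exI[of _ h]) auto
  qed blast
  have "theta3 x = 1 + 2 * g x" if "x \<in> ?S" for x
    using g that unfolding theta3_def by (metis sums_unique)
  moreover have "(\<lambda>x. 1 + 2 * g x) holomorphic_on ?S"
    using g op by (intro holomorphic_intros) (auto simp: holomorphic_on_open field_differentiable_def)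
  ultimately show ?thesis by (metis (no_types, lifting) holomorphic_transform)
qed

lemma halfplane_not_nonpos: "Re t > 0 \<Longrightarrow> t \<notin> \<real>\<^sub>\<le>\<^sub>0"
  by (auto simp: complex_nonpos_Reals_iff)

lemma Re_one_over: "Re (1 / t) = Re t / (norm t)\<^sup>2"
  by (simp add: Re_divide cmod_power2)

lemma Re_one_over_pos: "Re t > 0 \<Longrightarrow> Re (1 / t) > 0"
  unfolding Re_one_over by (auto intro!: divide_pos_pos)

lemma theta3_of_real:
  assumes "r > 0"
  shows "theta3 (of_real r) = of_real (1 + 2 * (\<Sum>j. exp (- (pi * (real (Suc j))\<^sup>2 * r))))"
proof -
  have e: "exp (- (complex_of_real pi * of_nat ((Suc j)\<^sup>2) * of_real r)) =
      of_real (exp (- (pi * (real (Suc j))\<^sup>2 * r)))" for j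
    by (simp flip: exp_of_real)
  have "summable (\<lambda>j. exp (- (pi * (real (Suc j))\<^sup>2 * r)))"
    using theta_terms_summable[of "of_real r"] assms unfolding e by simp
  then show ?thesis unfolding theta3_def e by (simp add: suminf_of_real)
qed

text \<open>Both sides are holomorphic in the right half-plane and agree on the positive reals,
  where Polya's formula applies with s = pi r; the identity theorem does the rest.\<close>

lemma theta3_inversion:
  assumes "Re t > 0"
  shows "theta3 (1 / t) = csqrt t * theta3 t"
proof -
  let ?S = "{t. Re t > 0}"
  let ?U = "complex_of_real ` {0<..}"
  have "theta3 (1 / t) - csqrt t * theta3 t = 0"
  proof (rule analytic_continuation[of "\<lambda>t. theta3 (1 / t) - csqrt t * theta3 t" ?S ?U 1])
    show "(\<lambda>t. theta3 (1 / t) - csqrt t * theta3 t) holomorphic_on ?S"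
    proof -
      have "(theta3 \<circ> (\<lambda>t. 1 / t)) holomorphic_on ?S"
        by (rule holomorphic_on_compose_gen[OF _ theta3_holomorphic])
          (auto intro!: holomorphic_intros Re_one_over_pos)
      then show ?thesis
        by (auto intro!: holomorphic_intros theta3_holomorphic dest: halfplane_not_nonpos simp: o_def)
    qed
    show "connected ?S" by (intro convex_connected convex_halfspace_Re_gt)
    show "1 islimpt ?U"
      unfolding islimpt_approachable
    proof (intro allI impI)
      fix e :: real assume "e > 0"
      then show "\<exists>x'\<in>?U. x' \<noteq> 1 \<and> dist x' 1 < e"
      proof (intro bexI[of _ "complex_of_real (1 + e / 2)"] conjI)
        show "complex_of_real (1 + e / 2) \<in> ?U" using \<open>e > 0\<close> by (intro imageI) simp
        show "complex_of_real (1 + e / 2) \<noteq> 1" using \<open>e > 0\<close> unfolding of_real_eq_1_iff by simp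
        have "complex_of_real (1 + e / 2) - 1 = complex_of_real (e / 2)" by simp
        then show "dist (complex_of_real (1 + e / 2)) 1 < e"
          using \<open>e > 0\<close> by (simp only: dist_norm norm_of_real)
      qed
    qed
    fix z assume "z \<in> ?U"
    then obtain r where r: "r > 0" "z = of_real r" by auto
    have inv: "1 + 2 * (\<Sum>j. exp (- (pi\<^sup>2 * (real (Suc j))\<^sup>2 / (pi * r)))) =
      sqrt (pi * r / pi) * (1 + 2 * (\<Sum>v. exp (- ((real (Suc v))\<^sup>2 * (pi * r)))))"
      by (rule real_theta_inversion) (use r in auto)
    have "theta3 (1 / z) = theta3 (of_real (1 / r))" by (simp add: r)
    also have "\<dots> = of_real (1 + 2 * (\<Sum>j. exp (- (pi * (real (Suc j))\<^sup>2 * (1 / r)))))"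
      using r by (intro theta3_of_real) auto
    also have "(\<lambda>j. exp (- (pi * (real (Suc j))\<^sup>2 * (1 / r)))) = (\<lambda>j. exp (- (pi\<^sup>2 * (real (Suc j))\<^sup>2 / (pi * r))))"
      by (simp add: power2_eq_square)
    also have "1 + 2 * (\<Sum>j. exp (- (pi\<^sup>2 * (real (Suc j))\<^sup>2 / (pi * r)))) =
        sqrt r * (1 + 2 * (\<Sum>v. exp (- (pi * (real (Suc v))\<^sup>2 * r))))"
      unfolding inv by (simp add: mult_ac)
    finally show "theta3 (1 / z) - csqrt z * theta3 z = 0"
      using r by (simp add: theta3_of_real)
  qed (use assms open_halfspace_Re_gt in auto)
  then show ?thesis by simp
qed

lemma theta3_shift2: "theta3 (t + 2 * \<i>) = theta3 t"
proof -
  have "exp (- (complex_of_real pi * of_nat k * (t + 2 * \<i>))) = exp (- (complex_of_real pi * of_nat k * t))" for k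
  proof -
    have "exp (- (complex_of_real pi * of_nat k * (t + 2 * \<i>))) =
      exp (- (complex_of_real pi * of_nat k * t)) * exp (- (2 * of_nat k * of_real pi * \<i>))"
      by (simp flip: exp_add add: algebra_simps)
    also have "exp (- (2 * of_nat k * of_real pi * \<i>)) = 1"
      unfolding exp_eq_1 by (auto intro!: exI[of _ "- int k"])
    finally show ?thesis by simp
  qed
  then show ?thesis by (simp only: theta3_def)
qed

lemma theta3_shift: "theta3 (t + \<i>) = theta4 t"
  by (simp add: theta4_def)

lemma theta4_shift: "theta4 (t + \<i>) = theta3 t"
  using theta3_shift2[of t] by (simp add: theta4_def algebra_simps)

lemma sums_pairs:
  fixes f :: "nat \<Rightarrow> 'a :: real_normed_vector"
  assumes "f sums s"
  shows "(\<lambda>n. f (2 * n) + f (2 * n + 1)) sums s"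
proof -
  have "{n * 2..<n * 2 + 2} = {2 * n, 2 * n + 1}" for n :: nat by auto
  then show ?thesis using sums_group[OF assms, of 2] by simp
qed

lemma theta2_sums:
  assumes "Re t > 0"
  shows "(\<lambda>k. 2 * exp (- (complex_of_real pi * of_nat ((2 * k + 1)\<^sup>2) * t / 4))) sums theta2 t"
proof -
  define e where "e = (\<lambda>k t. exp (- (complex_of_real pi * of_nat (k\<^sup>2) * t)))"
  have e_sums: "(\<lambda>j. e (Suc j) u) sums ((theta3 u - 1) / 2)" if "Re u > 0" for u
    unfolding e_def by (rule theta3_sums[OF that])
  have 1: "(\<lambda>n. e (Suc (2 * n)) (t / 4) + e (Suc (2 * n + 1)) (t / 4)) sums ((theta3 (t / 4) - 1) / 2)"
    using assms by (intro sums_pairs[of "\<lambda>j. e (Suc j) (t / 4)"] e_sums) simp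
  have 2: "e (Suc (2 * n + 1)) (t / 4) = e (Suc n) t" for n
    unfolding e_def by (rule arg_cong[of _ _ exp]) (simp add: power2_eq_square field_simps)
  have "(\<lambda>n. e (Suc (2 * n)) (t / 4)) sums ((theta3 (t / 4) - 1) / 2 - (theta3 t - 1) / 2)"
    using sums_diff[OF 1 e_sums[OF assms]] unfolding 2 by simp
  moreover have "(theta3 (t / 4) - 1) / 2 - (theta3 t - 1) / 2 = theta2 t / 2"
    by (simp add: theta2_def diff_divide_distrib)
  moreover have "e (Suc (2 * n)) (t / 4) = exp (- (complex_of_real pi * of_nat ((2 * n + 1)\<^sup>2) * t / 4))" for n
    by (simp add: e_def)
  ultimately have "(\<lambda>n. exp (- (complex_of_real pi * of_nat ((2 * n + 1)\<^sup>2) * t / 4))) sums (theta2 t / 2)"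
    by simp
  from sums_mult[OF this, of 2] show ?thesis by simp
qed

text \<open>Odd squares are 1 modulo 8, so the shift multiplies every term by the same phase exp (-
  pi i / 4). The norm is all that the reduction needs.\<close>

lemma norm_theta2_shift:
  assumes "Re t > 0"
  shows "norm (theta2 (t + \<i>)) = norm (theta2 t)"
proof -
  let ?f = "\<lambda>k t. 2 * exp (- (complex_of_real pi * of_nat ((2 * k + 1)\<^sup>2) * t / 4))"
  have e: "?f k (t + \<i>) = exp (- (of_real pi * \<i> / 4)) * ?f k t" for k
  proof -
    have "even (k * (k + 1))" by simp
    then obtain j where j: "k * (k + 1) = 2 * j" by blast
    have "(2 * k + 1)\<^sup>2 = 4 * (k * (k + 1)) + 1" by (simp add: power2_eq_square algebra_simps)
    then have sq: "(2 * k + 1)\<^sup>2 = 8 * j + 1" unfolding j by simp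
    have "?f k (t + \<i>) = ?f k t * exp (- (complex_of_real pi * \<i> / 4)) * exp (- (2 * of_nat j * of_real pi * \<i>))"
      unfolding sq mult.assoc exp_add[symmetric] by (simp add: algebra_simps add_divide_distrib)
    also have "exp (- (2 * of_nat j * of_real pi * \<i>)) = 1"
      unfolding exp_eq_1 by (auto intro!: exI[of _ "- int j"])
    finally show ?thesis by (simp add: mult_ac)
  qed
  have "(\<lambda>k. ?f k (t + \<i>)) sums theta2 (t + \<i>)" using assms by (intro theta2_sums) simp
  moreover have "(\<lambda>k. ?f k (t + \<i>)) sums (exp (- (of_real pi * \<i> / 4)) * theta2 t)"
    unfolding e by (intro sums_mult theta2_sums assms)
  ultimately have "theta2 (t + \<i>) = exp (- (of_real pi * \<i> / 4)) * theta2 t"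
    by (rule sums_unique2)
  then show ?thesis by (simp add: norm_mult norm_exp_eq_Re)
qed

lemma norm_theta_shift_int:
  assumes "Re t > 0"
  shows "norm (theta2 (t + \<i> * of_int k)) = norm (theta2 t) \<and>
    (if even k then theta3 (t + \<i> * of_int k) = theta3 t \<and> theta4 (t + \<i> * of_int k) = theta4 t
     else theta3 (t + \<i> * of_int k) = theta4 t \<and> theta4 (t + \<i> * of_int k) = theta3 t)"
proof (induction k rule: int_induct[of _ 0])
  case (step1 k)
  have "t + \<i> * of_int (k + 1) = (t + \<i> * of_int k) + \<i>" by (simp add: algebra_simps)
  then show ?case using step1 assms
    by (simp only: norm_theta2_shift[of "t + \<i> * of_int k"] theta3_shift theta4_shift) (auto split: if_splits simp: norm_theta2_shift)
next
  case (step2 k)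
  define u where "u = t + \<i> * of_int (k - 1)"
  have u: "t + \<i> * of_int k = u + \<i>" "Re u > 0" using assms by (auto simp: algebra_simps u_def)
  show ?case using step2 unfolding u_def[symmetric] u(1) theta3_shift theta4_shift norm_theta2_shift[OF u(2)]
    by (auto split: if_splits)
qed auto

lemma Re_csqrt_pos:
  assumes "Re t > 0"
  shows "Re (csqrt t) > 0"
proof -
  have "0 < Re ((csqrt t)\<^sup>2)" using assms by simp
  then have "(Re (csqrt t))\<^sup>2 > (Im (csqrt t))\<^sup>2" unfolding Re_power2 by simp
  then have "Re (csqrt t) \<noteq> 0"
    using zero_le_power2[of "Im (csqrt t)"] by (metis not_less power_zero_numeral)
  then show ?thesis using Re_csqrt[of t] by linarith
qed

lemma csqrt_four_times:
  assumes "Re t > 0"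
  shows "csqrt (t / 4) = csqrt t / 2" "csqrt (4 * t) = 2 * csqrt t"
proof -
  have "0 < Re (csqrt t / 2)" "0 < Re (2 * csqrt t)"
    using Re_csqrt_pos[OF assms] by (simp_all del: csqrt.simps)
  then show "csqrt (t / 4) = csqrt t / 2" "csqrt (4 * t) = 2 * csqrt t"
    by (intro csqrt_unique disjI1; simp add: power_divide power_mult_distrib del: csqrt.simps)+
qed

text \<open>In theta3 + theta4 the odd squares cancel and the even ones, 4 k^2, are doubled.
  Expressed in this way, theta4 inherits an inversion law from theta3.\<close>

lemma theta4_conv_theta3:
  assumes "Re u > 0"
  shows "theta4 u = 2 * theta3 (4 * u) - theta3 u"
proof -
  define e where "e = (\<lambda>k t. exp (- (complex_of_real pi * of_nat (k\<^sup>2) * t)))"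
  have e_sums: "(\<lambda>j. e (Suc j) u) sums ((theta3 u - 1) / 2)" if "Re u > 0" for u
    unfolding e_def by (rule theta3_sums[OF that])
  have s: "(\<lambda>j. e (Suc j) (u + \<i>) + e (Suc j) u) sums ((theta3 (u + \<i>) - 1) / 2 + (theta3 u - 1) / 2)"
    using assms by (intro sums_add e_sums) auto
  have ei: "e k (u + \<i>) = (-1) ^ k * e k u" for k
  proof -
    have "e k (u + \<i>) = e k u * exp (of_nat (k\<^sup>2) * (- (of_real pi * \<i>)))"
      unfolding e_def by (simp flip: exp_add add: algebra_simps)
    also have "exp (of_nat (k\<^sup>2) * (- (of_real pi * \<i>))) = (-1) ^ (k\<^sup>2)"
      unfolding exp_of_nat_mult by (simp add: exp_minus)
    also have "(-1 :: complex) ^ (k\<^sup>2) = (-1) ^ k"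
      by (cases "even k") auto
    finally show ?thesis by simp
  qed
  have p: "e (Suc (2 * n)) (u + \<i>) + e (Suc (2 * n)) u + (e (Suc (2 * n + 1)) (u + \<i>) + e (Suc (2 * n + 1)) u) = 2 * e (Suc n) (4 * u)" for n
  proof -
    have "e (Suc (2 * n + 1)) u = e (Suc n) (4 * u)"
      unfolding e_def by (rule arg_cong[of _ _ exp]) (simp add: power2_eq_square field_simps)
    then show ?thesis by (simp add: ei)
  qed
  have "(\<lambda>n. 2 * e (Suc n) (4 * u)) sums ((theta3 (u + \<i>) - 1) / 2 + (theta3 u - 1) / 2)"
    using sums_pairs[OF s] unfolding p .
  moreover have "(\<lambda>n. 2 * e (Suc n) (4 * u)) sums (2 * ((theta3 (4 * u) - 1) / 2))"
    using assms by (intro sums_mult e_sums) simp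
  ultimately have "(theta3 (u + \<i>) - 1) / 2 + (theta3 u - 1) / 2 = 2 * ((theta3 (4 * u) - 1) / 2)"
    by (rule sums_unique2)
  then have "theta3 (u + \<i>) + theta3 u = 2 * theta3 (4 * u)" by algebra
  then show ?thesis by (simp add: theta4_def eq_diff_eq)
qed

text \<open>Theta3 is inverted at t and also at 4 t or t/4. The factor 2 of
  \<open>theta4_conv_theta3\<close> matches csqrt (4 t) = 2 csqrt t in one case and cancels against
  csqrt (t/4) = csqrt t / 2 in the other.\<close>

lemma theta4_inversion:
  assumes "Re t > 0"
  shows "theta4 t * csqrt t = theta2 (1 / t)"
    and "theta4 (1 / t) = csqrt t * theta2 t"
proof -
  note theta4 = theta4_conv_theta3
  note Re = Re_one_over_pos[OF assms]
  have "theta3 (1 / t / 4) = csqrt (4 * t) * theta3 (4 * t)"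
    using theta3_inversion[of "4 * t"] assms by (simp add: mult.commute)
  then show "theta4 t * csqrt t = theta2 (1 / t)"
    unfolding theta2_def theta4[OF assms] theta3_inversion[OF assms] csqrt_four_times(2)[OF assms]
    by (simp add: algebra_simps)
  have "theta3 (4 * (1 / t)) = csqrt (t / 4) * theta3 (t / 4)"
    using theta3_inversion[of "t / 4"] assms by simp
  then show "theta4 (1 / t) = csqrt t * theta2 t"
    unfolding theta2_def theta4[OF Re] theta3_inversion[OF assms] csqrt_four_times(1)[OF assms]
    by (simp add: algebra_simps)
qed

lemma theta4_series_exp:
  "theta4 t = theta4_series (exp (- (of_real pi * t)))"
proof -
  have "exp (- (complex_of_real pi * of_nat ((Suc j)\<^sup>2) * (t + \<i>))) = (-1) ^ Suc j * exp (- (of_real pi * t)) ^ ((Suc j)\<^sup>2)" for j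
  proof -
    have "exp (- (complex_of_real pi * of_nat ((Suc j)\<^sup>2) * (t + \<i>))) =
      exp (of_nat ((Suc j)\<^sup>2) * (- (of_real pi * \<i>))) * exp (of_nat ((Suc j)\<^sup>2) * (- (of_real pi * t)))"
      by (simp flip: exp_add add: algebra_simps)
    also have "\<dots> = (-1) ^ ((Suc j)\<^sup>2) * exp (- (of_real pi * t)) ^ ((Suc j)\<^sup>2)"
      unfolding exp_of_nat_mult by (simp add: exp_minus)
    also have "(-1 :: complex) ^ ((Suc j)\<^sup>2) = (-1) ^ Suc j"
      by (cases "even (Suc j)") auto
    finally show ?thesis .
  qed
  then show ?thesis by (simp only: theta4_def theta3_def theta4_series_def)
qed

section \<open>Reduction to large real part\<close>

text \<open>Splitting x into k equal steps makes the quadratic Taylor bound sharp enough that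
  rational arithmetic certifies the numerical lower bounds for exp.\<close>

lemma exp_ge_quadratic_power:
  fixes x :: real
  assumes "0 \<le> x" "k > 0"
  shows "(1 + x / real k + (x / real k)\<^sup>2 / 2) ^ k \<le> exp x"
proof -
  have "(1 + x / real k + (x / real k)\<^sup>2 / 2) ^ k \<le> exp (x / real k) ^ k"
    using assms by (intro power_mono exp_lower_Taylor_quadratic add_nonneg_nonneg) auto
  also have "\<dots> = exp x" using assms by (simp flip: exp_of_nat_mult)
  finally show ?thesis .
qed

lemma exp_neg_pi_bounds:
  shows "exp (- (3 / 4 * pi)) \<le> (1 / 5 :: real)" "exp (- (3 / 2 * pi)) \<le> (1 / 101 :: real)"
proof -
  have "(5 :: real) \<le> exp (9 / 4)"
    using exp_ge_quadratic_power[of "9 / 4" 1] by (simp add: power2_eq_square)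
  also have "\<dots> \<le> exp (3 / 4 * pi)" using pi_gt3 by simp
  finally show "exp (- (3 / 4 * pi)) \<le> (1 / 5 :: real)"
    by (simp add: exp_minus field_simps)
  \<comment> \<open>The fraction is 1 + u + u^2/2 at u = 4.71/16, and 4.71 lies just below 3 pi /
    2.\<close>
  have "(101 :: real) \<le> (6849041 / 5120000) ^ 16" by (simp add: power_divide)
  also have "\<dots> \<le> exp (471 / 100)"
    using exp_ge_quadratic_power[of "471 / 100" 16] by (simp add: power2_eq_square)
  also have "\<dots> \<le> exp (3 / 2 * pi)" using pi_approx(1) by simp
  finally show "exp (- (3 / 2 * pi)) \<le> (1 / 101 :: real)"
    by (simp add: exp_minus field_simps)
qed

section \<open>Size of the theta functions where Re t is at least 3/4\<close>

lemma geometric_suminf_Suc: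
  fixes x :: real
  assumes "0 \<le> x" "x < 1"
  shows "summable (\<lambda>j. x ^ Suc j)" "(\<Sum>j. x ^ Suc j) = x / (1 - x)"
proof -
  have "(\<lambda>j. x * x ^ j) sums (x * (1 / (1 - x)))"
    using assms by (intro sums_mult geometric_sums) simp
  then show "summable (\<lambda>j. x ^ Suc j)" "(\<Sum>j. x ^ Suc j) = x / (1 - x)"
    by (auto simp: sums_iff)
qed

text \<open>Replacing the squares by all positive exponents bounds the tail by 2 x/(1 - x), and x <=
  exp (- 3 pi / 4) <= 1/5.\<close>

lemma norm_theta3_minus_1:
  assumes "Re t \<ge> 3 / 4"
  shows "norm (theta3 t - 1) \<le> 1 / 2"
proof -
  define x where "x = exp (- (pi * Re t))"
  have "x \<le> exp (- (3 / 4 * pi))" using assms by (simp add: x_def)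
  from order_trans[OF this exp_neg_pi_bounds(1)]
  have x: "0 \<le> x" "x \<le> 1 / 5" by (auto simp: x_def)
  have "norm (\<Sum>j. exp (- (complex_of_real pi * of_nat ((Suc j)\<^sup>2) * t))) \<le> (\<Sum>j. x ^ Suc j)"
  proof (rule norm_suminf_le[rotated])
  show "summable (\<lambda>j. x ^ Suc j)" using x by (intro geometric_suminf_Suc) auto
  fix j :: nat
  have "Suc j \<le> (Suc j)\<^sup>2" by (simp add: power2_eq_square)
  then show "norm (exp (- (complex_of_real pi * of_nat ((Suc j)\<^sup>2) * t))) \<le> x ^ Suc j"
    unfolding norm_theta_term x_def[symmetric] using x by (intro power_decreasing) auto
  qed
  also have "\<dots> = x / (1 - x)" using x by (intro geometric_suminf_Suc) auto
  also have "\<dots> \<le> 1 / 4" using x by (simp add: field_simps)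
  finally show ?thesis by (simp add: theta3_def norm_mult)
qed

lemma norm_theta34_ge:
  assumes "Re t \<ge> 3 / 4"
  shows "norm (theta3 t) \<ge> 1 / 2" "norm (theta4 t) \<ge> 1 / 2"
  using norm_theta3_minus_1[of t] norm_theta3_minus_1[of "t + \<i>"] assms
    norm_triangle_ineq2[of 1 "1 - theta3 t"] norm_triangle_ineq2[of 1 "1 - theta3 (t + \<i>)"]
  by (auto simp: theta4_def norm_minus_commute)

text \<open>After the leading term is factored out, the exponents are ((2k + 1)^2 - 1)/4 = k (k + 1)
  >= 2k, so a geometric series bounds u. The constant bound keeps 1 + u away from 0; the decaying
  one is needed to beat the growth of 1/theta2.\<close>

lemma theta2_approx:
  assumes "Re t \<ge> 3 / 4"
  obtains u where "theta2 t = 2 * exp (- (of_real pi * t / 4)) * (1 + u)"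
    "norm u \<le> 1 / 100" "norm u \<le> 2 * exp (- (2 * pi * Re t))"
proof -
  define x where "x = exp (- (2 * pi * Re t))"
  have "x \<le> exp (- (3 / 2 * pi))" using assms by (simp add: x_def)
  from order_trans[OF this exp_neg_pi_bounds(2)]
  have x: "0 \<le> x" "x \<le> 1 / 101" by (auto simp: x_def)
  define f where "f = (\<lambda>k. exp (- (complex_of_real pi * of_nat ((2 * k + 1)\<^sup>2) * t / 4)))"
  define g where "g = (\<lambda>k. exp (- (complex_of_real pi * of_nat (k * (k + 1)) * t)))"
  have fg: "f k = exp (- (of_real pi * t / 4)) * g k" for k
    unfolding f_def g_def exp_add[symmetric] by (rule arg_cong[of _ _ exp]) (simp add: power2_eq_square field_simps)
  have gb: "norm (g (Suc k)) \<le> x ^ Suc k" for k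
  proof -
    have "norm (g (Suc k)) = exp (- (pi * Re t)) ^ (Suc k * (Suc k + 1))"
      unfolding g_def norm_theta_term ..
    also have "\<dots> \<le> exp (- (pi * Re t)) ^ (2 * Suc k)"
      using assms by (intro power_decreasing) auto
    also have "\<dots> = x ^ Suc k"
      unfolding power_mult x_def by (simp add: power2_eq_square mult_exp_exp mult.assoc)
    finally show ?thesis .
  qed
  have sg: "summable (\<lambda>k. g (Suc k))"
    by (rule summable_comparison_test'[OF geometric_suminf_Suc(1)]) (use x gb in auto)
  have g: "g sums (1 + (\<Sum>k. g (Suc k)))"
    using summable_sums[OF sg] unfolding sums_Suc_iff by (simp add: g_def add.commute)
  have "(\<lambda>k. 2 * f k) sums (2 * (exp (- (of_real pi * t / 4)) * (1 + (\<Sum>k. g (Suc k)))))"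
    unfolding fg by (intro sums_mult g)
  then have "theta2 t = 2 * (exp (- (of_real pi * t / 4)) * (1 + (\<Sum>k. g (Suc k))))"
    using theta2_sums[of t] assms sums_unique2 unfolding f_def by fastforce
  moreover have u: "norm (\<Sum>k. g (Suc k)) \<le> x / (1 - x)"
    using norm_suminf_le[of "\<lambda>k. g (Suc k)" "\<lambda>k. x ^ Suc k", OF gb geometric_suminf_Suc(1)] x
    geometric_suminf_Suc(2)[of x] by simp
  moreover have xx: "x / (1 - x) \<le> 1 / 100" "x / (1 - x) \<le> 2 * x"
  proof -
    show "x / (1 - x) \<le> 1 / 100" using x by (simp add: field_simps)
    have "x * 1 \<le> x * (2 * (1 - x))" using x by (intro mult_left_mono) auto
    then show "x / (1 - x) \<le> 2 * x" using x by (simp add: divide_le_eq algebra_simps)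
  qed
  ultimately show ?thesis
    using order_trans[OF u xx(1)] order_trans[OF u xx(2)]
    by (intro that[of "\<Sum>k. g (Suc k)"]) (simp_all add: x_def mult.assoc)
qed

lemma norm_inverse_theta2_le:
  assumes "Re t \<ge> 3 / 4"
  shows "theta2 t \<noteq> 0" "norm (1 / theta2 t) \<le> 0.506 * exp (pi * Re t / 4)"
proof -
  obtain u where u: "theta2 t = 2 * exp (- (of_real pi * t / 4)) * (1 + u)" "norm u \<le> 1 / 100"
    using theta2_approx[OF assms] by metis
  have "norm (1 + u) \<ge> 99 / 100" using norm_triangle_ineq2[of 1 "- u"] u(2) by simp
  then have n2: "norm (theta2 t) \<ge> 2 * exp (- (pi * Re t / 4)) * (99 / 100)"
    unfolding u(1) norm_mult by (intro mult_mono) (auto simp: norm_exp_eq_Re)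
  have pos: "2 * exp (- (pi * Re t / 4)) * (99 / 100) > 0" by simp
  then have nz: "norm (theta2 t) > 0" using n2 by linarith
  have "norm (1 / theta2 t) \<le> 1 / (2 * exp (- (pi * Re t / 4)) * (99 / 100))"
    unfolding norm_divide norm_one
    by (rule divide_left_mono) (use n2 nz pos in auto)
  also have "\<dots> = 50 / 99 * exp (pi * Re t / 4)"
    by (simp add: exp_minus field_simps)
  \<comment> \<open>0.506 is 1/(2 * 0.99) = 50/99 rounded up. It is the prefactor in
    \<open>far_bound\<close>, \<open>near_gauss\<close> and \<open>near_tail\<close>.\<close>
  also have "\<dots> \<le> 0.506 * exp (pi * Re t / 4)" by (intro mult_right_mono) auto
  finally show "norm (1 / theta2 t) \<le> 0.506 * exp (pi * Re t / 4)" .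
  show "theta2 t \<noteq> 0" using nz by auto
qed

text \<open>Both terms grow like exp (pi Re t / 4), but their relative difference decays like exp (-
  2 pi Re t), so the absolute difference stays bounded.\<close>

lemma inverse_theta2_approx:
  assumes "Re t \<ge> 3 / 4"
  shows "norm (1 / theta2 t - exp (of_real pi * t / 4) / 2) \<le> 1 / 2"
proof -
  obtain u where u: "theta2 t = 2 * exp (- (of_real pi * t / 4)) * (1 + u)" "norm u \<le> 1 / 100"
      "norm u \<le> 2 * exp (- (2 * pi * Re t))"
    using theta2_approx[OF assms] by metis
  have n: "norm (1 + u) \<ge> 99 / 100" using norm_triangle_ineq2[of 1 "- u"] u(2) by simp
  then have nz: "1 + u \<noteq> 0" by auto
  have "1 / theta2 t - exp (of_real pi * t / 4) / 2 = - (exp (of_real pi * t / 4) / 2 * (u / (1 + u)))"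
  proof -
    have gen: "1 / (2 * inverse e * w) - e / 2 = - (e / 2 * ((w - 1) / w))" if "e \<noteq> 0" "w \<noteq> 0" for e w :: complex
      using that by (simp add: field_simps)
    show ?thesis unfolding u(1) exp_minus using gen[of "exp (of_real pi * t / 4)" "1 + u"] nz by simp
  qed
  then have "norm (1 / theta2 t - exp (of_real pi * t / 4) / 2) = exp (pi * Re t / 4) / 2 * (norm u / norm (1 + u))"
    by (simp only: norm_minus_cancel norm_mult norm_divide norm_exp_eq_Re norm_numeral) simp
  also have "\<dots> \<le> exp (pi * Re t / 4) / 2 * (2 * exp (- (2 * pi * Re t)) / (99 / 100))"
    using n u(3) by (intro mult_left_mono frac_le) auto
  also have "\<dots> = 100 / 99 * exp (- (7 * pi * Re t / 4))"
    by (simp add: mult_exp_exp algebra_simps)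
  also have "\<dots> \<le> 100 / 99 * exp (- (3 / 4 * pi))"
    using assms by (intro mult_left_mono iffD2[OF exp_le_cancel_iff]) (auto simp: field_simps)
  also have "\<dots> \<le> 100 / 99 * (1 / 5)" using exp_neg_pi_bounds(1) by (intro mult_left_mono) auto
  finally show ?thesis by simp
qed

text \<open>Modulo 2, the pair (c, d) determines which of the three theta functions arises after reduction to
  a point with large real part.\<close>

definition reduced_theta_norms :: "bool \<Rightarrow> complex \<Rightarrow> real set" where
  "reduced_theta_norms b t = (if b then {norm (theta2 t)} else {norm (theta3 t), norm (theta4 t)})"

text \<open>Shift Im t into [-1/2, 1/2], then invert. While Re t < 3/4, the shifted point has
  squared modulus at most 1/4 + 9/16 = 13/16, so each round enlarges Re t by the factor 16/13 at
  least and n bounds the number of rounds. The threshold 3/4 is below sqrt 3 / 2, the least real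
  part in the usual fundamental domain, and so buys this fixed gain. All three theta functions are
  carried along because inversion exchanges theta2 with theta4 and the shift exchanges theta3 with
  theta4.\<close>

lemma theta_reduction_aux:
  assumes "Re t > 0" "Re t \<ge> 3 / 4 * (13 / 16) ^ n"
  shows "\<exists>c d t'. coprime c d \<and> Re t' \<ge> 3 / 4 \<and>
    Re t' * (norm (of_int c * t + \<i> * of_int d))\<^sup>2 = Re t \<and>
    norm (theta4 t) * sqrt (norm (of_int c * t + \<i> * of_int d)) \<in> reduced_theta_norms (odd c \<and> even (d::int)) t' \<and>
    norm (theta3 t) * sqrt (norm (of_int c * t + \<i> * of_int d)) \<in> reduced_theta_norms (odd c \<and> odd d) t' \<and>
    norm (theta2 t) * sqrt (norm (of_int c * t + \<i> * of_int d)) \<in> reduced_theta_norms (even c) t'"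
  using assms
proof (induction n arbitrary: t)
  case 0
  then show ?case
    by (intro exI[of _ 0] exI[of _ 1] exI[of _ t]) (auto simp: reduced_theta_norms_def)
next
  case (Suc n)
  show ?case
  proof (cases "Re t \<ge> 3 / 4")
    case True
    then show ?thesis
      by (intro exI[of _ 0] exI[of _ 1] exI[of _ t]) (auto simp: reduced_theta_norms_def)
  next
    case False
    define k where "k = - round (Im t)"
    define t0 where "t0 = t + \<i> * of_int k"
    define t1 where "t1 = 1 / t0"
    have Re0: "Re t0 = Re t" by (simp add: t0_def)
    have "\<bar>Im t0\<bar> \<le> 1 / 2"
      using of_int_round_abs_le[of "Im t"] by (simp add: t0_def k_def abs_minus_commute)
    then have "(Im t0)\<^sup>2 \<le> (1 / 2)\<^sup>2" using abs_le_square_iff[of "Im t0" "1 / 2"] by simp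
    moreover have "(Re t0)\<^sup>2 \<le> (3 / 4)\<^sup>2"
      using False Suc.prems Re0 by (intro power_mono) auto
    ultimately have n0: "(norm t0)\<^sup>2 \<le> 13 / 16" unfolding cmod_power2 by (simp add: power2_eq_square)
    have t0: "t0 \<noteq> 0" using Suc.prems Re0 by auto
    have Re1: "Re t1 = Re t / (norm t0)\<^sup>2" by (simp add: t1_def Re_one_over Re0)
    have Re1pos: "Re t1 > 0" using Suc.prems t0 unfolding Re1 by simp
    have "3 / 4 * (13 / 16) ^ n \<le> Re t / (13 / 16)" using Suc.prems by simp
    also have "\<dots> \<le> Re t1" unfolding Re1 using n0 t0 Suc.prems by (intro divide_left_mono) auto
    finally obtain c1 d1 t' where IH: "coprime c1 d1" "Re t' \<ge> 3 / 4"
      "Re t' * (norm (of_int c1 * t1 + \<i> * of_int d1))\<^sup>2 = Re t1"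
      "norm (theta4 t1) * sqrt (norm (of_int c1 * t1 + \<i> * of_int d1)) \<in> reduced_theta_norms (odd c1 \<and> even (d1::int)) t'"
      "norm (theta3 t1) * sqrt (norm (of_int c1 * t1 + \<i> * of_int d1)) \<in> reduced_theta_norms (odd c1 \<and> odd d1) t'"
      "norm (theta2 t1) * sqrt (norm (of_int c1 * t1 + \<i> * of_int d1)) \<in> reduced_theta_norms (even c1) t'"
      using Suc.IH[OF Re1pos] by blast
    \<comment> \<open>The pair is read off from -i (c1/t0 + i d1) t0 = d1 t0 - i c1 = d1 t + i (d1 k
      - c1).\<close>
    define c where "c = d1"
    define d where "d = d1 * k - c1"
    have "of_int c * t + \<i> * of_int d = - \<i> * (of_int c1 * t1 + \<i> * of_int d1) * t0 + 0"
      using t0 by (simp add: c_def d_def t1_def t0_def field_simps)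
    then have N: "norm (of_int c * t + \<i> * of_int d) = norm (of_int c1 * t1 + \<i> * of_int d1) * norm t0"
      by (simp add: norm_mult)
    have cop: "coprime c d"
    proof (rule coprimeI)
      fix e assume e: "e dvd c" "e dvd d"
      then have "e dvd c * k - d" by (intro dvd_diff dvd_mult2)
      then have "e dvd d1" "e dvd c1" using e(1) by (simp_all add: c_def d_def)
      then show "is_unit e" using IH(1) coprime_common_divisor by blast
    qed
    have 1: "Re t' * (norm (of_int c * t + \<i> * of_int d))\<^sup>2 = Re t"
    proof -
      have "Re t' * (norm (of_int c * t + \<i> * of_int d))\<^sup>2 = Re t1 * (norm t0)\<^sup>2"
        unfolding N IH(3)[symmetric] by (simp add: power_mult_distrib)
      then show ?thesis unfolding Re1 using t0 by simp
    qed
    have ncs: "norm (csqrt t0) = sqrt (norm t0)" by simp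
    have Re0p: "Re t0 > 0" using Suc.prems Re0 by simp
    have w: "norm (theta4 t0) * sqrt (norm t0) = norm (theta2 t1)"
       "norm (theta3 t0) * sqrt (norm t0) = norm (theta3 t1)"
       "norm (theta2 t0) * sqrt (norm t0) = norm (theta4 t1)"
      using arg_cong[OF theta4_inversion(1)[OF Re0p], of norm] arg_cong[OF theta4_inversion(2)[OF Re0p], of norm]
        arg_cong[OF theta3_inversion[OF Re0p], of norm]
      unfolding t1_def norm_mult ncs by (simp_all only: mult.commute)
    have w': "norm (theta4 t0) * sqrt (norm (of_int c * t + \<i> * of_int d)) \<in> reduced_theta_norms (even c1) t'"
      "norm (theta3 t0) * sqrt (norm (of_int c * t + \<i> * of_int d)) \<in> reduced_theta_norms (odd c1 \<and> odd d1) t'"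
      "norm (theta2 t0) * sqrt (norm (of_int c * t + \<i> * of_int d)) \<in> reduced_theta_norms (odd c1 \<and> even d1) t'"
      using IH(4,5,6) unfolding w[symmetric] N real_sqrt_mult by (simp_all only: mult_ac)
    have odd: "odd c1 \<or> odd d1"
      using IH(1) by (meson coprime_common_divisor odd_one)
    have s: "norm (theta2 t0) = norm (theta2 t)"
      "if even k then theta3 t0 = theta3 t \<and> theta4 t0 = theta4 t else theta3 t0 = theta4 t \<and> theta4 t0 = theta3 t"
      using norm_theta_shift_int[OF Suc.prems(1), of k] unfolding t0_def by auto
    have "norm (theta4 t) * sqrt (norm (of_int c * t + \<i> * of_int d)) \<in> reduced_theta_norms (odd c \<and> even d) t' \<and>
      norm (theta3 t) * sqrt (norm (of_int c * t + \<i> * of_int d)) \<in> reduced_theta_norms (odd c \<and> odd d) t' \<and>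
      norm (theta2 t) * sqrt (norm (of_int c * t + \<i> * of_int d)) \<in> reduced_theta_norms (even c) t'"
    \<comment> \<open>An odd shift exchanges the classes (odd, even) and (odd, odd) of (c, d), just
      as it exchanges theta4 and theta3. Coprimality excludes (even, even), so the three remaining
      classes are permuted.\<close>
    proof (cases "even k")
      case True
      then have "(odd c \<and> even d) = even c1" "(odd c \<and> odd d) = (odd c1 \<and> odd d1)" "even c = (odd c1 \<and> even d1)"
        using odd by (auto simp: c_def d_def)
      then show ?thesis using w' s True by simp
    next
      case False
      then have "(odd c \<and> odd d) = even c1" "(odd c \<and> even d) = (odd c1 \<and> odd d1)" "even c = (odd c1 \<and> even d1)"
        using odd by (auto simp: c_def d_def)
      then show ?thesis using w' s False by simp
    qed
    with cop IH(2) 1 show ?thesis by blast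
  qed
qed

lemma theta4_reduction:
  assumes "Re t > 0"
  obtains c d :: int and t' where "coprime c d" "Re t' \<ge> 3 / 4"
    "Re t' * (norm (of_int c * t + \<i> * of_int d))\<^sup>2 = Re t"
    "norm (theta4 t) * sqrt (norm (of_int c * t + \<i> * of_int d)) \<in> reduced_theta_norms (odd c \<and> even d) t'"
proof -
  obtain n where "(13 / 16) ^ n < Re t / (3 / 4)"
    using real_arch_pow_inv[of "Re t / (3 / 4)" "13 / 16"] assms by auto
  then have "3 / 4 * (13 / 16) ^ n \<le> Re t" by simp
  from theta_reduction_aux[OF assms this] show ?thesis using that by blast
qed

section \<open>The coefficient integral\<close>

lemma has_integral_exp_period:
  fixes j :: int
  shows "((\<lambda>v. exp (of_real (pi * of_int j) * Complex y v)) has_integral (if j = 0 then 2 else 0)) {-1..1}"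
proof (cases "j = 0")
  case True
  then show ?thesis using has_integral_const_real[of "1 :: complex" "-1" 1] by (simp add: scaleR_2)
next
  case False
  let ?c = "complex_of_real (pi * of_int j)"
  let ?G = "\<lambda>v. exp (?c * Complex y v) / (\<i> * ?c)"
  have c: "?c \<noteq> 0" using False by simp
  have "((\<lambda>v. exp (?c * Complex y v)) has_integral (?G 1 - ?G (-1))) {-1..1}"
  proof (rule fundamental_theorem_of_calculus)
    fix v :: real
    have "((\<lambda>v. exp (?c * (of_real y + \<i> * of_real v)) / (\<i> * ?c)) has_vector_derivative
      exp (?c * (of_real y + \<i> * of_real v))) (at v within {-1..1})"
      by (rule has_vector_derivative_real_field, (rule derivative_eq_intros refl | (use c in simp))+)
    then show "(?G has_vector_derivative exp (?c * Complex y v)) (at v within {-1..1})"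
      by (simp add: Complex_eq)
  qed simp
  moreover have "?G 1 - ?G (-1) = 0"
  proof -
    have "exp (?c * Complex y 1) = exp (?c * Complex y (-1)) * exp (2 * of_int j * of_real pi * \<i>)"
      unfolding mult_exp_exp by (rule arg_cong[of _ _ exp]) (simp add: Complex_eq algebra_simps)
    also have "exp (2 * of_int j * of_real pi * \<i>) = 1"
      unfolding exp_eq_1 by auto
    finally show ?thesis by simp
  qed
  ultimately show ?thesis using False by simp
qed

lemma norm_exp_pi_less_1: "Re t > 0 \<Longrightarrow> norm (exp (- (of_real pi * t))) < 1"
  by (simp add: norm_exp_eq_Re)

text \<open>No product formula for theta4 is needed: its product with a convergent power series is
  1.\<close>

lemma theta4_nonzero:
  assumes "Re t > 0"
  shows "theta4 t \<noteq> 0"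
  using pbar_generating_function[OF norm_exp_pi_less_1[OF assms]] unfolding theta4_series_exp by auto

lemma inverse_theta4_sums:
  assumes "Re t > 0"
  shows "(\<lambda>k. of_nat (pbar k) * exp (- (of_real pi * t)) ^ k) sums (1 / theta4 t)"
proof -
  let ?z = "exp (- (of_real pi * t))"
  have "summable (\<lambda>k. of_nat (pbar k) * ?z ^ k)"
    using pbar_summable[OF norm_exp_pi_less_1[OF assms]] by (rule summable_norm_cancel)
  moreover have "(\<Sum>k. of_nat (pbar k) * ?z ^ k) = 1 / theta4 t"
    using pbar_generating_function[OF norm_exp_pi_less_1[OF assms]] theta4_nonzero[OF assms]
    unfolding theta4_series_exp by (simp add: field_simps)
  ultimately show ?thesis by (simp add: sums_iff)
qed

text \<open>Cauchy's formula as termwise integration over one period of length 2, whence the factor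
  2. The norms of the terms do not depend on v, so their values at v = 0 serve as majorants for
  uniform convergence.\<close>

lemma pbar_integral:
  assumes y: "y > 0"
  shows "((\<lambda>v. exp (of_real (pi * real n) * Complex y v) / theta4 (Complex y v)) has_integral
    of_nat (2 * pbar n)) {-1..1}"
proof -
  define f where "f = (\<lambda>k v. of_nat (pbar k) * exp (of_real (pi * of_int (int n - int k)) * Complex y v))"
  have f_eq: "f k v = exp (of_real (pi * real n) * Complex y v) * (of_nat (pbar k) * exp (- (of_real pi * Complex y v)) ^ k)" for k v
    unfolding f_def by (simp add: exp_of_nat_mult[symmetric] mult_exp_exp algebra_simps)
  have sums: "(\<lambda>k. f k v) sums (exp (of_real (pi * real n) * Complex y v) / theta4 (Complex y v))" for v
    using sums_mult[OF inverse_theta4_sums[of "Complex y v"]] y unfolding f_eq by simp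
  define M where "M = (\<lambda>k. norm (f k 0))"
  have M: "summable M"
    unfolding M_def f_eq norm_mult
    using pbar_summable[OF norm_exp_pi_less_1[of "Complex y 0"]] y by (intro summable_mult) (simp add: norm_mult)
  have fM: "norm (f k v) \<le> M k" for k v
    unfolding M_def f_def by (simp add: norm_mult norm_exp_eq_Re)
  have "uniform_limit (cbox (-1) 1) (\<lambda>N v. \<Sum>k<N. f k v)
      (\<lambda>v. \<Sum>k. f k v) sequentially"
    by (rule Weierstrass_m_test[OF fM M])
  moreover have "(\<lambda>v. \<Sum>k. f k v) = (\<lambda>v. exp (of_real (pi * real n) * Complex y v) / theta4 (Complex y v))"
    using sums by (auto simp: sums_iff)
  ultimately have unif: "uniform_limit (cbox (-1) 1) (\<lambda>N v. \<Sum>k<N. f k v)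
      (\<lambda>v. exp (of_real (pi * real n) * Complex y v) / theta4 (Complex y v)) sequentially" by simp
  have int_f: "(f k has_integral of_nat (pbar k) * (if k = n then 2 else 0)) (cbox (-1) 1)" for k
    using has_integral_mult_right[OF has_integral_exp_period[of "int n - int k" y], of "of_nat (pbar k)"]
    unfolding f_def by (cases "k = n") auto
  have cont: "continuous_on (cbox (-1) 1) (\<lambda>v. \<Sum>k<N. f k v)" for N
    unfolding f_def Complex_eq by (intro continuous_intros)
  obtain I J where IJ: "\<And>N. ((\<lambda>v. \<Sum>k<N. f k v) has_integral I N) (cbox (-1) 1)"
     "((\<lambda>v. exp (of_real (pi * real n) * Complex y v) / theta4 (Complex y v)) has_integral J) (cbox (-1) 1)"
     "(I \<longlongrightarrow> J) sequentially"
    by (rule uniform_limit_integral_cbox[OF unif cont]) auto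
  have "I N = (\<Sum>k<N. of_nat (pbar k) * (if k = n then 2 else 0))" for N
    by (rule has_integral_unique[OF IJ(1)]) (intro has_integral_sum int_f, simp)
  moreover have "(\<Sum>k<N. of_nat (pbar k) * (if k = n then 2 else 0 :: complex)) = of_nat (2 * pbar n)" if "N > n" for N
    using that by (simp add: if_distrib[of "\<lambda>x. _ * x"] sum.delta cong: if_cong)
  ultimately have "\<forall>\<^sub>F N in sequentially. I N = of_nat (2 * pbar n)"
    by (intro eventually_mono[OF eventually_gt_at_top[of n]]) (simp only:)
  then have "I \<longlonglongrightarrow> of_nat (2 * pbar n)" by (rule tendsto_eventually)
  then have "J = of_nat (2 * pbar n)" using IJ(3) LIMSEQ_unique by blast
  then show ?thesis using IJ(2) by simp
qed

section \<open>The main arc\<close>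

lemma integral_gaussian_half_line: "((\<lambda>Y. integral {0..Y} (\<lambda>v::real. exp (- v\<^sup>2))) \<longlongrightarrow> sqrt pi / 2) at_top"
proof -
  define g where "g = (\<lambda>x::real. indicator {0..} x *\<^sub>R exp (- x\<^sup>2))"
  have hb: "has_bochner_integral lborel g (sqrt pi / 2)"
    unfolding g_def by (rule gaussian_moment_0)
  have "((\<lambda>Y. \<integral>x. indicator {..Y} x *\<^sub>R g x \<partial>lborel) \<longlongrightarrow> integral\<^sup>L lborel g) at_top"
    using hb by (intro tendsto_integral_at_top) (auto simp: has_bochner_integral_iff)
  moreover have "(\<integral>x. indicator {..Y} x *\<^sub>R g x \<partial>lborel) = integral {0..Y} (\<lambda>v::real. exp (- v\<^sup>2))" for Y :: real
  proof -
    have "set_integrable lborel {0..Y} (\<lambda>v::real. exp (- v\<^sup>2))"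
      by (intro borel_integrable_atLeastAtMost') (intro continuous_intros)
    moreover have "indicator {..Y} x *\<^sub>R g x = indicator {0..Y} x *\<^sub>R exp (- x\<^sup>2)" for x :: real
      by (auto simp: indicator_def g_def)
    ultimately show ?thesis using set_borel_integral_eq_integral(2)[of "{0..Y}" "\<lambda>v::real. exp (- v\<^sup>2)"]
      unfolding set_lebesgue_integral_def by simp
  qed
  moreover have "integral\<^sup>L lborel g = sqrt pi / 2" using hb by (simp add: has_bochner_integral_iff)
  ultimately show ?thesis by simp
qed

lemma integral_gaussian_le:
  assumes "Y \<ge> 0"
  shows "integral {0..Y} (\<lambda>v::real. exp (- v\<^sup>2)) \<le> sqrt pi / 2"
proof (rule tendsto_lowerbound[OF integral_gaussian_half_line])
  show "\<forall>\<^sub>F X in at_top. integral {0..Y} (\<lambda>v::real. exp (- v\<^sup>2)) \<le> integral {0..X} (\<lambda>v. exp (- v\<^sup>2))"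
    using eventually_ge_at_top[of Y]
    by eventually_elim
      (intro integral_subset_le integrable_continuous_real continuous_intros; simp)
qed simp

text \<open>This is sqrt pi / 2 times the imaginary error function. Antisymmetrising any primitive
  makes it odd, which fixes the constant and later transfers bounds to the lower half-plane.\<close>

lemma gaussian_primitive:
  obtains F :: "complex \<Rightarrow> complex"
  where "\<And>z. (F has_field_derivative exp (z\<^sup>2)) (at z)" "\<And>z. F (- z) = - F z"
proof -
  have "(\<lambda>z::complex. exp (z\<^sup>2)) holomorphic_on UNIV" by (intro holomorphic_intros)
  then obtain G :: "complex \<Rightarrow> complex" where "\<And>z. z \<in> UNIV \<Longrightarrow> (G has_field_derivative exp (z\<^sup>2)) (at z within UNIV)"
    using holomorphic_convex_primitive'[OF convex_UNIV open_UNIV] by blast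
  then have G: "(G has_field_derivative exp (z\<^sup>2)) (at z)" for z by simp
  define F where "F = (\<lambda>z. (G z - G (- z)) / 2)"
  have "(F has_field_derivative exp (z\<^sup>2)) (at z)" for z
  proof -
    have "((\<lambda>z. G (- z)) has_field_derivative exp ((- z)\<^sup>2) * (- 1)) (at z)"
      by (rule DERIV_chain'[OF DERIV_minus[OF DERIV_ident] G])
    then have "((\<lambda>z. (G z - G (- z)) / 2) has_field_derivative (exp (z\<^sup>2) - exp ((- z)\<^sup>2) * (- 1)) / 2) (at z)"
      by (intro DERIV_cdivide DERIV_diff G)
    then show ?thesis by (simp add: F_def)
  qed
  moreover have "F (- z) = - F z" for z by (simp add: F_def field_simps)
  ultimately show ?thesis by (rule that)
qed

text \<open>F tends to i sqrt pi / 2 along every vertical ray going up. On the ray from z the real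
  part of the squared argument is at most Re (z^2) - v^2, because Im z >= 0, so a half-line Gaussian
  integral bounds the distance of F z from this limit.\<close>

lemma gaussian_primitive_bound:
  assumes F: "\<And>z. (F has_field_derivative exp (z\<^sup>2)) (at z)" "\<And>z. F (- z) = - F z"
    and z: "Im z \<ge> 0"
  shows "norm (F z - \<i> * of_real (sqrt pi / 2)) \<le> sqrt pi / 2 * exp (Re (z\<^sup>2))"
proof -
  have vert: "((\<lambda>v. \<i> * exp ((w + \<i> * of_real v)\<^sup>2)) has_integral (F (w + \<i> * of_real Y) - F w)) {0..Y}"
    if "Y \<ge> 0" for w and Y :: real
  proof -
    have "((\<lambda>v. \<i> * exp ((w + \<i> * of_real v)\<^sup>2)) has_integral (F (w + \<i> * of_real Y) - F (w + \<i> * of_real 0))) {0..Y}"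
    proof (rule fundamental_theorem_of_calculus[OF that])
      fix v :: real
      have "((\<lambda>x. F (w + \<i> * x)) has_field_derivative (exp ((w + \<i> * of_real v)\<^sup>2) * \<i>)) (at (of_real v))"
        by (rule DERIV_chain'[OF _ F(1)]) (auto intro!: derivative_eq_intros)
      then show "((\<lambda>v. F (w + \<i> * of_real v)) has_vector_derivative \<i> * exp ((w + \<i> * of_real v)\<^sup>2)) (at v within {0..Y})"
        by (intro has_vector_derivative_real_field) (simp add: mult.commute has_field_derivative_at_within)
    qed
    then show ?thesis by simp
  qed
  have F0: "F 0 = 0" using F(2)[of 0] by simp
  have axis: "F (\<i> * of_real Y) = \<i> * of_real (integral {0..Y} (\<lambda>v. exp (- v\<^sup>2)))" if "Y \<ge> 0" for Y
  proof -
    have "((\<lambda>v::real. exp (- v\<^sup>2)) has_integral integral {0..Y} (\<lambda>v. exp (- v\<^sup>2))) {0..Y}"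
      by (intro integrable_integral integrable_continuous_real continuous_intros)
    from has_integral_mult_right[OF has_integral_of_real[OF this], of \<i>]
    have "((\<lambda>v. \<i> * of_real (exp (- v\<^sup>2))) has_integral \<i> * of_real (integral {0..Y} (\<lambda>v. exp (- v\<^sup>2)))) {0..Y}" .
    moreover have "\<i> * exp ((0 + \<i> * of_real v)\<^sup>2) = \<i> * of_real (exp (- v\<^sup>2))" for v
    proof -
      have "(0 + \<i> * of_real v)\<^sup>2 = complex_of_real (- v\<^sup>2)" by (simp add: power_mult_distrib)
      then show ?thesis by (simp only: exp_of_real)
    qed
    then have "((\<lambda>v. \<i> * of_real (exp (- v\<^sup>2))) has_integral (F (0 + \<i> * of_real Y) - F 0)) {0..Y}"
      using vert[OF that, of 0] by simp
    ultimately have "F (0 + \<i> * of_real Y) - F 0 = \<i> * of_real (integral {0..Y} (\<lambda>v. exp (- v\<^sup>2)))"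
      by (rule has_integral_unique[rotated])
    then show ?thesis by (simp add: F0)
  qed
  have bound: "norm (F (z + \<i> * of_real Y) - F z) \<le> sqrt pi / 2 * exp (Re (z\<^sup>2))" if "Y \<ge> 0" for Y
  proof -
    have "norm (integral {0..Y} (\<lambda>v. \<i> * exp ((z + \<i> * of_real v)\<^sup>2))) \<le> integral {0..Y} (\<lambda>v. exp (Re (z\<^sup>2)) * exp (- v\<^sup>2))"
    proof (rule integral_norm_bound_integral)
      show "(\<lambda>v. \<i> * exp ((z + \<i> * of_real v)\<^sup>2)) integrable_on {0..Y}"
        using vert[OF that] by (rule has_integral_integrable)
      show "(\<lambda>v. exp (Re (z\<^sup>2)) * exp (- v\<^sup>2)) integrable_on {0..Y}"
        by (intro integrable_continuous_real continuous_intros)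
      fix v assume v: "v \<in> {0..Y}"
      have "Re ((z + \<i> * of_real v)\<^sup>2) = Re (z\<^sup>2) - v\<^sup>2 - 2 * (v * Im z)"
        by (simp add: power2_eq_square algebra_simps)
      also have "\<dots> \<le> Re (z\<^sup>2) + - v\<^sup>2" using v z by simp
      finally show "norm (\<i> * exp ((z + \<i> * of_real v)\<^sup>2)) \<le> exp (Re (z\<^sup>2)) * exp (- v\<^sup>2)"
        unfolding norm_mult norm_exp_eq_Re mult_exp_exp by simp
    qed
    also have "\<dots> = exp (Re (z\<^sup>2)) * integral {0..Y} (\<lambda>v. exp (- v\<^sup>2))" by simp
    also have "\<dots> \<le> exp (Re (z\<^sup>2)) * (sqrt pi / 2)" by (intro mult_left_mono integral_gaussian_le that) simp
    finally show ?thesis using integral_unique[OF vert[OF that, of z]] by (simp add: mult.commute)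
  qed
  \<comment> \<open>The limit is known on the imaginary axis only. At height Im z + Y the horizontal
    segment joining z + i Y to the axis contributes a factor exp (- Y^2), so the limit is the same
    on the ray.\<close>
  have horiz: "norm (F (z + \<i> * of_real Y) - F (\<i> * of_real (Im z + Y))) \<le> exp ((Re z)\<^sup>2 - Y\<^sup>2) * \<bar>Re z\<bar>" if "Y \<ge> 0" for Y
  proof -
    let ?S = "closed_segment (\<i> * of_real (Im z + Y)) (z + \<i> * of_real Y)"
    have "norm (F (z + \<i> * of_real Y) - F (\<i> * of_real (Im z + Y))) \<le>
      exp ((Re z)\<^sup>2 - Y\<^sup>2) * norm (z + \<i> * of_real Y - \<i> * of_real (Im z + Y))"
    proof (rule field_differentiable_bound[of ?S F "\<lambda>z. exp (z\<^sup>2)"])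
      fix w assume "w \<in> ?S"
      then obtain u where u: "0 \<le> u" "u \<le> 1" "w = (1 - u) *\<^sub>R (\<i> * of_real (Im z + Y)) + u *\<^sub>R (z + \<i> * of_real Y)"
        by (auto simp: in_segment)
      have "Re w = u * Re z" "Im w = Im z + Y" by (auto simp: u(3) algebra_simps)
      then have "Re (w\<^sup>2) = (u * Re z)\<^sup>2 - (Im z + Y)\<^sup>2" by (simp add: Re_power2)
      also have "\<dots> \<le> (Re z)\<^sup>2 - Y\<^sup>2"
      proof (rule diff_mono)
        have "u\<^sup>2 * (Re z)\<^sup>2 \<le> 1 * (Re z)\<^sup>2" using u by (intro mult_right_mono power_le_one) auto
        then show "(u * Re z)\<^sup>2 \<le> (Re z)\<^sup>2" by (simp add: power_mult_distrib)
        show "Y\<^sup>2 \<le> (Im z + Y)\<^sup>2" using z that by (intro power_mono) auto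
      qed
      finally show "norm (exp (w\<^sup>2)) \<le> exp ((Re z)\<^sup>2 - Y\<^sup>2)" by (simp add: norm_exp_eq_Re)
    qed (auto intro: has_field_derivative_at_within F(1))
    moreover have "z + \<i> * of_real Y - \<i> * of_real (Im z + Y) = of_real (Re z)" by (simp add: complex_eq_iff)
    ultimately show ?thesis by simp
  qed
  have "(\<lambda>n. F (z + \<i> * of_real (real n))) \<longlonglongrightarrow> \<i> * of_real (sqrt pi / 2)"
  proof -
    have at: "filterlim (\<lambda>n. Im z + real n) at_top sequentially" by real_asymp
    have "(\<lambda>n. \<i> * complex_of_real (integral {0..Im z + real n} (\<lambda>v. exp (- v\<^sup>2)))) \<longlonglongrightarrow> \<i> * of_real (sqrt pi / 2)"
      by (intro tendsto_intros filterlim_compose[OF integral_gaussian_half_line at])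
    then have 1: "(\<lambda>n. F (\<i> * of_real (Im z + real n))) \<longlonglongrightarrow> \<i> * of_real (sqrt pi / 2)"
    proof -
      have ax: "F (\<i> * of_real (Im z + real n)) = \<i> * complex_of_real (integral {0..Im z + real n} (\<lambda>v. exp (- v\<^sup>2)))" for n
        by (rule axis) (use z in simp)
      show ?thesis unfolding ax by fact
    qed
    have "(\<lambda>n. F (z + \<i> * of_real (real n)) - F (\<i> * of_real (Im z + real n))) \<longlonglongrightarrow> 0"
    proof (rule Lim_null_comparison)
      show "\<forall>\<^sub>F n in sequentially. norm (F (z + \<i> * of_real (real n)) - F (\<i> * of_real (Im z + real n))) \<le>
          exp ((Re z)\<^sup>2 - (real n)\<^sup>2) * \<bar>Re z\<bar>"
        by (intro always_eventually allI horiz) simp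
      have "(\<lambda>n. exp ((Re z)\<^sup>2 - (real n)\<^sup>2)) \<longlonglongrightarrow> 0" by real_asymp
      then show "(\<lambda>n. exp ((Re z)\<^sup>2 - (real n)\<^sup>2) * \<bar>Re z\<bar>) \<longlonglongrightarrow> 0" by (rule tendsto_mult_left_zero)
    qed
    from tendsto_add[OF this 1] show ?thesis by simp
  qed
  then have "(\<lambda>n. norm (F (z + \<i> * of_real (real n)) - F z)) \<longlonglongrightarrow> norm (\<i> * of_real (sqrt pi / 2) - F z)"
    by (intro tendsto_intros)
  then have "norm (\<i> * of_real (sqrt pi / 2) - F z) \<le> sqrt pi / 2 * exp (Re (z\<^sup>2))"
    by (rule Lim_bounded[where M = 0]) (intro allI impI bound, simp)
  then show ?thesis by (simp add: norm_minus_commute)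
qed

text \<open>The integrand is the derivative of an explicit combination of a Gaussian primitive, because the
  exponent is a perfect square up to an additive constant in the variable sqrt t, in two ways.\<close>

lemma main_arc_integral:
  fixes a b y v1 :: real
  assumes pos: "a > 0" "b > 0" "y > 0" "v1 > 0" and ab: "1 \<le> 2 * a * b"
  defines "E \<equiv> a\<^sup>2 * y + b\<^sup>2 * y / (y\<^sup>2 + v1\<^sup>2)"
  obtains I where "((\<lambda>v. csqrt (Complex y v) * exp (of_real (a\<^sup>2) * Complex y v + of_real (b\<^sup>2) / Complex y v)) has_integral I) {-v1..v1}"
    and "norm (I - of_real (sqrt pi / a\<^sup>2 * (b - 1 / (2 * a)) * exp (2 * a * b))) \<le>
      1 / a\<^sup>2 * (2 * sqrt (norm (Complex y v1)) * exp E + 2 * sqrt pi * b * exp E + sqrt pi * (b + 1 / (2 * a)))"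
proof -
  obtain F :: "complex \<Rightarrow> complex" where F: "\<And>z. (F has_field_derivative exp (z\<^sup>2)) (at z)" "\<And>z. F (- z) = - F z"
    using gaussian_primitive by blast
  define K where "K = sqrt pi / 2"
  define A where "A = complex_of_real a"
  define B where "B = complex_of_real b"
  have A0: "A \<noteq> 0" "B \<noteq> 0" using pos by (auto simp: A_def B_def)
  \<comment> \<open>With w = sqrt t the exponent is (A w - B/w)^2 + 2 A B and also (A w + B/w)^2 - 2
    A B, and sqrt t dt = 2 w^2 dw. Differentiating w exp (...) gives the wanted term 2 A^2 w^2
    together with 1 - 2 B^2/w^2; the coefficients B - 1/(2A) and B + 1/(2A) are the ones that cancel
    the latter.\<close>
  define G where "G = (\<lambda>w. 1 / A\<^sup>2 * (w * exp (A\<^sup>2 * w\<^sup>2 + B\<^sup>2 / w\<^sup>2)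
     + (B - 1 / (2 * A)) * exp (2 * A * B) * F (A * w - B / w)
     - (B + 1 / (2 * A)) * exp (- (2 * A * B)) * F (A * w + B / w)))"
  have dG: "(G has_field_derivative 2 * w\<^sup>2 * exp (A\<^sup>2 * w\<^sup>2 + B\<^sup>2 / w\<^sup>2)) (at w)" if w: "w \<noteq> 0" for w
  proof -
    let ?e = "exp (A\<^sup>2 * w\<^sup>2 + B\<^sup>2 / w\<^sup>2)"
    have e1: "exp (2 * A * B) * exp ((A * w - B / w)\<^sup>2) = ?e"
      unfolding mult_exp_exp using w by (intro arg_cong[of _ _ exp]) (simp add: field_simps power2_eq_square)
    have e2: "exp (- (2 * A * B)) * exp ((A * w + B / w)\<^sup>2) = ?e"
      unfolding mult_exp_exp using w by (intro arg_cong[of _ _ exp]) (simp add: field_simps power2_eq_square)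
    have d1: "((\<lambda>w. F (A * w - B / w)) has_field_derivative exp ((A * w - B / w)\<^sup>2) * (A + B / w\<^sup>2)) (at w)"
      using w by (intro DERIV_chain'[OF _ F(1)]) (auto intro!: derivative_eq_intros simp: power2_eq_square)
    have d2: "((\<lambda>w. F (A * w + B / w)) has_field_derivative exp ((A * w + B / w)\<^sup>2) * (A - B / w\<^sup>2)) (at w)"
      using w by (intro DERIV_chain'[OF _ F(1)]) (auto intro!: derivative_eq_intros simp: power2_eq_square)
    have d3: "((\<lambda>w. w * exp (A\<^sup>2 * w\<^sup>2 + B\<^sup>2 / w\<^sup>2)) has_field_derivative
        ?e + w * (?e * (A\<^sup>2 * (2 * w) - B\<^sup>2 * (2 * w) / w ^ 4))) (at w)"
      using w by (auto intro!: derivative_eq_intros simp: power2_eq_square power4_eq_xxxx field_simps)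
    have "(G has_field_derivative 1 / A\<^sup>2 * (?e + w * (?e * (A\<^sup>2 * (2 * w) - B\<^sup>2 * (2 * w) / w ^ 4))
      + (B - 1 / (2 * A)) * exp (2 * A * B) * (exp ((A * w - B / w)\<^sup>2) * (A + B / w\<^sup>2))
      - (B + 1 / (2 * A)) * exp (- (2 * A * B)) * (exp ((A * w + B / w)\<^sup>2) * (A - B / w\<^sup>2)))) (at w)"
      unfolding G_def by (intro DERIV_cmult DERIV_add DERIV_diff d1 d2 d3)
    also have "(B - 1 / (2 * A)) * exp (2 * A * B) * (exp ((A * w - B / w)\<^sup>2) * (A + B / w\<^sup>2)) =
       (B - 1 / (2 * A)) * (A + B / w\<^sup>2) * ?e" unfolding e1[symmetric] by simp
    also have "(B + 1 / (2 * A)) * exp (- (2 * A * B)) * (exp ((A * w + B / w)\<^sup>2) * (A - B / w\<^sup>2)) =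
       (B + 1 / (2 * A)) * (A - B / w\<^sup>2) * ?e" unfolding e2[symmetric] by simp
    also have "1 / A\<^sup>2 * (?e + w * (?e * (A\<^sup>2 * (2 * w) - B\<^sup>2 * (2 * w) / w ^ 4))
      + (B - 1 / (2 * A)) * (A + B / w\<^sup>2) * ?e - (B + 1 / (2 * A)) * (A - B / w\<^sup>2) * ?e) = 2 * w\<^sup>2 * ?e"
    proof -
      have "1 / A\<^sup>2 * (e + w * (e * (A\<^sup>2 * (2 * w) - B\<^sup>2 * (2 * w) / w ^ 4))
      + (B - 1 / (2 * A)) * (A + B / w\<^sup>2) * e - (B + 1 / (2 * A)) * (A - B / w\<^sup>2) * e) = 2 * w\<^sup>2 * e" for e
        using w A0 by (simp add: field_simps power2_eq_square power4_eq_xxxx)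
      then show ?thesis .
    qed
    finally show ?thesis .
  qed
  let ?t = "\<lambda>v. Complex y v"
  define g where "g = (\<lambda>v. csqrt (?t v) * exp (of_real (a\<^sup>2) * ?t v + of_real (b\<^sup>2) / ?t v))"
  have Ret: "Re (?t v) > 0" for v using pos by simp
  have cs: "csqrt (?t v) \<noteq> 0" for v
  proof -
    have "?t v \<noteq> 0" using Ret[of v] by (metis less_irrefl zero_complex.sel(1))
    then show ?thesis unfolding csqrt_eq_0 .
  qed
  have FTC: "((\<lambda>v. \<i> * g v) has_integral (G (csqrt (?t v1)) - G (csqrt (?t (- v1))))) {-v1..v1}"
  proof (rule fundamental_theorem_of_calculus)
    fix v :: real
    let ?c = "\<lambda>x. csqrt (of_real y + \<i> * x)"
    have tv: "of_real y + \<i> * of_real v = ?t v" for v by (simp add: Complex_eq)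
    have "((\<lambda>x. G (?c x)) has_field_derivative
        (2 * (csqrt (?t v))\<^sup>2 * exp (A\<^sup>2 * (csqrt (?t v))\<^sup>2 + B\<^sup>2 / (csqrt (?t v))\<^sup>2)) * (\<i> / (2 * csqrt (?t v)))) (at (of_real v))"
    proof (rule DERIV_chain'[where f = ?c])
      show "(?c has_field_derivative \<i> / (2 * csqrt (?t v))) (at (of_real v))"
        using halfplane_not_nonpos[OF Ret[of v]] unfolding tv[symmetric]
        by (auto intro!: derivative_eq_intros)
      show "(G has_field_derivative 2 * (csqrt (?t v))\<^sup>2 * exp (A\<^sup>2 * (csqrt (?t v))\<^sup>2 + B\<^sup>2 / (csqrt (?t v))\<^sup>2)) (at (?c (of_real v)))"
        unfolding tv by (rule dG[OF cs])
    qed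
    also have "2 * (csqrt (?t v))\<^sup>2 * exp (A\<^sup>2 * (csqrt (?t v))\<^sup>2 + B\<^sup>2 / (csqrt (?t v))\<^sup>2) * (\<i> / (2 * csqrt (?t v))) = \<i> * g v"
    proof -
      have gen: "2 * c\<^sup>2 * e * (\<i> / (2 * c)) = \<i> * (c * e)" if "c \<noteq> 0" for c e :: complex
        using that by (simp add: power2_eq_square)
      show ?thesis unfolding gen[OF cs] unfolding g_def power2_csqrt A_def B_def of_real_power ..
    qed
    finally have D: "((\<lambda>x. G (?c x)) has_field_derivative \<i> * g v) (at (of_real v))" .
    show "((\<lambda>v. G (csqrt (?t v))) has_vector_derivative \<i> * g v) (at v within {-v1..v1})"
      using has_vector_derivative_real_field[OF D] unfolding tv .
  qed (use pos in simp)
  define I where "I = - \<i> * (G (csqrt (?t v1)) - G (csqrt (?t (- v1))))"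
  have "((\<lambda>v. - \<i> * (\<i> * g v)) has_integral I) {-v1..v1}"
    unfolding I_def by (intro has_integral_mult_right FTC)
  then have int: "(g has_integral I) {-v1..v1}" by simp
  define w1 where "w1 = csqrt (?t v1)"
  define w2 where "w2 = csqrt (?t (- v1))"
  have w2: "w2 = cnj w1"
  proof -
    have "cnj (?t v1) = ?t (- v1)" by (simp add: complex_eq_iff)
    then show ?thesis unfolding w1_def w2_def cnj_csqrt[OF halfplane_not_nonpos[OF Ret[of v1]]] by (simp only:)
  qed
  have w1sq: "w1\<^sup>2 = ?t v1" by (simp add: w1_def)
  have w1nz: "w1 \<noteq> 0" using cs by (simp add: w1_def)
  have Rew1: "Re w1 > 0" unfolding w1_def by (rule Re_csqrt_pos[OF Ret])
  have Imw1: "Im w1 > 0"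
  proof -
    have "2 * Re w1 * Im w1 = v1" using arg_cong[OF w1sq, of Im] by (simp add: Im_power2)
    then show ?thesis using Rew1 pos by (metis mult_pos_pos mult_less_0_iff zero_less_mult_iff zero_less_numeral less_asym)
  qed
  have nw1: "norm w1 = sqrt (norm (?t v1))" unfolding w1_def by simp
  define zm where "zm = A * w1 - B / w1"
  define zp where "zp = A * w1 + B / w1"
  have zm2: "A * w2 - B / w2 = cnj zm" "A * w2 + B / w2 = cnj zp" by (auto simp: zm_def zp_def w2 A_def B_def)
  have Imzm: "Im zm \<ge> 0"
  proof -
    have "Im (B / w1) \<le> 0" using Imw1 pos by (simp add: B_def Im_divide divide_nonpos_nonneg sum_power2_ge_zero)
    moreover have "Im zm = a * Im w1 - Im (B / w1)" by (simp add: zm_def A_def)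
    moreover have "0 \<le> a * Im w1" using Imw1 pos by simp
    ultimately show ?thesis by linarith
  qed
  have ReE: "Re (A\<^sup>2 * w1\<^sup>2 + B\<^sup>2 / w1\<^sup>2) = E"
    unfolding w1sq A_def B_def E_def by (simp flip: of_real_power add: Re_divide)
  have Rezm: "Re (zm\<^sup>2) = E - 2 * a * b"
  proof -
    have "zm\<^sup>2 = A\<^sup>2 * w1\<^sup>2 + B\<^sup>2 / w1\<^sup>2 - 2 * A * B"
      unfolding zm_def using w1nz by (simp add: field_simps power2_eq_square)
    then show ?thesis using ReE by (simp add: A_def B_def)
  qed
  have Rezp: "Re (zp\<^sup>2) = E + 2 * a * b"
  proof -
    have "zp\<^sup>2 = A\<^sup>2 * w1\<^sup>2 + B\<^sup>2 / w1\<^sup>2 + 2 * A * B"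
      unfolding zp_def using w1nz by (simp add: field_simps power2_eq_square)
    then show ?thesis using ReE by (simp add: A_def B_def)
  qed
  note bd = gaussian_primitive_bound[OF F, folded K_def]
  have bm: "norm (F zm - \<i> * of_real K) \<le> K * exp (E - 2 * a * b)"
    using bd[OF Imzm] unfolding Rezm .
  \<comment> \<open>The endpoints of the arc are conjugate. The point - \<open>cnj zm\<close> lies
    in the upper half-plane and its square has the same real part as that of \<open>zm\<close>, so
    by oddness F (\<open>cnj zm\<close>) is close to - i K. The difference of the two F-values,
    about 2 i K, produces the main term.\<close>
  have bm2: "norm (F (cnj zm) + \<i> * of_real K) \<le> K * exp (E - 2 * a * b)"
  proof -
    have "Re ((- cnj zm)\<^sup>2) = Re (zm\<^sup>2)" by (simp add: Re_power2)
    then have "norm (F (- cnj zm) - \<i> * of_real K) \<le> K * exp (E - 2 * a * b)"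
      using bd[of "- cnj zm"] Imzm unfolding Rezm by simp
    moreover have "F (- cnj zm) - \<i> * of_real K = - (F (cnj zm) + \<i> * of_real K)" by (simp add: F(2))
    ultimately show ?thesis by (simp only: norm_minus_cancel)
  qed
  \<comment> \<open>Here a crude bound is enough: the factor exp (2 a b) is offset by the
    coefficient \<open>c2\<close>, which carries exp (- 2 a b).\<close>
  have bp: "norm (F z) \<le> K + K * exp (E + 2 * a * b)" if "z = zp \<or> z = cnj zp" for z
  proof -
    have R: "Re (z\<^sup>2) = E + 2 * a * b" "Re ((- z)\<^sup>2) = E + 2 * a * b"
      using that Rezp by (auto simp: Re_power2)
    have nK: "norm (\<i> * complex_of_real K) = K" by (simp add: norm_mult K_def)
    show ?thesis
    proof (cases "Im z \<ge> 0")
      case True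
      then show ?thesis
        using bd[of z] norm_triangle_ineq2[of "F z" "\<i> * of_real K"] nK unfolding R by linarith
    next
      case False
      then show ?thesis
        using bd[of "- z"] norm_triangle_ineq2[of "F (- z)" "\<i> * of_real K"] nK F(2)[of z] unfolding R by simp
    qed
  qed
  define c1 where "c1 = (b - 1 / (2 * a)) * exp (2 * a * b)"
  define c2 where "c2 = (b + 1 / (2 * a)) * exp (- (2 * a * b))"
  have c12: "0 \<le> c1" "0 \<le> c2" "b - 1 / (2 * a) \<ge> 0"
    using pos ab by (auto simp: c1_def c2_def field_simps)
  have C1: "(B - 1 / (2 * A)) * exp (2 * A * B) = of_real c1" "(B + 1 / (2 * A)) * exp (- (2 * A * B)) = of_real c2"
    by (auto simp: c1_def c2_def A_def B_def simp flip: exp_of_real)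
  define e1 where "e1 = exp (A\<^sup>2 * w1\<^sup>2 + B\<^sup>2 / w1\<^sup>2)"
  define e2 where "e2 = exp (A\<^sup>2 * w2\<^sup>2 + B\<^sup>2 / w2\<^sup>2)"
  have ne: "norm e1 = exp E" "norm e2 = exp E"
  proof -
    show "norm e1 = exp E" unfolding e1_def norm_exp_eq_Re ReE ..
    have "A\<^sup>2 * w2\<^sup>2 + B\<^sup>2 / w2\<^sup>2 = cnj (A\<^sup>2 * w1\<^sup>2 + B\<^sup>2 / w1\<^sup>2)" by (simp add: w2 A_def B_def)
    then have "Re (A\<^sup>2 * w2\<^sup>2 + B\<^sup>2 / w2\<^sup>2) = E" by (simp only: ReE cnj.sel)
    then show "norm e2 = exp E" unfolding e2_def norm_exp_eq_Re by (simp only:)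
  qed
  have "I - of_real (sqrt pi / a\<^sup>2 * (b - 1 / (2 * a)) * exp (2 * a * b)) =
     - \<i> / A\<^sup>2 * (w1 * e1 - w2 * e2 + of_real c1 * (F zm - \<i> * of_real K) - of_real c1 * (F (cnj zm) + \<i> * of_real K)
       - of_real c2 * F zp + of_real c2 * F (cnj zp))"
  proof -
    have "of_real (sqrt pi / a\<^sup>2 * (b - 1 / (2 * a)) * exp (2 * a * b)) = of_real c1 * (2 * of_real K) / A\<^sup>2"
      by (simp add: c1_def K_def A_def)
    moreover have "I = - \<i> / A\<^sup>2 * (w1 * e1 + of_real c1 * F zm - of_real c2 * F zp - (w2 * e2 + of_real c1 * F (cnj zm) - of_real c2 * F (cnj zp)))"
      unfolding I_def G_def w1_def[symmetric] w2_def[symmetric] zm2 C1 zm_def[symmetric] zp_def[symmetric] e1_def[symmetric] e2_def[symmetric]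
      by (simp add: algebra_simps diff_divide_distrib add_divide_distrib)
    moreover have "- \<i> / A\<^sup>2 * (w1 * e1 + c * F zm - d * F zp - (w2 * e2 + c * F (cnj zm) - d * F (cnj zp))) - c * (2 * k) / A\<^sup>2 =
      - \<i> / A\<^sup>2 * (w1 * e1 - w2 * e2 + c * (F zm - \<i> * k) - c * (F (cnj zm) + \<i> * k) - d * F zp + d * F (cnj zp))" for c d k
      using A0 by (simp add: divide_simps) (simp add: algebra_simps)
    ultimately show ?thesis by (simp only:)
  qed
  then have "norm (I - of_real (sqrt pi / a\<^sup>2 * (b - 1 / (2 * a)) * exp (2 * a * b))) =
     1 / a\<^sup>2 * norm (w1 * e1 - w2 * e2 + of_real c1 * (F zm - \<i> * of_real K) - of_real c1 * (F (cnj zm) + \<i> * of_real K)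
       - of_real c2 * F zp + of_real c2 * F (cnj zp))"
    by (simp only: norm_mult norm_divide norm_minus_cancel norm_ii) (simp add: A_def norm_power)
  also have "\<dots> \<le> 1 / a\<^sup>2 * (sqrt (norm (?t v1)) * exp E + sqrt (norm (?t v1)) * exp E + c1 * (K * exp (E - 2 * a * b))
     + c1 * (K * exp (E - 2 * a * b)) + c2 * (K + K * exp (E + 2 * a * b)) + c2 * (K + K * exp (E + 2 * a * b)))"
  proof (intro mult_left_mono norm_triangle_le norm_triangle_le_diff add_mono)
    show "norm (w1 * e1) \<le> sqrt (norm (?t v1)) * exp E" by (simp only: norm_mult ne nw1)
    show "norm (w2 * e2) \<le> sqrt (norm (?t v1)) * exp E" by (simp only: norm_mult ne nw1 w2 complex_mod_cnj)
  qed (use c12 bm bm2 bp in \<open>auto simp only: norm_mult norm_of_real abs_of_nonneg intro!: mult_left_mono zero_le_divide_1_iff[THEN iffD2] zero_le_power2\<close>)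
  also have "c1 * (K * exp (E - 2 * a * b)) = (b - 1 / (2 * a)) * K * exp E"
    unfolding c1_def by (simp add: exp_diff)
  also have "c2 * (K + K * exp (E + 2 * a * b)) = (b + 1 / (2 * a)) * K * exp (- (2 * a * b)) + (b + 1 / (2 * a)) * K * exp E"
    unfolding c2_def by (simp add: exp_add exp_minus field_simps)
  finally have "norm (I - of_real (sqrt pi / a\<^sup>2 * (b - 1 / (2 * a)) * exp (2 * a * b))) \<le>
    1 / a\<^sup>2 * (sqrt (norm (?t v1)) * exp E + sqrt (norm (?t v1)) * exp E + (b - 1 / (2 * a)) * K * exp E
     + (b - 1 / (2 * a)) * K * exp E + ((b + 1 / (2 * a)) * K * exp (- (2 * a * b)) + (b + 1 / (2 * a)) * K * exp E)
     + ((b + 1 / (2 * a)) * K * exp (- (2 * a * b)) + (b + 1 / (2 * a)) * K * exp E))" .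
  also have "\<dots> \<le> 1 / a\<^sup>2 * (2 * sqrt (norm (Complex y v1)) * exp E + 2 * sqrt pi * b * exp E + sqrt pi * (b + 1 / (2 * a)))"
  proof (rule mult_left_mono)
    have "(b + 1 / (2 * a)) * K * exp (- (2 * a * b)) \<le> (b + 1 / (2 * a)) * K * 1"
      using pos by (intro mult_left_mono) (auto simp: K_def)
    then have 1: "(b + 1 / (2 * a)) * K * exp (- (2 * a * b)) \<le> sqrt pi * (b + 1 / (2 * a)) / 2"
      by (simp add: K_def mult.commute)
    have 2: "(b - 1 / (2 * a)) * K * exp E + (b + 1 / (2 * a)) * K * exp E = sqrt pi * b * exp E"
      by (simp add: K_def algebra_simps)
    have arith: "S + S + G + G + (e + H) + (e + H) \<le> 2 * S + 2 * P + Q"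
      if "e \<le> Q / 2" "G + H = P" for S G H e P Q :: real using that by linarith
    show "sqrt (norm (?t v1)) * exp E + sqrt (norm (?t v1)) * exp E + (b - 1 / (2 * a)) * K * exp E
     + (b - 1 / (2 * a)) * K * exp E + ((b + 1 / (2 * a)) * K * exp (- (2 * a * b)) + (b + 1 / (2 * a)) * K * exp E)
     + ((b + 1 / (2 * a)) * K * exp (- (2 * a * b)) + (b + 1 / (2 * a)) * K * exp E) \<le>
     2 * sqrt (norm (Complex y v1)) * exp E + 2 * sqrt pi * b * exp E + sqrt pi * (b + 1 / (2 * a))"
      using arith[OF 1 2, of "sqrt (norm (?t v1)) * exp E"] by (simp only: mult.assoc)
  qed simp
  finally have "norm (I - of_real (sqrt pi / a\<^sup>2 * (b - 1 / (2 * a)) * exp (2 * a * b))) \<le>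
      1 / a\<^sup>2 * (2 * sqrt (norm (Complex y v1)) * exp E + 2 * sqrt pi * b * exp E + sqrt pi * (b + 1 / (2 * a)))" .
  then show ?thesis using that[OF int[unfolded g_def]] by blast
qed

section \<open>Bounds away from the main arc\<close>

text \<open>The profile of 1/theta4 in the modulus v = |c t + i d| decreases as long as v^2 <= pi y,
  so a lower bound for v bounds it from above. With r = v/v0, sqrt r is at most 1 + (r^2 - 1)/4,
  while the exponents differ by (r^2 - 1) pi y/(4 v^2), whose second factor is at least
  9/16.\<close>

lemma cusp_profile_mono:
  fixes y v0 v :: real
  assumes "0 < v0" "v0 \<le> v" "3 / 4 * v\<^sup>2 \<le> y"
  shows "sqrt v * exp (pi * y / (4 * v\<^sup>2)) \<le> sqrt v0 * exp (pi * y / (4 * v0\<^sup>2))"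
proof -
  define r where "r = v / v0"
  have v: "v = r * v0" and r1: "1 \<le> r" using assms by (auto simp: r_def)
  have y: "3 / 4 * r\<^sup>2 * v0\<^sup>2 \<le> y" using assms(3) unfolding v by (simp add: power_mult_distrib)
  have y0: "y > 0"
  proof -
    have "0 < 3 / 4 * r\<^sup>2 * v0\<^sup>2" using r1 assms(1) by simp
    then show ?thesis using y by linarith
  qed
  have "sqrt r \<le> (1 + r) / 2" using arith_geo_mean_sqrt[of 1 r] r1 by simp
  also have "\<dots> \<le> 1 + (r\<^sup>2 - 1) / 4"
  proof -
    have "0 \<le> r\<^sup>2 - 2 * r + 1" using zero_le_power2[of "r - 1"] by (simp add: power2_diff)
    then show ?thesis by (simp add: field_simps)
  qed
  also have "\<dots> \<le> 1 + (pi * y / (4 * v0\<^sup>2) - pi * y / (4 * v\<^sup>2))"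
  proof -
    have "(1 :: real) / 4 \<le> 3 * (3 / 4) / 4" by simp
    also have "\<dots> \<le> pi * (y / (v\<^sup>2)) / 4"
    proof -
      have "3 / 4 \<le> y / v\<^sup>2" using assms by (simp add: field_simps)
      then have "3 * (3 / 4) \<le> pi * (y / v\<^sup>2)" using pi_gt3 by (intro mult_mono) auto
      then show ?thesis by (rule divide_right_mono) simp
    qed
    finally have "(r\<^sup>2 - 1) * (1 / 4) \<le> (r\<^sup>2 - 1) * (pi * (y / (v\<^sup>2)) / 4)"
      using r1 by (intro mult_left_mono) (auto simp: one_le_power)
    also have "\<dots> = pi * y / (4 * v0\<^sup>2) - pi * y / (4 * v\<^sup>2)"
      unfolding v using r1 assms(1) by (simp add: field_simps)
    finally show ?thesis by simp
  qed
  also have "\<dots> \<le> exp (pi * y / (4 * v0\<^sup>2) - pi * y / (4 * v\<^sup>2))" by (rule exp_ge_add_one_self)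
  finally have "sqrt r * exp (pi * y / (4 * v\<^sup>2)) \<le> exp (pi * y / (4 * v0\<^sup>2))"
    by (simp add: exp_diff field_simps)
  then have "sqrt v0 * (sqrt r * exp (pi * y / (4 * v\<^sup>2))) \<le> sqrt v0 * exp (pi * y / (4 * v0\<^sup>2))"
    using assms by (intro mult_left_mono) auto
  then show ?thesis by (simp add: v real_sqrt_mult mult_ac)
qed

text \<open>The bound for all cusps whose denominator is at least 5.\<close>

definition far_bound :: "real \<Rightarrow> real" where
  "far_bound y = 0.506 * (sqrt 5 * sqrt y * exp (pi / (100 * y)))"

text \<open>Near the cusps of denominator 3, at distance u: a Gaussian for u at most y, a constant beyond.\<close>

definition near_gauss :: "real \<Rightarrow> real \<Rightarrow> real" where
  "near_gauss y u = 0.506 * (sqrt 3 * sqrt y * exp (pi / (36 * y))) * exp (- ((pi / (72 * y) - 1 / 4) / y\<^sup>2 * u\<^sup>2))"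

definition near_tail :: "real \<Rightarrow> real" where
  "near_tail y = 0.506 * (sqrt (sqrt 18 * y) * exp (pi / (72 * y)))"

text \<open>For w = u^2/y^2 <= 1, the fourth root of 1 + w is at most exp (w/4) and 1/(1 + w) <= 1 -
  w/2; together they give the Gaussian coefficient pi/(72 y) - 1/4. For |u| > y one has v >= sqrt 18
  y, and the profile is monotone. The condition 3/4 v^2 <= y confines u to the window |u| <= sqrt (4
  y / 27), so the constant is charged only there.\<close>

lemma near_cusp_bound:
  assumes y: "y > 0" and N: "v\<^sup>2 = 9 * (y\<^sup>2 + u\<^sup>2)" "0 < v" "3 / 4 * v\<^sup>2 \<le> y"
  shows "0.506 * (sqrt v * exp (pi * y / (4 * v\<^sup>2))) \<le> near_gauss y u + (if \<bar>u\<bar> \<le> sqrt (4 * y / 27) then near_tail y else 0)"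
proof (cases "\<bar>u\<bar> \<le> y")
  case True
  define w where "w = u\<^sup>2 / y\<^sup>2"
  have w: "0 \<le> w" "w \<le> 1" using True y by (auto simp: w_def abs_le_square_iff[symmetric])
  have v2: "v\<^sup>2 = (3 * y)\<^sup>2 * (1 + w)" using y by (simp add: N w_def field_simps)
  have "v = 3 * y * sqrt (1 + w)"
  proof -
    have "v = sqrt (v\<^sup>2)" using N(2) real_sqrt_abs[of v] by simp
    also have "\<dots> = sqrt ((3 * y)\<^sup>2) * sqrt (1 + w)" unfolding v2 real_sqrt_mult ..
    also have "sqrt ((3 * y)\<^sup>2) = 3 * y" by (rule real_sqrt_unique) (use y in auto)
    finally show ?thesis .
  qed
  then have sv: "sqrt v = sqrt 3 * sqrt y * sqrt (sqrt (1 + w))" by (simp add: real_sqrt_mult)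
  have "sqrt (1 + w) \<le> exp (w / 2)"
  proof -
    have "sqrt (1 + w) \<le> sqrt (exp w)" using exp_ge_add_one_self[of w] by (intro real_sqrt_le_mono) simp
    also have "\<dots> = exp (w / 2)" using real_sqrt_unique[of "exp (w / 2)" "exp w"] by (simp add: power2_eq_square mult_exp_exp)
    finally show ?thesis .
  qed
  then have "sqrt (sqrt (1 + w)) \<le> sqrt (exp (w / 2))" by (rule real_sqrt_le_mono)
  also have "\<dots> = exp (w / 4)" using real_sqrt_unique[of "exp (w / 4)" "exp (w / 2)"] by (simp add: power2_eq_square mult_exp_exp)
  finally have s: "sqrt (sqrt (1 + w)) \<le> exp (w / 4)" .
  have "pi * y / (4 * v\<^sup>2) = pi / (36 * y) * (1 / (1 + w))"
  proof -
    have "pi * y / (4 * ((3 * y)\<^sup>2 * W)) = pi / (36 * y) * (1 / W)" if "W > 0" for W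
      using y that by (simp add: power2_eq_square)
    then show ?thesis unfolding v2 using w by simp
  qed
  also have "\<dots> \<le> pi / (36 * y) * (1 - w / 2)"
  proof (rule mult_left_mono)
    have "w * w \<le> w * 1" using w by (intro mult_left_mono) auto
    then show "1 / (1 + w) \<le> 1 - w / 2" using w by (simp add: field_simps)
  qed (use y in simp)
  finally have e: "exp (pi * y / (4 * v\<^sup>2)) \<le> exp (pi / (36 * y) * (1 - w / 2))" by simp
  have "sqrt v * exp (pi * y / (4 * v\<^sup>2)) \<le> (sqrt 3 * sqrt y * exp (w / 4)) * exp (pi / (36 * y) * (1 - w / 2))"
    unfolding sv using s e y w by (intro mult_mono mult_left_mono) auto
  also have "\<dots> = sqrt 3 * sqrt y * exp (w / 4 + pi / (36 * y) * (1 - w / 2))" by (simp add: exp_add)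
  also have "w / 4 + pi / (36 * y) * (1 - w / 2) = pi / (36 * y) + - ((pi / (72 * y) - 1 / 4) / y\<^sup>2 * u\<^sup>2)"
  proof -
    define P where "P = pi / (72 * y)"
    have P: "pi / (36 * y) = 2 * P" by (simp add: P_def)
    have "(P - 1 / 4) / y\<^sup>2 * u\<^sup>2 = (P - 1 / 4) * w" by (simp add: w_def)
    then show ?thesis unfolding P_def[symmetric] P by (simp add: algebra_simps)
  qed
  finally have "0.506 * (sqrt v * exp (pi * y / (4 * v\<^sup>2))) \<le> near_gauss y u"
    unfolding near_gauss_def exp_add by (simp add: mult.assoc)
  moreover have "0 \<le> near_tail y" using y by (simp add: near_tail_def)
  ultimately show ?thesis by auto
next
  case False
  have u2: "y\<^sup>2 \<le> u\<^sup>2" using False y by (simp flip: abs_le_square_iff)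
  have "(sqrt 18 * y)\<^sup>2 \<le> v\<^sup>2" using u2 by (simp add: N power_mult_distrib)
  then have "sqrt 18 * y \<le> v" using less_imp_le[OF N(2)] by (rule power2_le_imp_le)
  then have "sqrt v * exp (pi * y / (4 * v\<^sup>2)) \<le> sqrt (sqrt 18 * y) * exp (pi * y / (4 * (sqrt 18 * y)\<^sup>2))"
    using y N by (intro cusp_profile_mono) auto
  also have "pi * y / (4 * (sqrt 18 * y)\<^sup>2) = pi / (72 * y)"
    using y by (simp add: power_mult_distrib power2_eq_square)
  finally have "0.506 * (sqrt v * exp (pi * y / (4 * v\<^sup>2))) \<le> near_tail y"
    unfolding near_tail_def by simp
  moreover have "u\<^sup>2 \<le> 4 * y / 27"
  proof -
    have "3 / 4 * (9 * u\<^sup>2) \<le> 3 / 4 * v\<^sup>2" unfolding N by simp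
    then show ?thesis using N(3) by simp
  qed
  then have "\<bar>u\<bar> \<le> sqrt (4 * y / 27)" by (metis real_sqrt_abs real_sqrt_le_mono)
  moreover have "0 \<le> near_gauss y u" using y by (simp add: near_gauss_def)
  ultimately show ?thesis by simp
qed

text \<open>Serves to absorb every contribution of bounded type (reduction to theta3 or theta4, and
  the approximation error on the main arc) into \<open>far_bound\<close>. Fourth powers remove the
  nested roots, and a linear lower bound for exp then suffices.\<close>

lemma far_bound_ge:
  assumes y: "0 < y" "y \<le> 1 / 81"
  shows "2 * sqrt (sqrt (4 * y / 3)) \<le> far_bound y"
proof -
  define x where "x = pi / (25 * y)"
  \<comment> \<open>81 * 3.1415 / 25 is slightly above 10.17.\<close>
  have x: "x \<ge> 10.17"
  proof -
    have "10.17 * (25 * y) \<le> 10.17 * 25 * (1 / 81)" using y by simp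
    also have "\<dots> \<le> pi" using pi_approx(1) by simp
    finally show ?thesis unfolding x_def using y by (simp add: le_divide_eq)
  qed
  have e10: "exp (10::real) \<ge> 9000"
  proof -
    have "(9000::real) \<le> (1 + 10 / real 10 + (10 / real 10)\<^sup>2 / 2) ^ 10" by (simp add: power_divide)
    also have "\<dots> \<le> exp 10" by (rule exp_ge_quadratic_power) auto
    finally show ?thesis .
  qed
  have "9000 * (x - 9) \<le> exp 10 * exp (x - 10)"
    using e10 exp_ge_add_one_self[of "x - 10"] x by (intro mult_mono) auto
  then have ex: "9000 * (x - 9) \<le> exp x" by (simp add: mult_exp_exp)
  define S where "S = sqrt (sqrt (4 * y / 3))"
  have S4: "S ^ 4 = 4 * y / 3"
  proof -
    have "S ^ 4 = (S\<^sup>2)\<^sup>2" by simp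
    then show ?thesis using y by (simp add: S_def)
  qed
  have "(2 * S) ^ 4 \<le> far_bound y ^ 4"
  proof -
    have f4: "far_bound y ^ 4 = 0.506 ^ 4 * (25 * y\<^sup>2 * exp x)"
    proof -
      have "exp (pi / (100 * y)) ^ 4 = exp x" unfolding x_def exp_of_nat_mult[symmetric] using y by simp
      moreover have "sqrt z ^ 4 = z\<^sup>2" if "z \<ge> 0" for z
      proof -
        have "sqrt z ^ 4 = ((sqrt z)\<^sup>2)\<^sup>2" by (simp only: power_mult[symmetric]) simp
        then show ?thesis using that by simp
      qed
      ultimately show ?thesis unfolding far_bound_def power_mult_distrib using y by simp
    qed
    have xy: "x * y = pi / 25" using y by (simp add: x_def)
    have "(2 * S) ^ 4 = 64 / 3 * y" by (simp add: power_mult_distrib S4)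
    \<comment> \<open>1.638 is 25 * 0.506^4 rounded down, and 9000 (x - 9) is the linear minorant of
      exp x; both are put in here so that the next steps can reassemble
      \<open>far_bound y ^ 4\<close>.\<close>
    also have "\<dots> \<le> y * (1.638 * (pi / 25) * 9000 * (1 - 9 / x))"
    proof -
      have "9 / x \<le> 9 / 10.17" using x by (intro divide_left_mono) auto
      then have "64 / 3 \<le> 1.638 * (3 / 25) * 9000 * (1 - 9 / x)" by simp
      also have "\<dots> \<le> 1.638 * (pi / 25) * 9000 * (1 - 9 / x)"
      proof -
        have "0 \<le> 1 - 9 / x" using x by simp
        then show ?thesis using pi_gt3 by (intro mult_right_mono) auto
      qed
      finally show ?thesis using y by simp
    qed
    also have "\<dots> = 1.638 * y * (9000 * ((pi / 25) * (1 - 9 / x)))" by simp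
    also have "(pi / 25) * (1 - 9 / x) = y * (x - 9)" unfolding xy[symmetric] using x by (simp add: field_simps)
    also have "1.638 * y * (9000 * (y * (x - 9))) = 1.638 * y\<^sup>2 * (9000 * (x - 9))" by (simp add: power2_eq_square)
    also have "\<dots> \<le> 1.638 * y\<^sup>2 * exp x" using ex by (intro mult_left_mono) auto
    also have "\<dots> \<le> far_bound y ^ 4" unfolding f4 by (simp add: power_divide)
    finally show ?thesis .
  qed
  then show ?thesis unfolding S_def[symmetric]
    by (rule power_le_imp_le_base[where n = 3, simplified, OF _ ]) (use y in \<open>simp add: far_bound_def\<close>)
qed

text \<open>The main arc is exactly the set |t|^2 <= 4 y / 3, i.e. Re (1/t) >= 3/4, where one
  inversion reaches the good region and 1/theta2 can be approximated. Elsewhere t is reduced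
  completely and the pair (c, d) decides: theta3 or theta4 gives a bounded contribution, theta2
  gives the profile of a cusp of odd denominator |c|.\<close>

lemma inverse_theta4_bound:
  fixes y v :: real
  assumes y: "0 < y" "y \<le> 1 / 81" and v: "\<bar>v\<bar> \<le> 1"
  defines "t \<equiv> Complex y v" and "r \<equiv> sqrt (4 * y / 27)"
  shows "norm (1 / theta4 t - (if \<bar>v\<bar> \<le> sqrt (4 * y / 3 - y\<^sup>2) then csqrt t * exp (of_real pi / (4 * t)) / 2 else 0)) \<le>
    far_bound y + (near_gauss y (v - 2 / 3) + (if \<bar>v - 2 / 3\<bar> \<le> r then near_tail y else 0))
      + (near_gauss y (v + 2 / 3) + (if \<bar>v + 2 / 3\<bar> \<le> r then near_tail y else 0))" (is "?L \<le> ?R")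
proof -
  define q where "q = (\<lambda>u. near_gauss y u + (if \<bar>u\<bar> \<le> r then near_tail y else 0))"
  have nn: "0 \<le> q u" for u
    using y by (auto simp: q_def near_gauss_def near_tail_def)
  define Rq where "Rq = far_bound y + q (v - 2 / 3) + q (v + 2 / 3)"
  have Req: "?R = Rq" by (simp only: q_def Rq_def)
  have R1: "far_bound y \<le> Rq" unfolding Rq_def using nn[of "v - 2 / 3"] nn[of "v + 2 / 3"] by linarith
  have Ret: "Re t > 0" using y by (simp add: t_def)
  have fb: "c \<le> 2 * sqrt (sqrt (4 * y / 3)) \<Longrightarrow> c \<le> Rq" for c
    using far_bound_ge[OF y] R1 by linarith
  have nt: "(norm t)\<^sup>2 = y\<^sup>2 + v\<^sup>2" by (simp add: t_def cmod_power2)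
  have y43: "0 \<le> 4 * y / 3 - y\<^sup>2"
  proof -
    have "y * y \<le> y * (4 / 3)" using y by (intro mult_left_mono) auto
    then show ?thesis by (simp add: power2_eq_square)
  qed
  have v1: "\<bar>v\<bar> \<le> sqrt (4 * y / 3 - y\<^sup>2) \<longleftrightarrow> y\<^sup>2 + v\<^sup>2 \<le> 4 * y / 3"
  proof -
    have "\<bar>v\<bar> \<le> sqrt (4 * y / 3 - y\<^sup>2) \<longleftrightarrow> v\<^sup>2 \<le> 4 * y / 3 - y\<^sup>2"
      using y43 by (metis real_sqrt_abs real_sqrt_le_iff)
    then show ?thesis by linarith
  qed
  have "?L \<le> Rq"
  proof (cases "\<bar>v\<bar> \<le> sqrt (4 * y / 3 - y\<^sup>2)")
    case True
    have n2: "(norm t)\<^sup>2 \<le> 4 * y / 3" unfolding nt using True v1 by simp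
    have t0: "t \<noteq> 0" using Ret by auto
    have Re': "Re (1 / t) \<ge> 3 / 4"
      unfolding Re_one_over using n2 t0 by (simp add: le_divide_eq t_def)
    have th: "1 / theta4 t = csqrt t * (1 / theta2 (1 / t))"
      using theta4_inversion(1)[OF Ret] theta4_nonzero[OF Ret] t0
      by (metis csqrt_eq_0 div_by_1 divide_divide_eq_right mult.commute mult.right_neutral nonzero_divide_mult_cancel_right times_divide_eq_right)
    have "1 / theta4 t - csqrt t * exp (of_real pi / (4 * t)) / 2 =
      csqrt t * (1 / theta2 (1 / t) - exp (of_real pi * (1 / t) / 4) / 2)"
      unfolding th by (simp add: algebra_simps)
    then have "?L = norm (csqrt t) * norm (1 / theta2 (1 / t) - exp (of_real pi * (1 / t) / 4) / 2)"
      using True by (simp add: norm_mult)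
    also have "\<dots> \<le> norm (csqrt t) * (1 / 2)"
      by (intro mult_left_mono inverse_theta2_approx Re') auto
    also have "\<dots> \<le> 2 * sqrt (sqrt (4 * y / 3))"
    proof -
      have "norm t \<le> sqrt (4 * y / 3)" using n2 real_le_rsqrt by blast
      then have "sqrt (norm t) \<le> sqrt (sqrt (4 * y / 3))" by (rule real_sqrt_le_mono)
      moreover have "norm (csqrt t) = sqrt (norm t)" by simp
      moreover have "0 \<le> sqrt (norm t)" by simp
      ultimately show ?thesis by linarith
    qed
    finally show ?thesis by (rule fb)
  next
    case False
    then have L: "?L = norm (1 / theta4 t)" by simp
    obtain c d :: int and t' where red: "coprime c d" "Re t' \<ge> 3 / 4"
      "Re t' * (norm (of_int c * t + \<i> * of_int d))\<^sup>2 = Re t"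
      "norm (theta4 t) * sqrt (norm (of_int c * t + \<i> * of_int d)) \<in> reduced_theta_norms (odd c \<and> even d) t'"
      by (rule theta4_reduction[OF Ret])
    define \<nu> where "\<nu> = norm (of_int c * t + \<i> * of_int d)"
    have Rt: "Re t = y" by (simp add: t_def)
    have eq: "Re t' * \<nu>\<^sup>2 = y" using red(3) by (simp add: \<nu>_def Rt)
    have nu0: "\<nu> > 0"
    proof -
      have "\<nu> \<noteq> 0" using eq y by auto
      then show ?thesis by (simp add: \<nu>_def)
    qed
    have nu34: "3 / 4 * \<nu>\<^sup>2 \<le> y" unfolding eq[symmetric] using red(2) by (intro mult_right_mono) auto
    have ReY: "Re t' = y / \<nu>\<^sup>2" using eq nu0 by (simp add: field_simps)
    have th0: "norm (theta4 t) > 0" using theta4_nonzero[OF Ret] by simp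
    have nu2: "\<nu>\<^sup>2 = (of_int c * y)\<^sup>2 + (of_int c * v + of_int d)\<^sup>2"
      unfolding \<nu>_def cmod_power2 by (simp add: t_def)
    show ?thesis
    proof (cases "odd c \<and> even d")
      case False
      then have "norm (theta4 t) * sqrt \<nu> \<ge> 1 / 2"
        using red(4) norm_theta34_ge[OF red(2)] unfolding reduced_theta_norms_def \<nu>_def by auto
      then have "norm (1 / theta4 t) \<le> 2 * sqrt \<nu>"
        using th0 by (simp add: norm_divide field_simps)
      also have "sqrt \<nu> \<le> sqrt (sqrt (4 * y / 3))"
        using nu34 by (intro real_sqrt_le_mono real_le_rsqrt) simp
      finally show ?thesis unfolding L by (intro fb) simp
    next
      case True
      then have e: "norm (theta4 t) * sqrt \<nu> = norm (theta2 t')"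
        using red(4) unfolding reduced_theta_norms_def \<nu>_def by simp
      have "norm (1 / theta4 t) = sqrt \<nu> * norm (1 / theta2 t')"
        using th0 nu0 norm_inverse_theta2_le(1)[OF red(2)] unfolding norm_divide e[symmetric] by (simp add: field_simps)
      also have "\<dots> \<le> sqrt \<nu> * (0.506 * exp (pi * Re t' / 4))"
        by (intro mult_left_mono norm_inverse_theta2_le red(2)) (use nu0 in simp)
      finally have main: "norm (1 / theta4 t) \<le> 0.506 * (sqrt \<nu> * exp (pi * y / (4 * \<nu>\<^sup>2)))"
        unfolding ReY by (simp add: mult_ac)
      have "\<nu>\<^sup>2 \<le> 4 / 243" using nu34 y by simp
      then have "(of_int c * v + of_int d)\<^sup>2 \<le> 4 / 243"
        unfolding nu2 using zero_le_power2[of "of_int c * y"] by linarith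
      also have "(4 :: real) / 243 \<le> (1 / 7)\<^sup>2" by (simp add: power2_eq_square)
      finally have cd': "\<bar>of_int c * v + of_int d\<bar> \<le> 1 / 7"
        using abs_le_square_iff[of "of_int c * v + of_int d" "1 / 7"] by simp
      have dle: "\<bar>d\<bar> \<le> \<bar>c\<bar>"
      proof -
        have "\<bar>of_int c * v\<bar> \<le> \<bar>real_of_int c\<bar> * 1" unfolding abs_mult using v by (intro mult_left_mono) auto
        then have "\<bar>real_of_int d\<bar> < \<bar>real_of_int c\<bar> + 1" using cd' by linarith
        then show ?thesis by linarith
      qed
      \<comment> \<open>|c| = 1 forces d = 0, the cusp of the main arc, which is excluded here. For
        |c| = 3, d is even, at most 3 in modulus, and nonzero by coprimality, so d = 2 or d = -2 and
        the cusps are v = 2/3 and v = -2/3. For |c| >= 5, the modulus is at least 5 y.\<close>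
      have "\<bar>c\<bar> = 1 \<or> \<bar>c\<bar> = 3 \<or> \<bar>c\<bar> \<ge> 5" using True by presburger
      then consider "\<bar>c\<bar> = 1" | "\<bar>c\<bar> = 3" | "\<bar>c\<bar> \<ge> 5" by blast
      then show ?thesis
      proof cases
        case 1
        then have "d = 0" using dle True by presburger
        moreover have "(of_int c :: real)\<^sup>2 = 1" using 1 by (metis abs_1 of_int_abs of_int_1 power2_abs power_one)
        ultimately have "\<nu>\<^sup>2 = y\<^sup>2 + v\<^sup>2" unfolding nu2 by (simp add: power_mult_distrib)
        then show ?thesis using nu34 False v1 by simp
      next
        case 2
        have c2: "(of_int c :: real)\<^sup>2 = 9"
        proof -
          have "(of_int c :: real)\<^sup>2 = (of_int \<bar>c\<bar>)\<^sup>2" by simp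
          then show ?thesis unfolding 2 by simp
        qed
        have "d \<noteq> 0" using red(1) 2 by auto
        then have d: "\<bar>d\<bar> = 2" using dle True 2 by presburger
        have "(c = 3 \<or> c = -3) \<and> (d = 2 \<or> d = -2)" using 2 d by linarith
        then have "(of_int c * v + of_int d)\<^sup>2 = 9 * (v - 2/3)\<^sup>2 \<or> (of_int c * v + of_int d)\<^sup>2 = 9 * (v + 2/3)\<^sup>2"
          by (auto simp: power2_eq_square algebra_simps)
        then obtain u where u: "u = v - 2/3 \<or> u = v + 2/3" "(of_int c * v + of_int d)\<^sup>2 = 9 * u\<^sup>2" by blast
        have "\<nu>\<^sup>2 = 9 * (y\<^sup>2 + u\<^sup>2)" unfolding nu2 u(2) by (simp add: power_mult_distrib c2)
        from near_cusp_bound[OF y(1) this nu0 nu34]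
        have "0.506 * (sqrt \<nu> * exp (pi * y / (4 * \<nu>\<^sup>2))) \<le> q u" unfolding q_def r_def .
        then have "norm (1 / theta4 t) \<le> q u" by (rule order_trans[OF main])
        moreover have "0 \<le> far_bound y" using y by (simp add: far_bound_def)
        moreover have "q u \<le> q (v - 2 / 3) + q (v + 2 / 3)"
          using u(1) nn[of "v - 2 / 3"] nn[of "v + 2 / 3"] by (elim disjE) simp_all
        ultimately show ?thesis unfolding L Rq_def by linarith
      next
        case 3
        have "(5 * y)\<^sup>2 \<le> \<nu>\<^sup>2"
        proof -
          have "5\<^sup>2 \<le> \<bar>real_of_int c\<bar>\<^sup>2" using 3 by (intro power_mono) auto
          then have "25 * y\<^sup>2 \<le> (of_int c)\<^sup>2 * y\<^sup>2" by (intro mult_right_mono) auto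
          then show ?thesis unfolding nu2 power_mult_distrib by (simp add: add_increasing2)
        qed
        then have "5 * y \<le> \<nu>" by (rule power2_le_imp_le) (use nu0 in simp)
        have y5: "0 < 5 * y" using y by simp
        from cusp_profile_mono[OF y5 \<open>5 * y \<le> \<nu>\<close> nu34]
        have "sqrt \<nu> * exp (pi * y / (4 * \<nu>\<^sup>2)) \<le> sqrt (5 * y) * exp (pi * y / (4 * (5 * y)\<^sup>2))" .
        also have "pi * y / (4 * (5 * y)\<^sup>2) = pi / (100 * y)" using y by (simp add: power2_eq_square)
        finally have "norm (1 / theta4 t) \<le> far_bound y"
          using main unfolding far_bound_def real_sqrt_mult by (elim order_trans) simp
        then show ?thesis unfolding L using R1 by (rule order_trans)
      qed
    qed
  qed
  then show ?thesis unfolding Req .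
qed

section \<open>Integrating the bounds over the period\<close>

lemma gaussian_interval:
  fixes k e a b :: real
  assumes k: "k > 0"
  shows "(\<lambda>v. exp (- (k * (v - e)\<^sup>2))) integrable_on {a..b}"
    and "integral {a..b} (\<lambda>v. exp (- (k * (v - e)\<^sup>2))) \<le> sqrt (pi / k)"
proof -
  define f where "f = (\<lambda>v::real. exp (- (k * (v - e)\<^sup>2)))"
  have "has_bochner_integral lborel (\<lambda>x::real. exp (- x\<^sup>2)) (2 *\<^sub>R (sqrt pi / 2))"
    by (rule has_bochner_integral_even_function[OF gaussian_moment_0]) simp
  then have "has_bochner_integral lborel (\<lambda>x. exp (- (- (sqrt k * e) + sqrt k * x)\<^sup>2)) (2 *\<^sub>R (sqrt pi / 2) /\<^sub>R \<bar>sqrt k\<bar>)"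
    using k by (subst (asm) lborel_has_bochner_integral_real_affine_iff[of "sqrt k" _ _ "- (sqrt k * e)"]) auto
  moreover have "(\<lambda>x. exp (- (- (sqrt k * e) + sqrt k * x)\<^sup>2)) = f"
  proof
    fix x
    have "- (sqrt k * e) + sqrt k * x = sqrt k * (x - e)" by (simp add: algebra_simps)
    then show "exp (- (- (sqrt k * e) + sqrt k * x)\<^sup>2) = f x"
      unfolding f_def using k by (simp add: power_mult_distrib)
  qed
  moreover have "2 *\<^sub>R (sqrt pi / 2) /\<^sub>R \<bar>sqrt k\<bar> = sqrt (pi / k)"
    using k by (simp only: real_sqrt_divide real_scaleR_def) (simp add: field_simps)
  ultimately have f: "has_bochner_integral lborel f (sqrt (pi / k))" by simp
  have si: "set_integrable lborel {a..b} f"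
    unfolding f_def by (intro borel_integrable_atLeastAtMost') (intro continuous_intros)
  from set_borel_integral_eq_integral[OF si] show "(\<lambda>v. exp (- (k * (v - e)\<^sup>2))) integrable_on {a..b}"
    unfolding f_def by simp
  have "integral {a..b} f = (\<integral>x. indicator {a..b} x *\<^sub>R f x \<partial>lborel)"
    using set_borel_integral_eq_integral(2)[OF si] unfolding set_lebesgue_integral_def by simp
  also have "\<dots> \<le> integral\<^sup>L lborel f"
    using si f unfolding set_integrable_def has_bochner_integral_iff
    by (intro integral_mono) (auto simp: indicator_def f_def)
  also have "\<dots> = sqrt (pi / k)" using f by (simp add: has_bochner_integral_iff)
  finally show "integral {a..b} (\<lambda>v. exp (- (k * (v - e)\<^sup>2))) \<le> sqrt (pi / k)" unfolding f_def .
qed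

text \<open>\<open>near_gauss\<close> integrated over the whole line. The width is of order y^(3/2),
  so with the amplitude sqrt y the total is of order y^2 exp (pi/(36 y)); the factor y^2 is the 1/n
  of the error term.\<close>

definition gauss_total :: "real \<Rightarrow> real" where
  "gauss_total y = 0.506 * (sqrt 3 * sqrt y * exp (pi / (36 * y))) * sqrt (pi / ((pi / (72 * y) - 1 / 4) / y\<^sup>2))"

lemma near_cusp_integral:
  fixes y e :: real
  assumes y: "0 < y" "y \<le> 1 / 81" and e: "e = 2 / 3 \<or> e = - 2 / 3"
  defines "r \<equiv> sqrt (4 * y / 27)"
  obtains J where "((\<lambda>v. near_gauss y (v - e) + (if \<bar>v - e\<bar> \<le> r then near_tail y else 0)) has_integral J) {-1..1}"
    "J \<le> gauss_total y + 2 * r * near_tail y"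
proof -
  define k where "k = (pi / (72 * y) - 1 / 4) / y\<^sup>2"
  have "k > 0"
  proof -
    have "1 / 4 < pi / (72 * y)" using y pi_gt3 by (simp add: field_simps)
    then show ?thesis using y by (simp add: k_def)
  qed
  define C where "C = 0.506 * (sqrt 3 * sqrt y * exp (pi / (36 * y)))"
  have C0: "C \<ge> 0" using y by (simp add: C_def)
  have 1: "((\<lambda>v. near_gauss y (v - e)) has_integral C * integral {-1..1} (\<lambda>v. exp (- (k * (v - e)\<^sup>2)))) {-1..1}"
    unfolding near_gauss_def C_def k_def
    by (intro has_integral_mult_right integrable_integral gaussian_interval(1)) (use \<open>k > 0\<close> in \<open>simp add: k_def\<close>)
  \<comment> \<open>r <= 1/3 keeps the window around 2/3 or -2/3 inside {-1..1}, so its full length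
    2 r is counted.\<close>
  have r: "0 \<le> r" "r \<le> 1 / 3"
  proof -
    have "r \<le> sqrt ((1 / 3)\<^sup>2)" unfolding r_def using y by (intro real_sqrt_le_mono) (simp add: power2_eq_square)
    then show "r \<le> 1 / 3" by simp
    show "0 \<le> r" using y by (simp add: r_def)
  qed
  have "((\<lambda>v. near_tail y) has_integral (2 * r) *\<^sub>R near_tail y) {e - r..e + r}"
    using has_integral_const_real[of "near_tail y" "e - r" "e + r"] r by simp
  then have "((\<lambda>v. if v \<in> {e - r..e + r} then near_tail y else 0) has_integral (2 * r) *\<^sub>R near_tail y) {-1..1}"
    using r e by (subst has_integral_restrict) auto
  moreover have "(\<lambda>v. if v \<in> {e - r..e + r} then near_tail y else 0) = (\<lambda>v. if \<bar>v - e\<bar> \<le> r then near_tail y else 0)"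
    by (auto simp: fun_eq_iff)
  ultimately have 2: "((\<lambda>v. if \<bar>v - e\<bar> \<le> r then near_tail y else 0) has_integral 2 * r * near_tail y) {-1..1}"
    by simp
  have "C * integral {-1..1} (\<lambda>v. exp (- (k * (v - e)\<^sup>2))) \<le> C * sqrt (pi / k)"
    by (intro mult_left_mono gaussian_interval(2) \<open>k > 0\<close> C0)
  then have "C * integral {-1..1} (\<lambda>v. exp (- (k * (v - e)\<^sup>2))) + 2 * r * near_tail y \<le> gauss_total y + 2 * r * near_tail y"
    unfolding gauss_total_def C_def k_def by simp
  with has_integral_add[OF 1 2] show ?thesis by (rule that)
qed

text \<open>The integral over the period is 2 \<open>pbar n\<close>, and the approximation of
  1/theta4 carries another 1/2, so the main part of \<open>pbar n\<close> is I/4. The period has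
  length 2 and there are two cusps of denominator 3, so after halving each bound appears
  once.\<close>

lemma pbar_minus_main_arc:
  fixes y :: real
  assumes y: "0 < y" "y \<le> 1 / 81"
  defines "v1 \<equiv> sqrt (4 * y / 3 - y\<^sup>2)"
  assumes I: "((\<lambda>v. csqrt (Complex y v) * exp (of_real (pi * real n) * Complex y v + of_real (pi / 4) / Complex y v)) has_integral I) {-v1..v1}"
  shows "norm (of_nat (pbar n) - I / 4) \<le> exp (pi * real n * y) * (far_bound y + gauss_total y + 2 * sqrt (4 * y / 27) * near_tail y)"
proof -
  define r where "r = sqrt (4 * y / 27)"
  let ?t = "\<lambda>v. Complex y v"
  let ?e = "\<lambda>v. exp (of_real (pi * real n) * ?t v)"
  define M where "M = (\<lambda>v. csqrt (?t v) * exp (of_real pi / (4 * ?t v)) / 2)"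
  have v1: "0 \<le> v1" "v1 \<le> 1"
  proof -
    have "y * y \<le> y * (4 / 3)" using y by (intro mult_left_mono) auto
    then show "0 \<le> v1" unfolding v1_def by (simp add: power2_eq_square)
    have "4 * y / 3 - y\<^sup>2 \<le> 1" using y zero_le_power2[of y] by linarith
    then show "v1 \<le> 1" unfolding v1_def by simp
  qed
  have "((\<lambda>v. 1 / 2 * (csqrt (?t v) * exp (of_real (pi * real n) * ?t v + of_real (pi / 4) / ?t v))) has_integral 1 / 2 * I) {-v1..v1}"
    by (rule has_integral_mult_right[OF I])
  moreover have "1 / 2 * (csqrt (?t v) * exp (of_real (pi * real n) * ?t v + of_real (pi / 4) / ?t v)) = ?e v * M v" for v
    unfolding M_def exp_add by simp
  ultimately have "((\<lambda>v. ?e v * M v) has_integral I / 2) {-v1..v1}" by simp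
  then have "((\<lambda>v. if v \<in> {-v1..v1} then ?e v * M v else 0) has_integral I / 2) {-1..1}"
    using v1 by (subst has_integral_restrict) auto
  from has_integral_diff[OF pbar_integral[OF y(1), of n] this]
  have Q: "((\<lambda>v. ?e v / theta4 (?t v) - (if v \<in> {-v1..v1} then ?e v * M v else 0)) has_integral (of_nat (2 * pbar n) - I / 2)) {-1..1}" .
  define Q where "Q = (\<lambda>v. ?e v / theta4 (?t v) - (if v \<in> {-v1..v1} then ?e v * M v else 0))"
  note Q = Q[folded Q_def]
  define q where "q = (\<lambda>u. near_gauss y u + (if \<bar>u\<bar> \<le> r then near_tail y else 0))"
  obtain J1 where J1: "((\<lambda>v. q (v - 2 / 3)) has_integral J1) {-1..1}" "J1 \<le> gauss_total y + 2 * r * near_tail y"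
    using near_cusp_integral[OF y, of "2 / 3"] unfolding q_def r_def by auto
  obtain J2 where J2: "((\<lambda>v. q (v + 2 / 3)) has_integral J2) {-1..1}" "J2 \<le> gauss_total y + 2 * r * near_tail y"
    using near_cusp_integral[OF y, of "- 2 / 3"] unfolding q_def r_def by auto
  have far: "((\<lambda>v::real. far_bound y) has_integral 2 * far_bound y) {-1..1}"
    using has_integral_const_real[of "far_bound y" "-1" 1] by simp
  define g where "g = (\<lambda>v. exp (pi * real n * y) * (far_bound y + q (v - 2 / 3) + q (v + 2 / 3)))"
  have g: "(g has_integral exp (pi * real n * y) * (2 * far_bound y + J1 + J2)) {-1..1}"
    unfolding g_def by (intro has_integral_mult_right has_integral_add far J1 J2)
  have "norm (integral {-1..1} Q) \<le> integral {-1..1} g"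
  proof (rule integral_norm_bound_integral)
    show "Q integrable_on {-1..1}" "g integrable_on {-1..1}" using Q g by (auto simp: has_integral_integrable)
    fix v :: real assume v: "v \<in> {-1..1}"
    have mem: "v \<in> {-v1..v1} \<longleftrightarrow> \<bar>v\<bar> \<le> v1" by auto
    have "Q v = ?e v * (1 / theta4 (?t v) - (if \<bar>v\<bar> \<le> v1 then M v else 0))"
      unfolding Q_def mem by (simp add: right_diff_distrib)
    then have "norm (Q v) = exp (pi * real n * y) * norm (1 / theta4 (?t v) - (if \<bar>v\<bar> \<le> v1 then M v else 0))"
      by (simp add: norm_mult norm_exp_eq_Re)
    also have "\<dots> \<le> g v"
      unfolding g_def q_def r_def M_def v1_def using v
      by (intro mult_left_mono inverse_theta4_bound y) auto
    finally show "norm (Q v) \<le> g v" .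
  qed
  then have "norm (of_nat (2 * pbar n) - I / 2) \<le> exp (pi * real n * y) * (2 * far_bound y + J1 + J2)"
    using integral_unique[OF Q] integral_unique[OF g] by simp
  also have "\<dots> \<le> exp (pi * real n * y) * (2 * (far_bound y + gauss_total y + 2 * r * near_tail y))"
    using J1(2) J2(2) by (intro mult_left_mono) auto
  finally have *: "norm (of_nat (2 * pbar n) - I / 2) \<le> 2 * (exp (pi * real n * y) * (far_bound y + gauss_total y + 2 * r * near_tail y))"
    by (simp add: algebra_simps)
  have "of_nat (2 * pbar n) - I / 2 = 2 * (of_nat (pbar n) - I / 4)" by simp
  then have "norm (of_nat (2 * pbar n) - I / 2) = 2 * norm (of_nat (pbar n) - I / 4)"
    by (simp only: norm_mult norm_numeral)
  with * show ?thesis unfolding r_def by linarith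
qed

section \<open>Numerical estimates\<close>

lemma exp_3_ge: "exp (3 :: real) \<ge> 20"
proof -
  have "(20 :: real) \<le> (1 + 3 / 64 + (3 / 64)\<^sup>2 / 2) ^ 64" by (simp add: power_divide power2_eq_square)
  also have "\<dots> \<le> exp 3" using exp_ge_quadratic_power[of 3 64] by simp
  finally show ?thesis .
qed

lemma exp_seven_halves_ge: "exp (7 / 2 :: real) \<ge> 33"
proof -
  have "(33 :: real) \<le> (1 + 7 / 128 + (7 / 128)\<^sup>2 / 2) ^ 64" by (simp add: power_divide power2_eq_square)
  also have "\<dots> \<le> exp (7 / 2)" using exp_ge_quadratic_power[of "7 / 2" 64] by simp
  finally show ?thesis .
qed

text \<open>By convexity, one numerical value of exp yields a linear lower bound for all larger
  arguments.\<close>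

lemma exp_ge_tangent:
  fixes x c K :: real
  assumes "exp c \<ge> K" "x \<ge> c" "K \<ge> 0"
  shows "exp x \<ge> K * (x - c + 1)"
proof -
  have "x - c + 1 \<le> exp (x - c)" using exp_ge_add_one_self[of "x - c"] by linarith
  then have "K * (x - c + 1) \<le> exp c * exp (x - c)"
    using assms by (intro mult_mono) auto
  then show ?thesis by (simp add: mult_exp_exp)
qed

lemma far_bound_numeric:
  fixes s :: real
  assumes s: "s \<ge> 1356 / 100"
  shows "far_bound (1 / (6 * s)) \<le> 2.01 * exp (pi * s / 6) / (8 * s\<^sup>2)"
proof -
  \<comment> \<open>The exponent 6 pi s/100 of \<open>far_bound\<close> falls short of pi s/6 by 8
    pi s/75, and this must beat s^(3/2). The square of that quantity is p^3, so it is enough to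
    bound p, which a tangent line does.\<close>
  define p where "p = s * exp (- (16 / 225 * (pi * s)))"
  define q where "q = pi * s"
  have ps: "31415 / 10000 * s \<le> q" unfolding q_def using pi_approx(1) s by (intro mult_right_mono) auto
  have "s / 0.664 \<le> 20 * (16 / 225 * (pi * s) - 3 + 1)" unfolding q_def[symmetric] using ps s by simp
  also have "\<dots> \<le> exp (16 / 225 * (pi * s))"
    by (rule exp_ge_tangent[OF exp_3_ge]) (unfold q_def[symmetric], use ps s in simp_all)
  finally have "p \<le> 0.664" unfolding p_def by (simp add: exp_minus field_simps)
  moreover have p0: "p \<ge> 0" using s by (simp add: p_def)
  ultimately have p3: "p ^ 3 \<le> 0.664 ^ 3" by (intro power_mono) auto
  define Z where "Z = s * sqrt s * exp (- (8 / 75 * (pi * s)))"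
  have Z2: "Z\<^sup>2 = p ^ 3"
  proof -
    have "exp (- (8 / 75 * (pi * s))) ^ 2 = exp (- (16 / 225 * (pi * s))) ^ 3"
      by (simp add: exp_of_nat_mult[symmetric])
    then show ?thesis unfolding Z_def p_def power_mult_distrib using s by (simp add: power2_eq_square power3_eq_cube)
  qed
  have "far_bound (1 / (6 * s)) * (8 * s\<^sup>2) = 4.048 * (sqrt (5 / 6) * Z) * exp (pi * s / 6)"
  proof -
    have e1: "sqrt 5 * sqrt (1 / (6 * s)) * s\<^sup>2 = sqrt (5 / 6) * (s * sqrt s)"
    proof -
      have "sqrt 5 * sqrt (1 / (6 * s)) = sqrt (5 / 6) * (1 / sqrt s)"
        by (simp add: real_sqrt_mult[symmetric] real_sqrt_divide[symmetric])
      moreover have "1 / sqrt s * s\<^sup>2 = s * sqrt s"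
        using s by (simp add: power2_eq_square divide_eq_eq)
      ultimately show ?thesis by (simp only: mult.assoc)
    qed
    have e2: "exp (pi / (100 * (1 / (6 * s)))) = exp (- (8 / 75 * (pi * s))) * exp (pi * s / 6)"
      unfolding mult_exp_exp by simp
    have "far_bound (1 / (6 * s)) * (8 * s\<^sup>2) =
      0.506 * 8 * ((sqrt 5 * sqrt (1 / (6 * s)) * s\<^sup>2) * exp (pi / (100 * (1 / (6 * s)))))"
      unfolding far_bound_def by (simp only: mult_ac)
    then show ?thesis unfolding e1 e2 Z_def by simp
  qed
  also have "\<dots> \<le> 2.01 * exp (pi * s / 6)"
  proof (rule mult_right_mono)
    have "(sqrt (5 / 6) * Z)\<^sup>2 \<le> 5 / 6 * 0.664 ^ 3" unfolding power_mult_distrib Z2 using p3 by simp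
    also have "\<dots> \<le> (0.4965)\<^sup>2" by (simp add: power2_eq_square power3_eq_cube)
    finally have "sqrt (5 / 6) * Z \<le> 0.4965" by (rule power2_le_imp_le) simp
    moreover have "4.048 * u \<le> 2.01" if "u \<le> 0.4965" for u :: real using that by simp
    ultimately show "4.048 * (sqrt (5 / 6) * Z) \<le> 2.01" by blast
  qed simp
  finally show ?thesis using s by (simp add: pos_le_divide_eq)
qed

lemma gauss_total_numeric:
  fixes s :: real
  assumes s: "s \<ge> 1356 / 100"
  shows "gauss_total (1 / (6 * s)) \<le> 1.73 * exp (pi * s / 6) / (8 * s\<^sup>2)"
proof -
  define y where "y = 1 / (6 * s)"
  define K where "K = pi * s / 12 - 1 / 4"
  define q where "q = pi * s"
  have ps: "31415 / 10000 * s \<le> q" unfolding q_def using pi_approx(1) s by (intro mult_right_mono) auto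
  then have K: "K > 0" unfolding K_def q_def[symmetric] using s by simp
  have y: "y > 0" "s = 1 / (6 * y)" using s by (auto simp: y_def)
  have e: "pi / (36 * y) = pi * s / 6" "pi / (72 * y) - 1 / 4 = K"
    unfolding K_def y_def by simp_all
  have "gauss_total y * (8 * s\<^sup>2) = 4.048 * (sqrt 3 * sqrt y * sqrt (pi / (K / y\<^sup>2)) * s\<^sup>2) * exp (pi * s / 6)"
    unfolding gauss_total_def e by simp
  also have "sqrt 3 * sqrt y * sqrt (pi / (K / y\<^sup>2)) * s\<^sup>2 = sqrt (3 * y * (pi / (K / y\<^sup>2)) * (s\<^sup>2)\<^sup>2)"
    unfolding real_sqrt_mult by (simp only: real_sqrt_abs abs_power2)
  also have "3 * y * (pi / (K / y\<^sup>2)) * (s\<^sup>2)\<^sup>2 = pi * s / (72 * K)"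
    using K y(1) unfolding y(2) by (simp add: field_simps power2_eq_square)
  also have "4.048 * sqrt (pi * s / (72 * K)) * exp (pi * s / 6) \<le> 1.73 * exp (pi * s / 6)"
  proof (rule mult_right_mono)
    \<comment> \<open>The ratio pi s/(72 K) decreases to 12/72 = 1/6; 0.182 leaves room for the -1/4
      in K at s = 13.56.\<close>
    have "pi * s \<le> 0.182 * (72 * K)" unfolding K_def q_def[symmetric] using ps s by simp
    then have "pi * s / (72 * K) \<le> 0.182" using K by (simp add: divide_le_eq)
    also have "0.182 \<le> (0.42737 :: real)\<^sup>2" by (simp add: power2_eq_square)
    finally have "sqrt (pi * s / (72 * K)) \<le> 0.42737" by (intro real_le_lsqrt) (use K s in auto)
    then show "4.048 * sqrt (pi * s / (72 * K)) \<le> 1.73" by simp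
  qed simp
  finally show ?thesis using s unfolding y_def by (simp add: pos_le_divide_eq)
qed

text \<open>\<open>near_tail\<close> carries only half of the exponent pi s/6. The other half
  absorbs the surplus factor s that is left after multiplying by s^2.\<close>

lemma near_tail_numeric:
  fixes s :: real
  assumes s: "s \<ge> 1356 / 100"
  shows "2 * sqrt (4 * (1 / (6 * s)) / 27) * near_tail (1 / (6 * s)) \<le> 0.45 * exp (pi * s / 6) / (8 * s\<^sup>2)"
proof -
  define y where "y = 1 / (6 * s)"
  have y: "y > 0" "s = 1 / (6 * y)" using s by (auto simp: y_def)
  define q where "q = pi * s"
  have ps: "31415 / 10000 * s \<le> q" unfolding q_def using pi_approx(1) s by (intro mult_right_mono) auto
  have "s / 0.42 \<le> 33 * (pi * s / 12 - 7 / 2 + 1)" unfolding q_def[symmetric] using ps s by simp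
  also have "\<dots> \<le> exp (pi * s / 12)"
    by (rule exp_ge_tangent[OF exp_seven_halves_ge]) (unfold q_def[symmetric], use ps s in simp_all)
  finally have E: "s \<le> 0.42 * exp (pi * s / 12)" by (simp add: field_simps)
  have "sqrt 18 \<le> 4.2427" by (rule real_le_lsqrt) (simp_all add: power2_eq_square)
  then have "sqrt (4 * sqrt 18 / 27) \<le> 0.7929"
    by (intro real_le_lsqrt) (simp_all add: power2_eq_square)
  moreover have "sqrt (4 * y / 27) * sqrt (sqrt 18 * y) = sqrt (4 * sqrt 18 / 27) * y"
  proof -
    have "sqrt (4 * y / 27) * sqrt (sqrt 18 * y) = sqrt ((4 * sqrt 18 / 27) * y\<^sup>2)"
      unfolding real_sqrt_mult[symmetric] by (simp add: power2_eq_square)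
    also have "\<dots> = sqrt (4 * sqrt 18 / 27) * sqrt (y\<^sup>2)" by (rule real_sqrt_mult)
    also have "sqrt (y\<^sup>2) = y" using y by simp
    finally show ?thesis .
  qed
  ultimately have "sqrt (4 * y / 27) * sqrt (sqrt 18 * y) \<le> 0.7929 * y" using y by simp
  then have "2 * 0.506 * (sqrt (4 * y / 27) * sqrt (sqrt 18 * y)) * exp (pi * s / 12) * (8 * s\<^sup>2) \<le>
     2 * 0.506 * (0.7929 * y) * exp (pi * s / 12) * (8 * s\<^sup>2)"
    by (intro mult_right_mono mult_left_mono) auto
  also have "\<dots> = 2 * 0.506 * 0.7929 * (8 / 6) * exp (pi * s / 12) * s"
    using y(1) unfolding y(2) by (simp add: power2_eq_square)
  also have "\<dots> \<le> 2 * 0.506 * 0.7929 * (8 / 6) * exp (pi * s / 12) * (0.42 * exp (pi * s / 12))"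
    by (intro mult_left_mono E) simp
  also have "\<dots> = 2 * 0.506 * 0.7929 * (8 / 6) * 0.42 * exp (pi * s / 6)"
    by (simp add: mult_exp_exp)
  also have "\<dots> \<le> 0.45 * exp (pi * s / 6)" by (intro mult_right_mono) auto
  also have "2 * 0.506 * (sqrt (4 * y / 27) * sqrt (sqrt 18 * y)) * exp (pi * s / 12) = 2 * sqrt (4 * y / 27) * near_tail y"
  proof -
    have "pi / (72 * y) = pi * s / 12" unfolding y_def by simp
    then show ?thesis unfolding near_tail_def by simp
  qed
  finally show ?thesis using s unfolding y_def by (simp add: pos_le_divide_eq)
qed

text \<open>With X = exp (mu_hat n / 6), the factor exp (pi n y) is X and the cusps of denominator 3
  supply a second X, giving X^2 = exp (mu_hat n / 3). The budget is 2.01 + 1.73 + 0.45 from outside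
  the main arc and 0.08/4 from its boundary terms, in total 4.21, against 4.5 * 41/42.\<close>

lemma pbar_error_bound:
  assumes n: "n \<ge> 184"
  shows "\<bar>real (pbar n) - T_hat n\<bar> < 4.5 * (1 - 1 / mu_hat n) * exp (mu_hat n / 3) / (8 * real n)"
proof -
  define s where "s = sqrt (real n)"
  have s2: "s\<^sup>2 = real n" by (simp add: s_def)
  have s: "s \<ge> 1356 / 100"
    unfolding s_def by (rule real_le_rsqrt) (use n in \<open>simp add: power2_eq_square\<close>)
  have mu: "mu_hat n = pi * s" by (simp add: mu_hat_def s_def)
  define q where "q = pi * s"
  have ps: "31415 / 10000 * s \<le> q" unfolding q_def using pi_approx(1) s by (intro mult_right_mono) auto
  define y where "y = 1 / (6 * s)"
  \<comment> \<open>6 * 13.56 = 81.36 explains the bound 1/81, and 13.56 is sqrt 184 rounded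
    down.\<close>
  have y: "0 < y" "y \<le> 1 / 81" using s by (auto simp: y_def field_simps)
  define v1 where "v1 = sqrt (4 * y / 3 - y\<^sup>2)"
  \<comment> \<open>These a and b give the main-arc integrand: a^2 = pi n, b^2 = pi/4, and hence 2 a
    b = mu_hat n.\<close>
  define a where "a = sqrt pi * s"
  define b where "b = sqrt pi / 2"
  have ab: "a > 0" "b > 0" "2 * a * b = pi * s" "a\<^sup>2 = pi * real n" "b\<^sup>2 = pi / 4"
    using s by (auto simp: a_def b_def power_mult_distrib power_divide s2)
  have yy: "y\<^sup>2 < 4 * y / 3"
  proof -
    have "y * y < y * (4 / 3)" using y by (intro mult_strict_left_mono) auto
    then show ?thesis by (simp add: power2_eq_square)
  qed
  have v1: "v1 > 0" "v1\<^sup>2 = 4 * y / 3 - y\<^sup>2" using yy by (auto simp: v1_def)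
  define X where "X = exp (pi * s / 6)"
  have X: "X \<ge> 600"
  proof -
    have "(600 :: real) \<le> (1 + 7.09 / 8 + (7.09 / 8)\<^sup>2 / 2) ^ 8" by (simp add: power_divide power2_eq_square)
    also have "\<dots> \<le> exp 7.09" using exp_ge_quadratic_power[of "7.09" 8] by simp
    also have "\<dots> \<le> X" unfolding X_def by (rule iffD2[OF exp_le_cancel_iff]) (unfold q_def[symmetric], use ps s in simp)
    finally show ?thesis .
  qed
  have ny: "pi * real n * y = pi * s / 6" unfolding s2[symmetric] y_def using s by (simp add: power2_eq_square)
  define E where "E = a\<^sup>2 * y + b\<^sup>2 * y / (y\<^sup>2 + v1\<^sup>2)"
  \<comment> \<open>At the ends of the arc |t|^2 = 4 y / 3, so the singular part of the exponent is
    only 3 pi / 16. The boundary terms are thus of order X instead of X^2, and X >= 600 makes them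
    negligible.\<close>
  have E: "E = pi * s / 6 + 3 * pi / 16"
  proof -
    have yv: "y\<^sup>2 + v1\<^sup>2 = 4 * y / 3" using v1 by simp
    show ?thesis unfolding E_def yv ab ny using y by simp
  qed
  obtain I where I: "((\<lambda>v. csqrt (Complex y v) * exp (of_real (a\<^sup>2) * Complex y v + of_real (b\<^sup>2) / Complex y v)) has_integral I) {-v1..v1}"
    and Ib: "norm (I - of_real (sqrt pi / a\<^sup>2 * (b - 1 / (2 * a)) * exp (2 * a * b))) \<le>
      1 / a\<^sup>2 * (2 * sqrt (norm (Complex y v1)) * exp E + 2 * sqrt pi * b * exp E + sqrt pi * (b + 1 / (2 * a)))"
  proof (rule main_arc_integral[OF ab(1,2) y(1) v1(1)])
    show "1 \<le> 2 * a * b" unfolding ab q_def[symmetric] using ps s by simp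
  qed (auto simp: E_def)
  have main: "sqrt pi / a\<^sup>2 * (b - 1 / (2 * a)) * exp (2 * a * b) = 4 * T_hat n"
  proof -
    have F: "sqrt pi * (b - 1 / (2 * a)) = (pi / 2) * (1 - 1 / (pi * s))"
      using s by (simp add: a_def b_def field_simps)
    have "sqrt pi / a\<^sup>2 * (b - 1 / (2 * a)) * exp (2 * a * b) = sqrt pi * (b - 1 / (2 * a)) / a\<^sup>2 * exp (2 * a * b)"
      by simp
    also have "\<dots> = (pi / 2) * (1 - 1 / (pi * s)) / (pi * real n) * exp (pi * s)"
      unfolding F ab ..
    also have "\<dots> = 4 * T_hat n" unfolding T_hat_def mu by simp
    finally show ?thesis .
  qed
  have "1 / a\<^sup>2 * (2 * sqrt (norm (Complex y v1)) * exp E + 2 * sqrt pi * b * exp E + sqrt pi * (b + 1 / (2 * a))) \<le>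
     1 / a\<^sup>2 * (13 * X)"
  proof (rule mult_left_mono)
    have "norm (Complex y v1) = sqrt (4 * y / 3)" using v1 by (simp add: complex_norm)
    moreover have "sqrt (4 * y / 3) \<le> 1" using y by simp
    ultimately have 1: "sqrt (norm (Complex y v1)) \<le> 1" by simp
    have "exp (3 * pi / 16) \<le> exp (3 / 5)" using pi_approx(2) by simp
    also have "\<dots> \<le> 1 + 3 / 5 + (3 / 5)\<^sup>2" by (rule exp_bound) auto
    finally have "exp (3 * pi / 16) \<le> 2" by (simp add: power2_eq_square)
    then have e: "exp E \<le> 2 * X" unfolding E exp_add X_def by simp
    have f1: "2 * sqrt (norm (Complex y v1)) * exp E \<le> 2 * 1 * (2 * X)"
      using 1 e X by (intro mult_mono) auto
    have f2: "2 * sqrt pi * b * exp E \<le> 3.15 * (2 * X)"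
      using e X pi_approx(2) by (intro mult_mono) (auto simp: b_def)
    have f3: "sqrt pi * (b + 1 / (2 * a)) \<le> 2"
    proof -
      have "sqrt pi * (b + 1 / (2 * a)) = pi / 2 + 1 / (2 * s)" using s by (simp add: a_def b_def field_simps)
      also have "1 / (2 * s) \<le> 1 / 10" using s by (simp add: field_simps)
      finally show ?thesis using pi_approx(2) by simp
    qed
    have "2 * sqrt (norm (Complex y v1)) * exp E + 2 * sqrt pi * b * exp E + sqrt pi * (b + 1 / (2 * a)) \<le>
        2 * 1 * (2 * X) + 3.15 * (2 * X) + 2"
      by (intro add_mono f1 f2 f3)
    also have "\<dots> \<le> 13 * X" using X by simp
    finally show "2 * sqrt (norm (Complex y v1)) * exp E + 2 * sqrt pi * b * exp E + sqrt pi * (b + 1 / (2 * a)) \<le> 13 * X" .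
  qed simp
  also have "1 / a\<^sup>2 * (13 * X) \<le> 0.08 * X\<^sup>2 / (8 * real n)"
  proof -
    have "13 * 8 \<le> 0.08 * 3 * X" using X by simp
    also have "\<dots> \<le> 0.08 * pi * X" using X pi_gt3 by (intro mult_right_mono mult_left_mono) auto
    finally have "(13 * 8) * X \<le> (0.08 * pi * X) * X" using X by (intro mult_right_mono) auto
    then show ?thesis unfolding ab using n by (simp add: field_simps power2_eq_square)
  qed
  finally have bnd: "norm (I - of_real (4 * T_hat n)) \<le> 0.08 * X\<^sup>2 / (8 * real n)"
    using Ib unfolding main by linarith
  have arcs: "norm (of_nat (pbar n) - I / 4) \<le> X * (far_bound y + gauss_total y + 2 * sqrt (4 * y / 27) * near_tail y)"
    using pbar_minus_main_arc[OF y I[unfolded ab v1_def]] unfolding ny X_def .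
  have "far_bound y + gauss_total y + 2 * sqrt (4 * y / 27) * near_tail y \<le>
      2.01 * X / (8 * s\<^sup>2) + 1.73 * X / (8 * s\<^sup>2) + 0.45 * X / (8 * s\<^sup>2)"
    unfolding X_def y_def by (intro add_mono far_bound_numeric gauss_total_numeric near_tail_numeric s)
  also have "\<dots> = 4.19 * X / (8 * real n)" unfolding s2 by (simp add: field_simps)
  finally have "X * (far_bound y + gauss_total y + 2 * sqrt (4 * y / 27) * near_tail y) \<le> X * (4.19 * X / (8 * real n))"
    using X by (intro mult_left_mono) auto
  with arcs have arcs': "norm (of_nat (pbar n) - I / 4) \<le> 4.19 * X\<^sup>2 / (8 * real n)"
    by (simp add: power2_eq_square)
  have "\<bar>real (pbar n) - T_hat n\<bar> = norm (complex_of_real (real (pbar n) - T_hat n))" by (simp only: norm_of_real)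
  also have "complex_of_real (real (pbar n) - T_hat n) = (of_nat (pbar n) - I / 4) + (I - of_real (4 * T_hat n)) / 4"
    by (simp add: field_simps)
  also have "norm \<dots> \<le> norm (of_nat (pbar n) - I / 4) + norm (I - of_real (4 * T_hat n)) / 4"
    by (rule order_trans[OF norm_triangle_ineq]) (simp add: norm_divide)
  also have "\<dots> \<le> 4.19 * X\<^sup>2 / (8 * real n) + (0.08 * X\<^sup>2 / (8 * real n)) / 4"
    using arcs' bnd by (intro add_mono divide_right_mono) auto
  also have "\<dots> = 4.21 * (X\<^sup>2 / (8 * real n))" by simp
  also have "\<dots> < 4.5 * (1 - 1 / (pi * s)) * (X\<^sup>2 / (8 * real n))"
  proof (rule mult_strict_right_mono)
    have "42 \<le> pi * s" unfolding q_def[symmetric] using ps s by simp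
    then have "1 / (pi * s) \<le> 1 / 42" by (intro divide_left_mono) auto
    moreover have "4.21 < 4.5 * (1 - u)" if "u \<le> 1 / 42" for u :: real using that by simp
    ultimately show "4.21 < 4.5 * (1 - 1 / (pi * s))" by blast
    show "0 < X\<^sup>2 / (8 * real n)" using X n by (intro divide_pos_pos) auto
  qed
  also have "X\<^sup>2 = exp (mu_hat n / 3)" unfolding X_def mu by (simp add: power2_eq_square mult_exp_exp)
  finally show ?thesis unfolding mu by simp
qed

section \<open>From exponential smallness to the power of \<open>mu_hat n\<close>\<close>

lemma ln_2_2_ge: "ln (2.2 :: real) \<ge> 0.782"
proof -
  have "1 / 2.2 \<le> (1 - 0.782 / 64 :: real) ^ 64" by (simp add: power_divide)
  also have "\<dots> \<le> exp (- 0.782 / 64) ^ 64"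
    using exp_ge_add_one_self[of "- 0.782 / 64 :: real"] by (intro power_mono) auto
  also have "\<dots> = exp (- 0.782)" by (simp flip: exp_of_nat_mult)
  finally have "exp 0.782 \<le> (2.2 :: real)" by (simp add: exp_minus field_simps)
  moreover have "(0 :: real) < 2.2" by simp
  ultimately show ?thesis using ln_ge_iff by blast
qed

text \<open>With exp L = m this says 1.13 ln m * N0 m / m <= m. The bound ln L >= 1 + ln 2.2 -
  2.2/L, sharp at L = 2.2 and hence near ln 9, turns the right-hand side into a quadratic in L. Its
  value 8.994... at 2.2 shows that 1.13 is nearly the best factor this argument gives.\<close>

lemma exp_ge_mult_diff_ln:
  fixes L :: real
  assumes "exp L \<ge> 9" "L > 0"
  shows "exp L \<ge> 1.13 * (L * (2 * L - ln L))"
proof -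
  have "ln (2.2 / L) \<le> 2.2 / L - 1" using assms by (intro ln_le_minus_one) auto
  moreover have "ln (2.2 / L) = ln 2.2 - ln L" using assms by (intro ln_divide_pos) auto
  moreover have "1.782 - p \<le> l" if "c - l \<le> p - 1" "0.782 \<le> c" for c l p :: real using that by simp
  ultimately have "ln L \<ge> 1.782 - 2.2 / L" using ln_2_2_ge by metis
  then have "L * (2 * L - ln L) \<le> L * (2 * L - (1.782 - 2.2 / L))" using assms by (intro mult_left_mono) auto
  also have "\<dots> = 2 * L\<^sup>2 - 1.782 * L + 2.2" using assms by (simp add: power2_eq_square algebra_simps)
  finally have q: "1.13 * (L * (2 * L - ln L)) \<le> 1.13 * (2 * L\<^sup>2 - 1.782 * L + 2.2)" by simp
  define d where "d = L - 2.2"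
  have Ld: "L = 2.2 + d" by (simp add: d_def)
  have poly: "1.13 * (2 * L\<^sup>2 - 1.782 * L + 2.2) = 8.994348 + 7.93034 * d + 2.26 * d\<^sup>2"
    unfolding Ld by (simp add: power2_eq_square field_simps)
  show ?thesis
  proof (cases "L \<le> 2.2")
    case True
    then have d: "- 2.2 \<le> d" "d \<le> 0" using assms by (auto simp: d_def)
    have "d * (7.93034 + 2.26 * d) \<le> 0" using d by (intro mult_nonpos_nonneg) auto
    then have "7.93034 * d + 2.26 * d\<^sup>2 \<le> 0" by (simp add: power2_eq_square algebra_simps)
    then have "8.994348 + 7.93034 * d + 2.26 * d\<^sup>2 \<le> 9" by simp
    from order_trans[OF q[unfolded poly] order_trans[OF this assms(1)]] show ?thesis .
  next
    case False
    then have d: "d \<ge> 0" by (simp add: d_def)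
    have "(9 :: real) \<le> (1 + 2.2 / 64 + (2.2 / 64)\<^sup>2 / 2) ^ 64" by (simp add: power_divide power2_eq_square)
    also have "\<dots> \<le> exp 2.2" using exp_ge_quadratic_power[of "2.2" 64] by simp
    finally have "9 * (1 + d + d\<^sup>2 / 2) \<le> exp 2.2 * exp d"
      using d by (intro mult_mono exp_lower_Taylor_quadratic) auto
    then have "9 * (1 + d + d\<^sup>2 / 2) \<le> exp L" by (simp add: mult_exp_exp Ld)
    moreover have "8.994348 + 7.93034 * d + 2.26 * e \<le> 9 * (1 + d + e / 2)" if "0 \<le> e" for e :: real
      using that d by simp
    ultimately show ?thesis using order_trans[OF q[unfolded poly]] zero_le_power2[of d] order_trans by blast
  qed
qed

text \<open>The factor 3 is hidden in a power: 1.148^8 >= 3 for m <= 8, and 1.13^9 >= 3 from m = 9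
  on. In the second range write x = m k; the claim becomes 1.13 m k <= exp k. At k0 = N0 m / m one
  has exp k0 = m^2 / ln m, where the claim is the preceding inequality, and it persists for k >= k0
  since k0 >= 1.\<close>

lemma power_le_exp:
  fixes x :: real
  assumes m: "m \<ge> 2" and x: "x \<ge> 28.3" "x \<ge> N0 m"
  shows "3 * x ^ m \<le> exp x"
proof (cases "m \<le> 8")
  case True
  \<comment> \<open>The eighth root of the claim at m = 8: the tangent to exp at 7/2, evaluated at
    x/8 with x >= 28.3, just exceeds 1.148 x.\<close>
  have "1.148 * x \<le> 33 * (x / 8 - 7 / 2 + 1)" using x by simp
  also have "\<dots> \<le> exp (x / 8)"
    by (rule exp_ge_tangent[OF exp_seven_halves_ge]) (use x in simp_all)
  finally have "(1.148 * x) ^ 8 \<le> exp (x / 8) ^ 8" using x by (intro power_mono) auto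
  also have "\<dots> = exp x" by (simp flip: exp_of_nat_mult)
  finally have "1.148 ^ 8 * x ^ 8 \<le> exp x" by (simp only: power_mult_distrib)
  moreover have "3 * x ^ m \<le> 1.148 ^ 8 * x ^ 8"
    using x True by (intro mult_mono power_increasing) (auto simp: power_divide)
  ultimately show ?thesis by linarith
next
  case False
  then have m9: "m \<ge> 9" by simp
  define L where "L = ln (real m)"
  have eL: "exp L = real m" using m by (simp add: L_def)
  have L: "L > 0" using m by (simp add: L_def)
  define k0 where "k0 = 2 * L - ln L"
  have "exp L \<ge> 9" using m9 eL by simp
  then have "1.13 * (L * k0) \<le> exp L" unfolding k0_def using L by (rule exp_ge_mult_diff_ln)
  then have mL: "1.13 * k0 \<le> real m / L" using L unfolding eL by (simp add: field_simps)
  have "ln L \<le> L - 1" using L by (rule ln_le_minus_one)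
  then have k01: "k0 \<ge> 1" using L by (simp add: k0_def)
  define k where "k = x / real m"
  have xk: "x = real m * k" using m by (simp add: k_def)
  have "N0 m = real m * k0" by (simp add: N0_def k0_def L_def algebra_simps)
  then have kk0: "k \<ge> k0" using x(2) m unfolding xk by simp
  have ek0: "exp k0 = real m * (real m / L)"
    unfolding k0_def using L by (simp add: exp_diff exp_double eL power2_eq_square)
  have "k \<le> k0 * (1 + (k - k0))"
  proof -
    have "0 \<le> (k0 - 1) * (k - k0)" using k01 kk0 by simp
    then show ?thesis by (simp add: algebra_simps)
  qed
  also have "\<dots> \<le> k0 * exp (k - k0)" using k01 exp_ge_add_one_self[of "k - k0"] by (intro mult_left_mono) auto
  finally have "1.13 * k * real m \<le> 1.13 * (k0 * exp (k - k0)) * real m" by (intro mult_right_mono mult_left_mono) auto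
  also have "\<dots> = real m * (1.13 * k0) * exp (k - k0)" by simp
  also have "\<dots> \<le> real m * (real m / L) * exp (k - k0)"
    using mL by (intro mult_right_mono mult_left_mono) auto
  also have "\<dots> = exp k" unfolding ek0[symmetric] by (simp add: mult_exp_exp)
  finally have "1.13 * x \<le> exp k" unfolding xk by (simp add: mult_ac)
  then have "(1.13 * x) ^ m \<le> exp k ^ m" using x by (intro power_mono) auto
  also have "\<dots> = exp x" unfolding xk by (simp add: exp_of_nat_mult)
  finally have "1.13 ^ m * x ^ m \<le> exp x" by (simp only: power_mult_distrib)
  moreover have "3 \<le> (1.13 :: real) ^ m"
  proof -
    have "(3 :: real) \<le> 1.13 ^ 9" by (simp add: power_divide)
    also have "\<dots> \<le> 1.13 ^ m" using m9 by (intro power_increasing) auto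
    finally show ?thesis .
  qed
  then have "3 * x ^ m \<le> 1.13 ^ m * x ^ m" using x by (intro mult_right_mono) auto
  ultimately show ?thesis by linarith
qed

theorem theorem2p2:
  fixes m n :: nat
  assumes "m \<ge> 2"
    and "real n \<ge> N1 m"
  shows "\<bar>y_hat n\<bar> < (3 / 2) ^ (m + 1) * mu_hat n powi (- int m)"
proof -
  have n: "n \<ge> 184" and n2: "9 / (4 * pi\<^sup>2) * (N0 m)\<^sup>2 \<le> real n"
    using assms(2) by (auto simp: N1_def)
  \<comment> \<open>x is the gap between the exponents mu_hat n and mu_hat n / 3. Since x^2 = (4
    pi^2 / 9) n, the second entry of the maximum in \<open>N1\<close> says precisely that (N0 m)^2
    <= x^2, and the first entry, 184, gives x >= 28.3.\<close>
  define x where "x = 2 / 3 * mu_hat n"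
  have sq: "sqrt (real n) \<ge> 13.56" by (rule real_le_rsqrt) (use n in \<open>simp add: power2_eq_square\<close>)
  have mu: "mu_hat n \<ge> 42.5"
  proof -
    have "3.1415 * 13.56 \<le> mu_hat n"
      unfolding mu_hat_def using sq pi_approx(1) by (intro mult_mono) auto
    then show ?thesis by simp
  qed
  have "N0 m \<le> x"
  proof -
    have "(N0 m)\<^sup>2 = (9 / (4 * pi\<^sup>2) * (N0 m)\<^sup>2) * (4 * pi\<^sup>2 / 9)" by simp
    also have "\<dots> \<le> real n * (4 * pi\<^sup>2 / 9)" by (intro mult_right_mono n2) simp
    also have "\<dots> = x\<^sup>2" by (simp add: x_def mu_hat_def power_mult_distrib power_divide)
    finally show ?thesis by (rule power2_le_imp_le) (use mu in \<open>simp add: x_def\<close>)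
  qed
  moreover have "x \<ge> 28.3" using mu by (simp add: x_def)
  ultimately have xm: "3 * x ^ m \<le> exp x" by (intro power_le_exp assms(1)) auto
  have x0: "x > 0" using mu by (simp add: x_def)
  define c where "c = (1 - 1 / mu_hat n) / (8 * real n)"
  have c: "c > 0" using mu n by (simp add: c_def)
  have T: "T_hat n = c * exp (mu_hat n)" by (simp add: T_hat_def c_def)
  have "\<bar>R_hat n\<bar> < 4.5 * (c * exp (mu_hat n / 3))"
  proof -
    have "4.5 * (1 - 1 / mu_hat n) * exp (mu_hat n / 3) / (8 * real n) = 4.5 * (c * exp (mu_hat n / 3))"
      unfolding c_def by simp
    then show ?thesis using pbar_error_bound[OF n] unfolding R_hat_def by (simp only:)
  qed
  also have "c * exp (mu_hat n / 3) = T_hat n * exp (- x)"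
    unfolding T x_def by (simp add: mult.assoc mult_exp_exp)
  finally have "\<bar>R_hat n\<bar> < 4.5 * exp (- x) * T_hat n" by (simp add: mult_ac)
  moreover have T0: "T_hat n > 0" unfolding T using c by simp
  ultimately have "\<bar>y_hat n\<bar> < 4.5 * exp (- x)"
    unfolding y_hat_def abs_divide by (simp add: divide_less_eq)
  \<comment> \<open>4.5/3 = 3/2 is the additional factor in (3/2)^(m + 1); the other m factors come
    from x = 2/3 \<open>mu_hat n\<close>.\<close>
  also have "\<dots> \<le> 1.5 / x ^ m"
    using xm x0 by (simp add: exp_minus field_simps)
  also have "\<dots> = (3 / 2) ^ (m + 1) * mu_hat n powi (- int m)"
    unfolding x_def by (simp add: power_int_minus power_mult_distrib power_divide field_simps)
  finally show ?thesis .
qed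

end
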